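(* Let $d=1$, fix $m\in\mathbb N^{+}$, a period $X>0$ and $V_+>0$, and let $\tilde V\in\mathcal A(X,V_+)$ be a local maximizer of $G_m$ over $\mathcal A(X,V_+)$ with $G_m[\tilde V]>0$. Then there are only finitely many transitions (per period) between where $\tilde V$ equals $0$ and where it equals $V_+$; therefore $\tilde V$ is (a.e. equal to) a step function.
   Context: $\mathcal A(X,V_+)$ is the set of real-valued $V\in L^\infty(\mathbb R)$ that are $X$-periodic with $V(x)\in[0,V_+]$ for a.e. $x$. For $V\in\mathcal A(X,V_+)$ and $k\in[-\pi/X,\pi/X]$, $E_1(k)\le E_2(k)\le\cdots$ are the eigenvalues (with multiplicity) of $H_V(k)=-(\partial_x+ik)^2+V$ on $X$-periodic functions. Put $\alpha_m=\max_kE_m(k)$, $\beta_m=\min_kE_{m+1}(k)$ and $G_m[V]=\frac{\beta_m-\alpha_m}{(\alpha_m+\beta_m)/2}$. Local maximizer is understood with respect to the $L^\infty$ norm on $\mathcal A(X,V_+)$. *)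

theory Defs
  imports "HOL-Probability.Probability" "HOL-Library.Function_Algebras"
begin

section \<open>The admissible class\<close>

text \<open>Elements of $L^\infty$ are represented by Lebesgue measurable functions, and every condition
  on them is invariant under changes on null sets.\<close>

definition linf_norm :: "(real \<Rightarrow> real) \<Rightarrow> ereal" where
  "linf_norm f = esssup lebesgue (\<lambda>x. ereal \<bar>f x\<bar>)"

definition admissible :: "real \<Rightarrow> real \<Rightarrow> (real \<Rightarrow> real) set" where
  "admissible X Vp = {V. V \<in> borel_measurable lebesgue
      \<and> (AE x in lebesgue. V (x + X) = V x)
      \<and> (AE x in lebesgue. V x \<in> {0..Vp})}"

definition linf_local_maximizer ::
    "(real \<Rightarrow> real) set \<Rightarrow> ((real \<Rightarrow> real) \<Rightarrow> real) \<Rightarrow> (real \<Rightarrow> real) \<Rightarrow> bool" where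
  "linf_local_maximizer A G V \<longleftrightarrow>
     V \<in> A \<and> (\<exists>\<delta>>0. \<forall>W\<in>A. linf_norm (\<lambda>x. W x - V x) < ereal \<delta> \<longrightarrow> G W \<le> G V)"


section \<open>The Bloch operators and their eigenvalues\<close>

text \<open>\<open>f\<close> is the continuous representative of a function in $H^1_{loc}(\mathbb R)$ with weak
  derivative \<open>g\<close>.\<close>

definition H1_deriv :: "(real \<Rightarrow> complex) \<Rightarrow> (real \<Rightarrow> complex) \<Rightarrow> bool" where
  "H1_deriv f g \<longleftrightarrow> g \<in> borel_measurable lebesgue
      \<and> (\<forall>a b. set_integrable lebesgue {a..b} (\<lambda>x. (cmod (g x))\<^sup>2))
      \<and> (\<forall>a b. a \<le> b \<longrightarrow> (g has_integral (f b - f a)) {a..b})"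

text \<open>\<open>h\<close> is \<open>(\<partial>\<^sub>x + i k) f\<close>; being a weak derivative, \<open>h\<close> is determined only up to null sets.\<close>

definition bloch_deriv :: "real \<Rightarrow> (real \<Rightarrow> complex) \<Rightarrow> (real \<Rightarrow> complex) \<Rightarrow> bool" where
  "bloch_deriv k f h \<longleftrightarrow> (\<exists>g. H1_deriv f g \<and> h = (\<lambda>x. g x + \<i> * of_real k * f x))"

text \<open>\<open>u\<close> belongs to the domain of \<open>H\<^sub>V(k)\<close>, the \<open>X\<close>-periodic functions in $H^2_{loc}$, and
  \<open>h = - (\<partial>\<^sub>x + i k)\<^sup>2 u + V u\<close>. Periodicity of \<open>u\<close> forces periodicity of its derivative.\<close>

definition bloch_operator ::
    "real \<Rightarrow> (real \<Rightarrow> real) \<Rightarrow> real \<Rightarrow> (real \<Rightarrow> complex) \<Rightarrow> (real \<Rightarrow> complex) \<Rightarrow> bool" where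
  "bloch_operator X V k u h \<longleftrightarrow> (\<forall>x. u (x + X) = u x)
      \<and> (\<exists>u1 u2. bloch_deriv k u u1 \<and> bloch_deriv k u1 u2
            \<and> h = (\<lambda>x. - u2 x + of_real (V x) * u x))"

definition bloch_eigenspace ::
    "real \<Rightarrow> (real \<Rightarrow> real) \<Rightarrow> real \<Rightarrow> real \<Rightarrow> (real \<Rightarrow> complex) set" where
  "bloch_eigenspace X V k \<mu> =
     {u. \<exists>h. bloch_operator X V k u h \<and> (AE x in lebesgue. h x = of_real \<mu> * u x)}"

global_interpretation cfun: vector_space "\<lambda>(c::complex) (f::real \<Rightarrow> complex) x. c * f x"
  by unfold_locales (auto simp: fun_eq_iff algebra_simps)

text \<open>The operators are self-adjoint, so only real eigenvalues occur and the multiplicity is the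
  complex dimension of the eigenspace (zero if \<open>\<mu>\<close> is not an eigenvalue).\<close>

definition bloch_multiplicity :: "real \<Rightarrow> (real \<Rightarrow> real) \<Rightarrow> real \<Rightarrow> real \<Rightarrow> nat" where
  "bloch_multiplicity X V k \<mu> = cfun.dim (bloch_eigenspace X V k \<mu>)"

definition enumerates_eigenvalues ::
    "real \<Rightarrow> (real \<Rightarrow> real) \<Rightarrow> real \<Rightarrow> (nat \<Rightarrow> real) \<Rightarrow> bool" where
  "enumerates_eigenvalues X V k e \<longleftrightarrow> mono e
      \<and> (\<forall>\<mu>. finite {n. e n = \<mu>} \<and> card {n. e n = \<mu>} = bloch_multiplicity X V k \<mu>)"

text \<open>The band functions \<open>E\<^sub>m(k)\<close> are indexed by \<open>m \<ge> 1\<close>.\<close>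

definition bloch_E :: "real \<Rightarrow> (real \<Rightarrow> real) \<Rightarrow> nat \<Rightarrow> real \<Rightarrow> real" where
  "bloch_E X V m k = (THE e. enumerates_eigenvalues X V k e) (m - 1)"


section \<open>Spectral gaps\<close>

text \<open>The band functions are continuous in \<open>k\<close>, so supremum and infimum over the compact
  Brillouin zone are maximum and minimum.\<close>

definition gap_bottom :: "real \<Rightarrow> nat \<Rightarrow> (real \<Rightarrow> real) \<Rightarrow> real" where
  "gap_bottom X m V = (SUP k\<in>{- pi / X..pi / X}. bloch_E X V m k)"

definition gap_top :: "real \<Rightarrow> nat \<Rightarrow> (real \<Rightarrow> real) \<Rightarrow> real" where
  "gap_top X m V = (INF k\<in>{- pi / X..pi / X}. bloch_E X V (m + 1) k)"

definition gap_ratio :: "real \<Rightarrow> nat \<Rightarrow> (real \<Rightarrow> real) \<Rightarrow> real" where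
  "gap_ratio X m V =
     (gap_top X m V - gap_bottom X m V) / ((gap_bottom X m V + gap_top X m V) / 2)"


section \<open>Transitions and step functions\<close>

text \<open>As \<open>V\<close> is defined only almost everywhere, a transition between the values \<open>a\<close> and \<open>b\<close> is a
  point each of whose neighbourhoods meets both level sets in positive measure.\<close>

definition transitions :: "(real \<Rightarrow> real) \<Rightarrow> real \<Rightarrow> real \<Rightarrow> real set" where
  "transitions V a b = {x. \<forall>\<epsilon>>0.
      0 < emeasure lebesgue {y\<in>{x - \<epsilon><..<x + \<epsilon>}. V y = a} \<and>
      0 < emeasure lebesgue {y\<in>{x - \<epsilon><..<x + \<epsilon>}. V y = b}}"

definition periodic_step_function :: "real \<Rightarrow> (real \<Rightarrow> real) \<Rightarrow> bool" where
  "periodic_step_function X W \<longleftrightarrow> (\<forall>x. W (x + X) = W x)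
      \<and> (\<exists>(n::nat) p c. p 0 = 0 \<and> p n = X \<and> strict_mono_on {..n} p
            \<and> (\<forall>i<n. \<forall>x\<in>{p i<..<p (Suc i)}. W x = c i))"

end

theory Submission
  imports Defs
begin

text \<open>Write the Hill equation in Pruefer form and let \<open>rot\<close> be the angle by which a solution turns
  over one period. The \<open>m\<close>-th gap is the set of \<open>\<mu>\<close> for which \<open>m \<pi>\<close> lies between the minimum and the
  maximum of \<open>rot\<close> over all initial angles, so a one-sided bound on a gap edge of a perturbed
  potential needs only one trajectory. Let \<open>u\<close>, \<open>v\<close> be normalised solutions realising the lower edge
  \<open>\<alpha>\<close> and the upper edge \<open>\<beta>\<close>. Perturbing \<open>V\<close> by \<open>\<eta>\<close> moves the edges by at most (at least) the
  integrals of \<open>\<eta> u\<^sup>2\<close> and \<open>\<eta> v\<^sup>2\<close>, and maximality forces \<open>V = V\<^sub>+\<close> where \<open>f = \<alpha> v\<^sup>2 - \<beta> u\<^sup>2\<close> is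
  positive and \<open>V = 0\<close> where it is negative. Finally \<open>f\<close> has finitely many zeros, since \<open>v / u\<close>
  takes there one of two values and \<open>u v' - u' v\<close> has derivative \<open>(\<alpha> - \<beta>) u v\<close> with finitely many
  zeros (Rolle).\<close>

section \<open>Indefinite integrals of locally bounded functions\<close>

text \<open>\<open>V\<close> is only bounded and measurable, so solutions need not be twice
  differentiable, and all identities are stated through integrals with locally bounded integrands.
  The gap is defined by lists of eigenvalues with multiplicity, one list for each \<open>k\<close>;
  these must be identified before rotation angles can say anything about it. The bridge is the trace
  \<open>disc\<close> of the monodromy matrix: inside every band it is strictly monotone between 2
  and -2, so the value 2 cos(kX) picks exactly one point of each band, and an eigenvalue is double
  exactly when the monodromy is plus or minus the identity. The weights in \<open>f\<close> arise
  because the gap ratio is an increasing function of \<beta> / \<alpha>, whose rate of change has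
  the sign of \<alpha> \<beta>' - \<beta> \<alpha>'. The edges are never differentiated: strict
  one-sided bounds along a segment of admissible potentials already contradict maximality.
  Nonnegativity of \<open>V\<close> makes \<alpha> positive, which gives both weights of
  \<open>f\<close> the sign required for its finitely many zeros.\<close>

abbreviation loc_bounded :: "(real \<Rightarrow> 'a::real_normed_vector) \<Rightarrow> bool" where
  "loc_bounded f \<equiv> \<forall>a b. \<exists>K. \<forall>x\<in>{a..b}. norm (f x) \<le> K"

text \<open>A primitive of a fixed Borel integrand, not of a class modulo null sets. Local
  boundedness makes \<open>F\<close> locally Lipschitz, so that product and chain rule follow from
  elementary estimates instead of differentiation almost everywhere.\<close>

definition lprim :: "(real \<Rightarrow> 'a::euclidean_space) \<Rightarrow> (real \<Rightarrow> 'a) \<Rightarrow> bool" where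
  "lprim F f \<longleftrightarrow> f \<in> borel_measurable borel
      \<and> loc_bounded f
      \<and> (\<forall>a b. a \<le> b \<longrightarrow> (f has_integral (F b - F a)) {a..b})"

lemma locally_bounded_nonneg:
  assumes "loc_bounded f"
  obtains K where "K \<ge> 0" "\<And>x::real. x \<in> {a..b} \<Longrightarrow> norm (f x) \<le> K"
proof -
  obtain K where "\<forall>x\<in>{a..b}. norm (f x) \<le> K" using assms by blast
  then have "\<And>x. x \<in> {a..b} \<Longrightarrow> norm (f x) \<le> max K 0" by fastforce
  then show thesis using that[of "max K 0"] by simp
qed

lemma lprim_measurable: "lprim F f \<Longrightarrow> f \<in> borel_measurable borel"
  by (simp add: lprim_def)

lemma lprim_integral: "lprim F f \<Longrightarrow> a \<le> b \<Longrightarrow> (f has_integral (F b - F a)) {a..b}"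
  by (simp add: lprim_def)

lemma lprim_bounded:
  assumes "lprim F f"
  obtains K where "K \<ge> 0" "\<And>x. x \<in> {a..b} \<Longrightarrow> norm (f x) \<le> K"
  using locally_bounded_nonneg[of f a b] assms that unfolding lprim_def by blast

lemma has_integral_interval_bound:
  fixes f :: "real \<Rightarrow> 'a::euclidean_space"
  assumes "(f has_integral i) {a..b}" "a \<le> b" "0 \<le> K" "\<And>x. x \<in> {a..b} \<Longrightarrow> norm (f x) \<le> K"
  shows "norm i \<le> K * (b - a)"
  using has_integral_bound[of K f i a b] assms by simp

lemma lprim_lipschitz:
  assumes "lprim F f"
  obtains K where "K \<ge> 0" "\<And>x y. x \<in> {a..b} \<Longrightarrow> y \<in> {a..b} \<Longrightarrow> norm (F y - F x) \<le> K * \<bar>y - x\<bar>"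
proof -
  obtain K where K: "K \<ge> 0" "\<And>x. x \<in> {a..b} \<Longrightarrow> norm (f x) \<le> K"
    using lprim_bounded[OF assms] by blast
  have *: "norm (F y - F x) \<le> K * (y - x)" if "x \<in> {a..b}" "y \<in> {a..b}" "x \<le> y" for x y
    by (rule has_integral_interval_bound[OF lprim_integral[OF assms]]) (use K that in auto)
  have "norm (F y - F x) \<le> K * \<bar>y - x\<bar>" if "x \<in> {a..b}" "y \<in> {a..b}" for x y
    using *[OF that] *[OF that(2) that(1)] by (cases "x \<le> y") (auto simp: norm_minus_commute)
  with K(1) show thesis using that by blast
qed

lemma lprim_isCont:
  assumes "lprim F f" shows "isCont F x"
proof -
  obtain K where K: "K \<ge> 0" "\<And>u v. u \<in> {x-1..x+1} \<Longrightarrow> v \<in> {x-1..x+1} \<Longrightarrow> norm (F v - F u) \<le> K * \<bar>v - u\<bar>"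
    using lprim_lipschitz[OF assms] by blast
  have "eventually (\<lambda>y. y \<in> {x-1<..<x+1}) (at x)"
    by (rule eventually_at_in_open') auto
  then have "eventually (\<lambda>y. norm (F y - F x) \<le> K * \<bar>y - x\<bar>) (at x)"
    by eventually_elim (use K in auto)
  moreover have "((\<lambda>y. K * \<bar>y - x\<bar>) \<longlongrightarrow> K * \<bar>x - x\<bar>) (at x)"
    by (intro tendsto_intros)
  then have "((\<lambda>y. K * \<bar>y - x\<bar>) \<longlongrightarrow> 0) (at x)" by simp
  ultimately have "((\<lambda>y. F y - F x) \<longlongrightarrow> 0) (at x)"
    by (rule Lim_null_comparison)
  then show ?thesis unfolding isCont_def by (rule LIM_zero_cancel)
qed

lemma lprim_continuous_on: "lprim F f \<Longrightarrow> continuous_on S F"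
  by (simp add: continuous_at_imp_continuous_on lprim_isCont)

lemma lprim_measurable_prim: "lprim F f \<Longrightarrow> F \<in> borel_measurable borel"
  by (simp add: borel_measurable_continuous_onI lprim_continuous_on)

lemma bounded_on_continuous:
  fixes F :: "real \<Rightarrow> 'a::euclidean_space"
  assumes "continuous_on UNIV F"
  shows "loc_bounded F"
proof (intro allI)
  fix a b
  have "compact (F ` {a..b})"
    by (rule compact_continuous_image[OF continuous_on_subset[OF assms]]) auto
  then have "bounded (F ` {a..b})" by (rule compact_imp_bounded)
  then show "\<exists>K. \<forall>x\<in>{a..b}. norm (F x) \<le> K" unfolding bounded_iff by auto
qed

lemma borel_bounded_integrable_on:
  fixes f :: "real \<Rightarrow> 'a::euclidean_space"
  assumes "f \<in> borel_measurable borel" "\<And>x. x \<in> {a..b} \<Longrightarrow> norm (f x) \<le> K"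
  shows "f integrable_on {a..b}" "set_integrable lborel {a..b} f"
proof -
  show *: "set_integrable lborel {a..b} f"
    unfolding set_integrable_def
  proof (rule integrableI_bounded_set[where A="{a..b}" and B=K])
    show "(\<lambda>x. indicat_real {a..b} x *\<^sub>R f x) \<in> borel_measurable lborel" using assms by simp
    show "emeasure lborel {a..b} < \<infinity>" by (simp add: emeasure_lborel_Icc_eq)
  qed (use assms in \<open>auto simp: indicator_def\<close>)
  then show "f integrable_on {a..b}" by (rule set_borel_integral_eq_integral)
qed

text \<open>Two integrals stand for one oriented integral: the one over \<open>{0..x}\<close>
  vanishes for negative \<open>x\<close>, the one over \<open>{x..0}\<close> for positive
  \<open>x\<close>.\<close>

lemma lprim_exists:
  fixes f :: "real \<Rightarrow> 'a::euclidean_space"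
  assumes "f \<in> borel_measurable borel" "loc_bounded f"
  shows "lprim (\<lambda>x. c + integral {0..x} f - integral {x..0} f) f"
proof -
  have int: "f integrable_on {a..b}" for a b
  proof -
    obtain K where "\<forall>x\<in>{a..b}. norm (f x) \<le> K" using assms(2) by blast
    then show ?thesis using borel_bounded_integrable_on(1)[OF assms(1), of a b K] by blast
  qed
  have "(f has_integral (integral {0..b} f - integral {b..0} f - (integral {0..a} f - integral {a..0} f))) {a..b}"
    if "a \<le> b" for a b
  proof -
    have "integral {0..b} f - integral {b..0} f - (integral {0..a} f - integral {a..0} f) = integral {a..b} f"
    proof -
      consider "0 \<le> a" | "a \<le> 0" "0 \<le> b" | "b \<le> 0" using that by linarith
      then show ?thesis
      proof cases
        case 1
        then have "integral {0..a} f + integral {a..b} f = integral {0..b} f"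
          using Henstock_Kurzweil_Integration.integral_combine[OF _ that int] by blast
        with 1 that show ?thesis by (cases "a = 0"; cases "b = 0") (auto simp: algebra_simps)
      next
        case 2
        then have "integral {a..0} f + integral {0..b} f = integral {a..b} f"
          using Henstock_Kurzweil_Integration.integral_combine[OF _ _ int] by blast
        with 2 that show ?thesis by (cases "a = 0"; cases "b = 0") (auto simp: algebra_simps)
      next
        case 3
        then have "integral {a..b} f + integral {b..0} f = integral {a..0} f"
          using Henstock_Kurzweil_Integration.integral_combine[OF that _ int] by blast
        with 3 that show ?thesis by (cases "a = 0"; cases "b = 0") (auto simp: algebra_simps)
      qed
    qed
    then show ?thesis using int integrable_integral by metis
  qed
  then show ?thesis using assms unfolding lprim_def by (simp add: algebra_simps)
qed

lemma zero_derivative_const: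
  fixes h :: "real \<Rightarrow> 'a::euclidean_space"
  assumes "\<And>x. (h has_vector_derivative 0) (at x)"
  shows "h x = h y"
proof -
  have "\<And>x. x \<in> UNIV \<Longrightarrow> (h has_derivative (\<lambda>h. 0)) (at x within UNIV)"
    using assms by (simp add: has_vector_derivative_def)
  from has_derivative_zero_constant[OF convex_UNIV this] show ?thesis by auto
qed

text \<open>Quadratic increments force a zero derivative everywhere. The product rule uses this for
  the difference between a product and its candidate primitive.\<close>

lemma quadratic_const:
  fixes h :: "real \<Rightarrow> 'a::euclidean_space"
  assumes "\<And>a b. \<exists>C. \<forall>x y. a \<le> x \<and> x \<le> y \<and> y \<le> b \<longrightarrow> norm (h y - h x) \<le> C * (y - x)\<^sup>2"
  shows "h x = h y"
proof (rule zero_derivative_const)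
  fix x
  obtain C where C: "\<And>u v. x-1 \<le> u \<Longrightarrow> u \<le> v \<Longrightarrow> v \<le> x+1 \<Longrightarrow> norm (h v - h u) \<le> C * (v - u)\<^sup>2"
    using assms[of "x-1" "x+1"] by blast
  have C': "norm (h y - h x) \<le> C * (y - x)\<^sup>2" if "y \<in> {x-1<..<x+1}" for y
    using C[of x y] C[of y x] that by (cases "x \<le> y") (auto simp: norm_minus_commute power2_commute)
  have "((\<lambda>y. norm (h y - h x - (y - x) *\<^sub>R 0) / norm (y - x)) \<longlongrightarrow> 0) (at x)"
  proof (rule Lim_null_comparison)
    have "eventually (\<lambda>y. y \<in> {x-1<..<x+1} - {x}) (at x)"
      by (rule eventually_at_in_open) auto
    then show "eventually (\<lambda>y. norm (norm (h y - h x - (y - x) *\<^sub>R 0) / norm (y - x)) \<le> C * \<bar>y - x\<bar>) (at x)"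
    proof eventually_elim
      case (elim y)
      then have "norm (h y - h x) \<le> (C * \<bar>y - x\<bar>) * \<bar>y - x\<bar>" using C'[of y]
        by (simp add: power2_eq_square mult.assoc flip: abs_mult)
      then show ?case using elim by (simp add: pos_divide_le_eq)
    qed
    have "((\<lambda>y. C * \<bar>y - x\<bar>) \<longlongrightarrow> C * \<bar>x - x\<bar>) (at x)" by (intro tendsto_intros)
    then show "((\<lambda>y. C * \<bar>y - x\<bar>) \<longlongrightarrow> 0) (at x)" by simp
  qed
  then show "(h has_vector_derivative 0) (at x)"
    unfolding has_vector_derivative_def has_derivative_iff_norm
    using bounded_linear_zero by simp
qed


text \<open>The weaker hypothesis serves the chain rule, where the outer derivative is merely
  continuous and gives no quadratic rate.\<close>

lemma small_o_const:
  fixes h :: "real \<Rightarrow> 'a::euclidean_space"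
  assumes "\<And>x e. e > 0 \<Longrightarrow> \<exists>d>0. \<forall>y. \<bar>y - x\<bar> < d \<longrightarrow> norm (h y - h x) \<le> e * \<bar>y - x\<bar>"
  shows "h x = h y"
proof (rule zero_derivative_const)
  fix x
  show "(h has_vector_derivative 0) (at x)"
    unfolding has_vector_derivative_def has_derivative_at_alt using assms by simp
qed

lemma lprim_diff_eq:
  assumes "lprim F f" "lprim G f"
  shows "F x - F y = G x - G y"
proof -
  have *: "F b - F a = G b - G a" if "a \<le> b" for a b
    using has_integral_unique lprim_integral[OF assms(1) that] lprim_integral[OF assms(2) that] by blast
  show ?thesis using *[of x y] *[of y x]
    by (cases "x \<le> y") (auto simp: algebra_simps)
qed

lemma lprim_zero_const: "lprim F (\<lambda>_. 0) \<Longrightarrow> F x = F y"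
  using lprim_diff_eq[of F "\<lambda>_. 0" "\<lambda>_. 0" x y] by (simp add: lprim_def)

lemma lprim_obtain:
  fixes f :: "real \<Rightarrow> 'a::euclidean_space"
  assumes "f \<in> borel_measurable borel" "loc_bounded f"
  obtains F where "F 0 = c" "lprim F f"
  by (rule that[OF _ lprim_exists[OF assms, of c]]) simp

lemma lprim_locally_bounded: "lprim F f \<Longrightarrow> loc_bounded f"
  by (simp add: lprim_def)

lemma lprim_prim_locally_bounded: "lprim F f \<Longrightarrow> loc_bounded F"
  by (intro bounded_on_continuous lprim_continuous_on)

lemma locally_bounded_add:
  fixes f g :: "real \<Rightarrow> 'a::real_normed_vector"
  assumes "loc_bounded f" "loc_bounded g"
  shows "loc_bounded (\<lambda>x. f x + g x)"
proof (intro allI)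
  fix a b
  obtain K L where "\<forall>x\<in>{a..b}. norm (f x) \<le> K" "\<forall>x\<in>{a..b}. norm (g x) \<le> L" using assms by meson
  then have "\<forall>x\<in>{a..b}. norm (f x + g x) \<le> K + L" by (meson norm_triangle_mono)
  then show "\<exists>K. \<forall>x\<in>{a..b}. norm (f x + g x) \<le> K" by blast
qed

lemma locally_bounded_mult:
  fixes f g :: "real \<Rightarrow> 'a::real_normed_algebra"
  assumes "loc_bounded f" "loc_bounded g"
  shows "loc_bounded (\<lambda>x. f x * g x)"
proof (intro allI)
  fix a b
  obtain K where K: "K \<ge> 0" "\<And>x. x \<in> {a..b} \<Longrightarrow> norm (f x) \<le> K"
    using locally_bounded_nonneg[OF assms(1)] by blast
  obtain L where L: "L \<ge> 0" "\<And>x. x \<in> {a..b} \<Longrightarrow> norm (g x) \<le> L"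
    using locally_bounded_nonneg[OF assms(2)] by blast
  have "norm (f x * g x) \<le> K * L" if "x \<in> {a..b}" for x
    using norm_mult_ineq[of "f x" "g x"] mult_mono[OF K(2)[OF that] L(2)[OF that] K(1) norm_ge_zero]
    by linarith
  then show "\<exists>K. \<forall>x\<in>{a..b}. norm (f x * g x) \<le> K" by blast
qed

section \<open>Rules of calculus for primitives\<close>

lemma lprim_add:
  assumes "lprim F f" "lprim G g" shows "lprim (\<lambda>x. F x + G x) (\<lambda>x. f x + g x)"
proof -
  have "((\<lambda>x. f x + g x) has_integral (F b + G b) - (F a + G a)) {a..b}" if "a \<le> b" for a b
    using has_integral_add[OF lprim_integral[OF assms(1) that] lprim_integral[OF assms(2) that]]
    by (simp add: algebra_simps)
  then show ?thesis
    using assms locally_bounded_add[OF lprim_locally_bounded lprim_locally_bounded, OF assms]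
    unfolding lprim_def by (simp add: borel_measurable_add)
qed

lemma lprim_bounded_linear:
  assumes "lprim F f" "bounded_linear h"
  shows "lprim (\<lambda>x. h (F x)) (\<lambda>x. h (f x))"
proof -
  interpret bounded_linear h by fact
  have "((\<lambda>x. h (f x)) has_integral h (F b) - h (F a)) {a..b}" if "a \<le> b" for a b
    using has_integral_linear[OF lprim_integral[OF assms(1) that] assms(2)] by (simp add: o_def diff)
  moreover have "(\<lambda>x. h (f x)) \<in> borel_measurable borel"
    using lprim_measurable[OF assms(1)] borel_measurable_continuous_onI[OF linear_continuous_on[OF assms(2)]]
    by measurable
  moreover have "\<exists>K. \<forall>x\<in>{a..b}. norm (h (f x)) \<le> K" for a b
  proof -
    obtain K where K: "K \<ge> 0" "\<And>x. norm (h x) \<le> norm x * K" using nonneg_bounded by blast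
    obtain L where L: "L \<ge> 0" "\<And>x. x \<in> {a..b} \<Longrightarrow> norm (f x) \<le> L"
      using lprim_bounded[OF assms(1)] by blast
    have "\<forall>x\<in>{a..b}. norm (h (f x)) \<le> L * K"
      using K L by (meson mult_right_mono order_trans)
    then show ?thesis by blast
  qed
  ultimately show ?thesis unfolding lprim_def by simp
qed

lemma lprim_cmult:
  fixes F :: "real \<Rightarrow> 'a::{euclidean_space,real_normed_algebra}"
  shows "lprim F f \<Longrightarrow> lprim (\<lambda>x. c * F x) (\<lambda>x. c * f x)"
  by (rule lprim_bounded_linear[OF _ bounded_linear_mult_right])

lemma lprim_minus: "lprim F f \<Longrightarrow> lprim (\<lambda>x. - F x) (\<lambda>x. - f x)"
  by (rule lprim_bounded_linear[OF _ bounded_linear_minus[OF bounded_linear_ident]])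

lemma lprim_diff:
  assumes "lprim F f" "lprim G g" shows "lprim (\<lambda>x. F x - G x) (\<lambda>x. f x - g x)"
  using lprim_add[OF assms(1) lprim_minus[OF assms(2)]] by simp

text \<open>The product is compared with a primitive \<open>P\<close> of the expected integrand.
  Over \<open>{x..y}\<close> the discrepancy is the integral of
  \<open>f s * (G y - G s) + (F x - F s) * g s\<close>, whose terms are O(y - x) by the Lipschitz
  bounds.\<close>

lemma lprim_mult:
  fixes F G :: "real \<Rightarrow> 'a::{euclidean_space,real_normed_algebra}"
  assumes F: "lprim F f" and G: "lprim G g"
  shows "lprim (\<lambda>x. F x * G x) (\<lambda>x. f x * G x + F x * g x)"
proof -
  have [measurable]: "f \<in> borel_measurable borel" "g \<in> borel_measurable borel"
      "F \<in> borel_measurable borel" "G \<in> borel_measurable borel"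
    using F G by (auto intro: lprim_measurable lprim_measurable_prim)
  obtain P where P: "lprim P (\<lambda>x. f x * G x + F x * g x)"
    by (rule lprim_obtain[of "\<lambda>x. f x * G x + F x * g x" 0])
       (measurable, intro locally_bounded_add locally_bounded_mult lprim_locally_bounded[OF F]
         lprim_locally_bounded[OF G] lprim_prim_locally_bounded[OF F] lprim_prim_locally_bounded[OF G])
  define h where "h = (\<lambda>x. F x * G x - P x)"
  have "h x = h y" for x y
  proof (rule quadratic_const[of h])
    fix a b
    obtain K where K: "K \<ge> 0" "\<And>x. x \<in> {a..b} \<Longrightarrow> norm (f x) \<le> K" using lprim_bounded[OF F] by blast
    obtain L where L: "L \<ge> 0" "\<And>x. x \<in> {a..b} \<Longrightarrow> norm (g x) \<le> L" using lprim_bounded[OF G] by blast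
    obtain K' where K': "K' \<ge> 0" "\<And>x y. x \<in> {a..b} \<Longrightarrow> y \<in> {a..b} \<Longrightarrow> norm (F y - F x) \<le> K' * \<bar>y - x\<bar>"
      using lprim_lipschitz[OF F] by blast
    obtain L' where L': "L' \<ge> 0" "\<And>x y. x \<in> {a..b} \<Longrightarrow> y \<in> {a..b} \<Longrightarrow> norm (G y - G x) \<le> L' * \<bar>y - x\<bar>"
      using lprim_lipschitz[OF G] by blast
    have "norm (h y - h x) \<le> (K * L' + K' * L) * (y - x)\<^sup>2" if xy: "a \<le> x" "x \<le> y" "y \<le> b" for x y
    proof -
      \<comment> \<open>Freezing \<open>G y\<close> and \<open>F x\<close> writes the increment of
        the product as an integral of \<open>f\<close> and \<open>g\<close> with constant
        coefficients.\<close>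
      have "((\<lambda>s. (f s * G y + F x * g s) - (f s * G s + F s * g s)) has_integral
          ((F y - F x) * G y + F x * (G y - G x)) - (P y - P x)) {x..y}"
        by (intro has_integral_diff has_integral_add has_integral_mult_left has_integral_mult_right
             lprim_integral F G P xy)
      then have "((\<lambda>s. f s * (G y - G s) + (F x - F s) * g s) has_integral (h y - h x)) {x..y}"
        by (simp add: h_def algebra_simps)
      moreover have "norm (f s * (G y - G s) + (F x - F s) * g s) \<le> (K * L' + K' * L) * (y - x)"
        if s: "s \<in> {x..y}" for s
      proof -
        have "norm (f s * (G y - G s)) \<le> K * (L' * (y - x))"
        proof (rule order_trans[OF norm_mult_ineq mult_mono])
          show "norm (f s) \<le> K" using K s xy by auto
          have "norm (G y - G s) \<le> L' * \<bar>y - s\<bar>" using L'(2)[of s y] s xy by auto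
          also have "\<dots> \<le> L' * (y - x)" by (rule mult_left_mono) (use s L' in auto)
          finally show "norm (G y - G s) \<le> L' * (y - x)" .
        qed (use K in auto)
        moreover have "norm ((F x - F s) * g s) \<le> (K' * (y - x)) * L"
        proof (rule order_trans[OF norm_mult_ineq mult_mono])
          show "norm (g s) \<le> L" using L s xy by auto
          have "norm (F x - F s) \<le> K' * \<bar>x - s\<bar>" using K'(2)[of s x] s xy by auto
          also have "\<dots> \<le> K' * (y - x)" by (rule mult_left_mono) (use s K' in auto)
          finally show "norm (F x - F s) \<le> K' * (y - x)" .
        qed (use K' xy in auto)
        ultimately show ?thesis using norm_triangle_ineq[of "f s * (G y - G s)" "(F x - F s) * g s"]
          by (simp add: algebra_simps)
      qed
      ultimately have "norm (h y - h x) \<le> (K * L' + K' * L) * (y - x) * (y - x)"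
        using has_integral_interval_bound[of _ "h y - h x" x y "(K * L' + K' * L) * (y - x)"] xy K(1) L(1) K'(1) L'(1)
        by simp
      then show ?thesis by (simp add: power2_eq_square mult.assoc)
    qed
    then show "\<exists>C. \<forall>x y. a \<le> x \<and> x \<le> y \<and> y \<le> b \<longrightarrow> norm (h y - h x) \<le> C * (y - x)\<^sup>2" by blast
  qed
  note h = this
  have *: "F b * G b - F a * G a = P b - P a" for a b
    using h[of b a] unfolding h_def by (simp add: algebra_simps)
  show ?thesis using P unfolding lprim_def * .
qed

text \<open>By the mean value theorem the increment of the composition is \<open>\<phi>' z\<close>
  times that of \<open>F\<close>, with one \<open>z\<close> for the whole interval; replacing
  \<open>\<phi>' z\<close> by \<open>\<phi>' (F s)\<close> costs only the oscillation of
  \<open>\<phi>'\<close> near \<open>F x\<close>.\<close>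

lemma lprim_chain:
  fixes F :: "real \<Rightarrow> real"
  assumes F: "lprim F f" and \<phi>: "\<And>x. (\<phi> has_real_derivative \<phi>' x) (at x)" and c: "continuous_on UNIV \<phi>'"
  shows "lprim (\<lambda>x. \<phi> (F x)) (\<lambda>x. \<phi>' (F x) * f x)"
proof -
  have cF: "continuous_on UNIV (\<lambda>x. \<phi>' (F x))"
    using continuous_on_compose2[OF c lprim_continuous_on[OF F]] by simp
  have [measurable]: "f \<in> borel_measurable borel" "(\<lambda>x. \<phi>' (F x)) \<in> borel_measurable borel"
    using F cF by (auto intro: lprim_measurable borel_measurable_continuous_onI)
  obtain P where P: "lprim P (\<lambda>x. \<phi>' (F x) * f x)"
    by (rule lprim_obtain[of "\<lambda>x. \<phi>' (F x) * f x" 0])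
       (measurable, rule locally_bounded_mult[OF bounded_on_continuous[OF cF] lprim_locally_bounded[OF F]])
  define h where "h = (\<lambda>x. \<phi> (F x) - P x)"
  have "h x = h y" for x y
  proof (rule small_o_const[of h])
    fix x e :: real assume e: "e > 0"
    obtain K where K: "K \<ge> 0" "\<And>u. u \<in> {x-1..x+1} \<Longrightarrow> norm (f u) \<le> K" using lprim_bounded[OF F] by blast
    \<comment> \<open>The 2 is there because \<open>\<phi>' z\<close> and
      \<open>\<phi>' (F s)\<close> each lie within \<open>e'\<close> of
      \<open>\<phi>' (F x)\<close>; \<open>K + 1\<close> keeps the denominator positive.\<close>
    define e' where "e' = e / (2 * (K + 1))"
    have e': "e' > 0" using e K by (simp add: e'_def)
    have "isCont \<phi>' (F x)" using c by (simp add: continuous_on_eq_continuous_at)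
    then obtain d1 where d1: "d1 > 0" "\<And>z. \<bar>z - F x\<bar> < d1 \<Longrightarrow> \<bar>\<phi>' z - \<phi>' (F x)\<bar> < e'"
      using e' unfolding continuous_at_eps_delta dist_real_def by blast
    obtain d2 where d2: "d2 > 0" "\<And>z. \<bar>z - x\<bar> < d2 \<Longrightarrow> \<bar>F z - F x\<bar> < d1"
      using lprim_isCont[OF F, of x] d1(1) unfolding continuous_at_eps_delta dist_real_def by blast
    have main: "\<bar>h v - h u\<bar> \<le> e * (v - u)"
      if uv: "u \<le> v" "\<bar>u - x\<bar> < min d2 1" "\<bar>v - x\<bar> < min d2 1" for u v
    proof -
      have "\<exists>z. \<bar>z - F x\<bar> < d1 \<and> \<phi> (F v) - \<phi> (F u) = \<phi>' z * (F v - F u)"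
      proof -
        have Fuv: "\<bar>F u - F x\<bar> < d1" "\<bar>F v - F x\<bar> < d1" using d2 uv by auto
        consider "F u < F v" | "F v < F u" | "F u = F v" by linarith
        then show ?thesis
        proof cases
          case 1
          then obtain z where "F u < z" "z < F v" "\<phi> (F v) - \<phi> (F u) = (F v - F u) * \<phi>' z"
            using MVT2[of "F u" "F v" \<phi> \<phi>'] \<phi> by blast
          with Fuv show ?thesis by (intro exI[of _ z]) (auto simp: mult.commute)
        next
          case 2
          then obtain z where "F v < z" "z < F u" "\<phi> (F u) - \<phi> (F v) = (F u - F v) * \<phi>' z"
            using MVT2[of "F v" "F u" \<phi> \<phi>'] \<phi> by blast
          with Fuv show ?thesis by (intro exI[of _ z]) (auto simp: algebra_simps)
        next
          case 3
          with Fuv show ?thesis by (intro exI[of _ "F u"]) auto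
        qed
      qed
      then obtain z where z: "\<bar>z - F x\<bar> < d1" "\<phi> (F v) - \<phi> (F u) = \<phi>' z * (F v - F u)" by blast
      have "((\<lambda>s. \<phi>' z * f s - \<phi>' (F s) * f s) has_integral (\<phi>' z * (F v - F u) - (P v - P u))) {u..v}"
        by (intro has_integral_diff has_integral_mult_right lprim_integral F P uv)
      then have "((\<lambda>s. (\<phi>' z - \<phi>' (F s)) * f s) has_integral (h v - h u)) {u..v}"
      proof (rule back_subst[of "\<lambda>i. (_ has_integral i) _", OF back_subst[of "\<lambda>f. (f has_integral _) _"]])
        show "\<phi>' z * (F v - F u) - (P v - P u) = h v - h u" using z(2) by (simp add: h_def)
      qed (simp add: fun_eq_iff left_diff_distrib)
      moreover have "norm ((\<phi>' z - \<phi>' (F s)) * f s) \<le> e" if s: "s \<in> {u..v}" for s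
      proof -
        have "\<bar>s - x\<bar> < min d2 1" using s uv by auto
        then have "\<bar>\<phi>' (F s) - \<phi>' (F x)\<bar> < e'" "norm (f s) \<le> K" using d1 d2 K(2)[of s] by (auto simp: abs_less_iff)
        with d1(2)[OF z(1)] have "\<bar>\<phi>' z - \<phi>' (F s)\<bar> \<le> 2 * e'" "norm (f s) \<le> K + 1" by auto
        then have "\<bar>\<phi>' z - \<phi>' (F s)\<bar> * \<bar>f s\<bar> \<le> (2 * e') * (K + 1)" using e' by (intro mult_mono) auto
        also have "\<dots> = e" using K(1) by (simp add: e'_def field_simps)
        finally show ?thesis by (simp add: abs_mult)
      qed
      ultimately have "norm (h v - h u) \<le> e * (v - u)"
        using has_integral_interval_bound[of _ "h v - h u" u v e] uv e by simp
      then show ?thesis by simp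
    qed
    have "\<bar>h y - h x\<bar> \<le> e * \<bar>y - x\<bar>" if "\<bar>y - x\<bar> < min d2 1" for y
      using main[of x y] main[of y x] that d2(1) by (cases "x \<le> y") auto
    then show "\<exists>d>0. \<forall>y. \<bar>y - x\<bar> < d \<longrightarrow> norm (h y - h x) \<le> e * \<bar>y - x\<bar>"
      using d2(1) by (intro exI[of _ "min d2 1"]) auto
  qed
  note h = this
  have *: "\<phi> (F b) - \<phi> (F a) = P b - P a" for a b
    using h[of b a] unfolding h_def by linarith
  show ?thesis using P unfolding lprim_def * .
qed

lemma lprim_of_C1:
  fixes F :: "real \<Rightarrow> 'a::euclidean_space"
  assumes "\<And>x. (F has_vector_derivative f x) (at x)" "continuous_on UNIV f"
  shows "lprim F f"
proof -
  have "(f has_integral (F b - F a)) {a..b}" if "a \<le> b" for a b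
    by (rule fundamental_theorem_of_calculus[OF that]) (use assms(1) in \<open>auto intro: has_vector_derivative_at_within\<close>)
  then show ?thesis unfolding lprim_def
    using borel_measurable_continuous_onI[OF assms(2)] bounded_on_continuous[OF assms(2)] by blast
qed

lemma lprim_has_vector_derivative:
  assumes "lprim F f" "continuous_on UNIV f"
  shows "(F has_vector_derivative f x) (at x)"
proof -
  have "((\<lambda>u. integral {x-1..u} f) has_vector_derivative f x) (at x within {x-1..x+1})"
    by (rule integral_has_vector_derivative) (use assms in \<open>auto intro: continuous_on_subset\<close>)
  then have "((\<lambda>u. integral {x-1..u} f) has_vector_derivative f x) (at x)"
    by (simp add: at_within_Icc_at)
  then have "((\<lambda>u. F (x-1) + integral {x-1..u} f) has_vector_derivative 0 + f x) (at x)"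
    by (intro derivative_intros)
  then have *: "((\<lambda>u. F (x-1) + integral {x-1..u} f) has_vector_derivative f x) (at x)" by simp
  show ?thesis
  proof (rule has_vector_derivative_transform_within_open[OF *, of "{x-1<..<x+1}"])
    fix u assume "u \<in> {x-1<..<x+1}"
    then show "F (x-1) + integral {x-1..u} f = F u"
      using integral_unique[OF lprim_integral[OF assms(1), of "x-1" u]] by simp
  qed auto
qed

lemma lprim_mono:
  fixes F :: "real \<Rightarrow> real"
  assumes "lprim F f" "a \<le> b" "\<And>x. x \<in> {a..b} \<Longrightarrow> 0 \<le> f x"
  shows "F a \<le> F b"
  using has_integral_nonneg[OF lprim_integral[OF assms(1,2)] assms(3)] by simp

lemma lprim_strict_mono:
  fixes F :: "real \<Rightarrow> real"
  assumes F: "lprim F f" and ab: "a < b" and c: "continuous_on {a..b} f"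
    and nn: "\<And>x. x \<in> {a..b} \<Longrightarrow> 0 \<le> f x" and s: "s \<in> {a..b}" "f s \<noteq> 0"
  shows "F a < F b"
proof -
  have "integral {a..b} f = F b - F a" using lprim_integral[OF F] ab by (simp add: integral_unique)
  moreover have "integral {a..b} f \<noteq> 0" using integral_eq_0_iff[OF c ab] nn s by auto
  moreover have "F a \<le> F b" using lprim_mono[OF F _ nn] ab by simp
  ultimately show ?thesis by simp
qed

text \<open>Integrating factor: multiplication by \<open>exp (- C x)\<close> removes the homogeneous
  term \<open>c x * d x\<close>.\<close>

lemma linear_ode_factor:
  fixes d :: "real \<Rightarrow> real"
  assumes d: "lprim d (\<lambda>x. c x * d x + g x)" and C: "lprim C c"
  shows "lprim (\<lambda>x. d x * exp (- C x)) (\<lambda>x. g x * exp (- C x))"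
proof -
  have "lprim (\<lambda>x. exp (- C x)) (\<lambda>x. exp (- C x) * - c x)"
    by (rule lprim_chain[OF lprim_minus[OF C], of exp exp]) (auto intro: continuous_intros derivative_eq_intros)
  from lprim_mult[OF d this] show ?thesis
    by (rule back_subst[of "lprim _"]) (auto simp: algebra_simps)
qed

section \<open>The Pruefer angle\<close>

lemma lprim_abs_le:
  fixes F G :: "real \<Rightarrow> real"
  assumes F: "lprim F f" and G: "lprim G g" and ab: "a \<le> b" and le: "\<And>s. s \<in> {a..b} \<Longrightarrow> \<bar>f s\<bar> \<le> g s"
  shows "\<bar>F b - F a\<bar> \<le> G b - G a"
proof -
  have "G a - F a \<le> G b - F b"
    by (rule lprim_mono[OF lprim_diff[OF G F] ab]) (use le in \<open>fastforce simp: abs_le_iff\<close>)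
  moreover have "G a + F a \<le> G b + F b"
    by (rule lprim_mono[OF lprim_add[OF G F] ab]) (use le in \<open>fastforce simp: abs_le_iff\<close>)
  ultimately show ?thesis by linarith
qed

lemma lprim_linear: "lprim (\<lambda>x. M * x) (\<lambda>_. M)" for M :: real
  by (rule lprim_of_C1) (auto intro!: derivative_eq_intros continuous_intros
      simp flip: has_real_derivative_iff_has_vector_derivative)

lemma lprim_abs_le_linear:
  fixes F :: "real \<Rightarrow> real"
  assumes F: "lprim F f" and "\<And>s. \<bar>f s\<bar> \<le> M"
  shows "\<bar>F y - F x\<bar> \<le> M * \<bar>y - x\<bar>"
  using lprim_abs_le[OF F lprim_linear, of x y M] lprim_abs_le[OF F lprim_linear, of y x M] assms(2)
  by (cases "x \<le> y") (auto simp: algebra_simps abs_minus_commute)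

text \<open>Integration gains a factor \<open>1 / L\<close> in the exponentially weighted norm; this
  gain becomes the contraction constant of the fixed point argument.\<close>

lemma lprim_exp_bound:
  fixes F :: "real \<Rightarrow> real"
  assumes F: "lprim F f" and L: "L > 0" and M: "M \<ge> 0" and le: "\<And>s. \<bar>f s\<bar> \<le> M * exp (L * \<bar>s\<bar>)"
  shows "\<bar>F x - F 0\<bar> \<le> M / L * exp (L * \<bar>x\<bar>)"
proof -
  have E: "lprim (\<lambda>s. M / c * exp (c * s)) (\<lambda>s. M * exp (c * s))" if "c \<noteq> 0" for c
    by (rule lprim_of_C1) (use that in \<open>auto intro!: derivative_eq_intros continuous_intros
      simp flip: has_real_derivative_iff_has_vector_derivative\<close>)
  have "M / L \<ge> 0" using L M by simp
  show ?thesis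
  proof (cases "x \<ge> 0")
    case True
    have "\<bar>F x - F 0\<bar> \<le> M / L * exp (L * x) - M / L * exp (L * 0)"
    proof (rule lprim_abs_le[OF F E True])
      fix s assume "s \<in> {0..x}" then show "\<bar>f s\<bar> \<le> M * exp (L * s)" using le[of s] by simp
    qed (use L in auto)
    with \<open>M / L \<ge> 0\<close> True show ?thesis by simp
  next
    case False
    have "\<bar>F 0 - F x\<bar> \<le> M / (-L) * exp ((-L) * 0) - M / (-L) * exp ((-L) * x)"
    proof (rule lprim_abs_le[OF F E])
      fix s assume "s \<in> {x..0}" then show "\<bar>f s\<bar> \<le> M * exp (- L * s)" using le[of s] by simp
    qed (use False L in auto)
    with \<open>M / L \<ge> 0\<close> False show ?thesis by (simp add: abs_minus_commute)
  qed
qed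

text \<open>Picard iteration as one contraction on the whole line, in place of gluing local
  solutions: the unknown is written \<open>E z\<close> with \<open>z\<close> bounded and
  \<open>E\<close> an exponential weight. The bound \<open>B\<close> keeps the iterates in the
  weighted space.\<close>

lemma caratheodory_exists:
  fixes f :: "real \<Rightarrow> real \<Rightarrow> real"
  assumes meas: "\<And>y. continuous_on UNIV y \<Longrightarrow> (\<lambda>s. f s (y s)) \<in> borel_measurable borel"
    and bnd: "\<And>s y. \<bar>f s y\<bar> \<le> B" and lip: "\<And>s y z. \<bar>f s y - f s z\<bar> \<le> K * \<bar>y - z\<bar>" and K: "K > 0"
  shows "\<exists>y. y 0 = y0 \<and> lprim y (\<lambda>s. f s (y s))"
proof -
  \<comment> \<open>Chosen so that the contraction constant \<open>K / L\<close> is 1/2.\<close>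
  define L where "L = 2 * K"
  have L: "L > 0" using K by (simp add: L_def)
  have B: "B \<ge> 0" using bnd[of 0 0] by linarith
  define E where "E = (\<lambda>x::real. exp (L * \<bar>x\<bar>))"
  have E: "E x > 0" "E x \<ge> 1" for x using L by (auto simp: E_def)
  have cE: "continuous_on UNIV E" unfolding E_def by (intro continuous_intros)
  have contE: "continuous_on UNIV (\<lambda>s. E s * apply_bcontfun z s)" for z :: "real \<Rightarrow>\<^sub>C real"
    by (intro continuous_intros cE continuous_on_apply_bcontfun)
  define P where "P = (\<lambda>z::real \<Rightarrow>\<^sub>C real. \<lambda>x. y0 + integral {0..x} (\<lambda>s. f s (E s * apply_bcontfun z s))
      - integral {x..0} (\<lambda>s. f s (E s * apply_bcontfun z s)))"
  have P: "lprim (P z) (\<lambda>s. f s (E s * apply_bcontfun z s))" for z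
    unfolding P_def by (rule lprim_exists) (use meas[OF contE] bnd in auto)
  have P0: "P z 0 = y0" for z by (simp add: P_def)
  define T where "T = (\<lambda>z. Bcontfun (\<lambda>x. P z x / E x))"
  have T: "apply_bcontfun (T z) = (\<lambda>x. P z x / E x)" for z
  proof -
    have "(\<lambda>x. P z x / E x) \<in> bcontfun"
    proof (rule bcontfun_normI)
      show "continuous_on UNIV (\<lambda>x. P z x / E x)"
        by (intro continuous_intros cE lprim_continuous_on[OF P]) (use E in \<open>auto simp: less_imp_neq[symmetric]\<close>)
      fix x
      have "\<bar>f s (E s * apply_bcontfun z s)\<bar> \<le> B * exp (L * \<bar>s\<bar>)" for s
        using bnd[of s "E s * apply_bcontfun z s"] mult_left_mono[OF E(2)[of s] B] by (simp add: E_def)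
      then have "\<bar>P z x - y0\<bar> \<le> B / L * E x"
        using lprim_exp_bound[OF P L B, of z x] P0 by (simp add: E_def)
      moreover have "\<bar>y0\<bar> \<le> \<bar>y0\<bar> * E x" using mult_left_mono[OF E(2)[of x], of "\<bar>y0\<bar>"] by simp
      ultimately have "\<bar>P z x\<bar> \<le> (\<bar>y0\<bar> + B / L) * E x" unfolding distrib_right by linarith
      then show "norm (P z x / E x) \<le> \<bar>y0\<bar> + B / L" using E(1)[of x] by (simp add: pos_divide_le_eq)
    qed
    then show ?thesis by (simp add: T_def Bcontfun_inverse)
  qed
  have "dist (T z) (T w) \<le> 1/2 * dist z w" for z w
  proof (rule dist_bound)
    fix x
    have "\<bar>f s (E s * apply_bcontfun z s) - f s (E s * apply_bcontfun w s)\<bar> \<le> K * dist z w * exp (L * \<bar>s\<bar>)" for s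
    proof -
      have "\<bar>f s (E s * apply_bcontfun z s) - f s (E s * apply_bcontfun w s)\<bar>
          \<le> K * \<bar>E s * apply_bcontfun z s - E s * apply_bcontfun w s\<bar>" by (rule lip)
      also have "\<dots> = K * (E s * dist (apply_bcontfun z s) (apply_bcontfun w s))"
        using E(1)[of s] by (simp add: dist_real_def abs_mult flip: right_diff_distrib)
      also have "\<dots> \<le> K * (E s * dist z w)"
        using K E(1)[of s] dist_bounded[of z s w] by (intro mult_left_mono) auto
      finally show ?thesis by (simp add: E_def mult_ac)
    qed
    from lprim_exp_bound[OF lprim_diff[OF P P] L _ this, of x]
    have "\<bar>P z x - P w x\<bar> \<le> K * dist z w / L * E x" using K P0 by (simp add: E_def)
    then have "\<bar>P z x - P w x\<bar> / E x \<le> 1/2 * dist z w"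
      using E(1)[of x] K by (simp add: pos_divide_le_eq L_def)
    then show "dist (apply_bcontfun (T z) x) (apply_bcontfun (T w) x) \<le> 1/2 * dist z w"
      using E(1)[of x] by (simp add: T dist_real_def flip: diff_divide_distrib)
  qed
  then have "\<exists>!z. T z = z" by (intro banach_fix_type[of "1/2"]) auto
  then obtain z where z: "T z = z" by blast
  have "P z = (\<lambda>x. E x * apply_bcontfun z x)"
  proof
    fix x
    have "apply_bcontfun z x = P z x / E x" using T[of z] z by metis
    then show "P z x = E x * apply_bcontfun z x" using E(1)[of x] by simp
  qed
  then have "lprim (P z) (\<lambda>s. f s (P z s))" using P[of z] by simp
  with P0 show ?thesis by blast
qed

definition pot :: "(real \<Rightarrow> real) \<Rightarrow> bool" where
  "pot q \<longleftrightarrow> q \<in> borel_measurable borel \<and> (\<exists>Q. \<forall>x. \<bar>q x\<bar> \<le> Q)"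

text \<open>The Pruefer equation: \<open>\<theta>\<close> is the angle of \<open>(y', y)\<close> for a solution of \<open>y'' = q y\<close>.\<close>

definition pruf :: "(real \<Rightarrow> real) \<Rightarrow> (real \<Rightarrow> real) \<Rightarrow> bool" where
  "pruf q \<theta> \<longleftrightarrow> lprim \<theta> (\<lambda>x. (cos (\<theta> x))\<^sup>2 - q x * (sin (\<theta> x))\<^sup>2)"

lemma pot_locally_bounded: "pot q \<Longrightarrow> loc_bounded q"
  unfolding pot_def by auto

lemma sin_squared_diff: "(sin a)\<^sup>2 - (sin b)\<^sup>2 = sin (a + b) * sin (a - b)" for a b :: real
proof -
  have "sin (a + b) * sin (a - b) = (sin a)\<^sup>2 * (cos b)\<^sup>2 - (cos a)\<^sup>2 * (sin b)\<^sup>2"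
    by (simp add: sin_add sin_diff algebra_simps power2_eq_square)
  also have "\<dots> = (sin a)\<^sup>2 - (sin b)\<^sup>2" by (simp add: cos_squared_eq algebra_simps)
  finally show ?thesis by simp
qed

lemma sin_squared_lipschitz: "\<bar>(sin a)\<^sup>2 - (sin b)\<^sup>2\<bar> \<le> \<bar>a - b\<bar>" for a b :: real
proof -
  have "\<bar>sin (a + b)\<bar> * \<bar>sin (a - b)\<bar> \<le> 1 * \<bar>a - b\<bar>"
    by (intro mult_mono abs_sin_le_one abs_sin_x_le_abs_x) auto
  then show ?thesis unfolding sin_squared_diff abs_mult by simp
qed

lemma pruf_exists:
  assumes "pot q" shows "\<exists>\<theta>. \<theta> 0 = t \<and> pruf q \<theta>"
proof -
  obtain Q where Q: "\<And>x. \<bar>q x\<bar> \<le> Q" and [measurable]: "q \<in> borel_measurable borel"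
    using assms by (auto simp: pot_def)
  have Q0: "Q \<ge> 0" using Q[of 0] by linarith
  show ?thesis unfolding pruf_def
  proof (rule caratheodory_exists[where B="1 + Q" and K="1 + Q"])
    fix y :: "real \<Rightarrow> real" assume "continuous_on UNIV y"
    then have [measurable]: "y \<in> borel_measurable borel" by (rule borel_measurable_continuous_onI)
    show "(\<lambda>s. (cos (y s))\<^sup>2 - q s * (sin (y s))\<^sup>2) \<in> borel_measurable borel" by measurable
  next
    fix s y :: real
    have "\<bar>q s * (sin y)\<^sup>2\<bar> \<le> Q * 1" unfolding abs_mult
      by (rule mult_mono) (use Q Q0 in \<open>auto simp: abs_square_le_1\<close>)
    moreover have "\<bar>(cos y)\<^sup>2\<bar> \<le> 1" by (auto simp: abs_square_le_1)
    ultimately show "\<bar>(cos y)\<^sup>2 - q s * (sin y)\<^sup>2\<bar> \<le> 1 + Q" by linarith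
  next
    fix s y z :: real
    have "(cos y)\<^sup>2 - q s * (sin y)\<^sup>2 - ((cos z)\<^sup>2 - q s * (sin z)\<^sup>2) = - (1 + q s) * ((sin y)\<^sup>2 - (sin z)\<^sup>2)"
      by (simp add: cos_squared_eq algebra_simps)
    then have "\<bar>(cos y)\<^sup>2 - q s * (sin y)\<^sup>2 - ((cos z)\<^sup>2 - q s * (sin z)\<^sup>2)\<bar> = \<bar>1 + q s\<bar> * \<bar>(sin y)\<^sup>2 - (sin z)\<^sup>2\<bar>"
      by (simp only: abs_mult abs_minus_cancel)
    also have "\<dots> \<le> (1 + Q) * \<bar>y - z\<bar>"
      by (intro mult_mono sin_squared_lipschitz) (use Q[of s] Q0 in auto)
    finally show "\<bar>(cos y)\<^sup>2 - q s * (sin y)\<^sup>2 - ((cos z)\<^sup>2 - q s * (sin z)\<^sup>2)\<bar> \<le> (1 + Q) * \<bar>y - z\<bar>" .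
  qed (use Q0 in simp)
qed

text \<open>The basic comparison identity. The difference \<open>d\<close> of two angles solves a
  linear equation with bounded coefficient \<open>c\<close> and source
  \<open>(q2 - q1) * (sin \<theta>2)\<^sup>2\<close>, so the integrating factor makes its sign and
  size visible. Order preservation, uniqueness, monotonicity in the potential and Lipschitz
  dependence are all read off from it.\<close>

lemma pruf_difference:
  assumes q1: "pot q1" and q2: "pot q2" and t1: "pruf q1 \<theta>1" and t2: "pruf q2 \<theta>2"
    and Q: "\<And>x. \<bar>q1 x\<bar> \<le> Q"
  shows "\<exists>C. C 0 = 0 \<and> (\<forall>x. \<bar>C x\<bar> \<le> (1 + Q) * \<bar>x\<bar>) \<and> continuous_on UNIV C \<and>
    lprim (\<lambda>x. (\<theta>1 x - \<theta>2 x) * exp (- C x)) (\<lambda>x. (q2 x - q1 x) * (sin (\<theta>2 x))\<^sup>2 * exp (- C x))"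
proof -
  have [measurable]: "q1 \<in> borel_measurable borel" "\<theta>1 \<in> borel_measurable borel" "\<theta>2 \<in> borel_measurable borel"
    using q1 t1 t2 by (auto simp: pot_def pruf_def intro: lprim_measurable_prim)
  \<comment> \<open>Difference quotient of the squared sine. Where the angles meet, division by zero
    gives 0, which is consistent because \<open>c\<close> is multiplied there by a vanishing
    difference.\<close>
  define c where "c = (\<lambda>x. - (1 + q1 x) * (((sin (\<theta>1 x))\<^sup>2 - (sin (\<theta>2 x))\<^sup>2) / (\<theta>1 x - \<theta>2 x)))"
  have cm: "c \<in> borel_measurable borel" unfolding c_def by measurable
  have cb: "\<bar>c x\<bar> \<le> 1 + Q" for x
  proof -
    have "\<bar>((sin (\<theta>1 x))\<^sup>2 - (sin (\<theta>2 x))\<^sup>2) / (\<theta>1 x - \<theta>2 x)\<bar> \<le> 1"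
      using sin_squared_lipschitz[of "\<theta>1 x" "\<theta>2 x"] by (cases "\<theta>1 x = \<theta>2 x") (auto simp: abs_divide)
    moreover have "\<bar>- (1 + q1 x)\<bar> \<le> 1 + Q" using Q[of x] by linarith
    ultimately have "\<bar>c x\<bar> \<le> (1 + Q) * 1" unfolding c_def abs_mult
      by (intro mult_mono) auto
    then show ?thesis by simp
  qed
  obtain C where C: "C 0 = 0" "lprim C c"
    by (rule lprim_obtain[of c 0]) (use cm cb in auto)
  have "lprim (\<lambda>x. \<theta>1 x - \<theta>2 x) (\<lambda>x. c x * (\<theta>1 x - \<theta>2 x) + (q2 x - q1 x) * (sin (\<theta>2 x))\<^sup>2)"
  proof (rule back_subst[of "lprim _"])
    show "lprim (\<lambda>x. \<theta>1 x - \<theta>2 x) (\<lambda>x. ((cos (\<theta>1 x))\<^sup>2 - q1 x * (sin (\<theta>1 x))\<^sup>2) - ((cos (\<theta>2 x))\<^sup>2 - q2 x * (sin (\<theta>2 x))\<^sup>2))"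
      using t1 t2 unfolding pruf_def by (rule lprim_diff)
    show "(\<lambda>x. ((cos (\<theta>1 x))\<^sup>2 - q1 x * (sin (\<theta>1 x))\<^sup>2) - ((cos (\<theta>2 x))\<^sup>2 - q2 x * (sin (\<theta>2 x))\<^sup>2))
      = (\<lambda>x. c x * (\<theta>1 x - \<theta>2 x) + (q2 x - q1 x) * (sin (\<theta>2 x))\<^sup>2)"
    proof
      fix x
      have "c x * (\<theta>1 x - \<theta>2 x) = - (1 + q1 x) * ((sin (\<theta>1 x))\<^sup>2 - (sin (\<theta>2 x))\<^sup>2)"
        by (cases "\<theta>1 x = \<theta>2 x") (auto simp: c_def)
      then show "((cos (\<theta>1 x))\<^sup>2 - q1 x * (sin (\<theta>1 x))\<^sup>2) - ((cos (\<theta>2 x))\<^sup>2 - q2 x * (sin (\<theta>2 x))\<^sup>2)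
        = c x * (\<theta>1 x - \<theta>2 x) + (q2 x - q1 x) * (sin (\<theta>2 x))\<^sup>2"
        by (simp add: cos_squared_eq algebra_simps)
    qed
  qed
  then have "lprim (\<lambda>x. (\<theta>1 x - \<theta>2 x) * exp (- C x)) (\<lambda>x. (q2 x - q1 x) * (sin (\<theta>2 x))\<^sup>2 * exp (- C x))"
    by (rule linear_ode_factor[OF _ C(2)])
  moreover have "\<bar>C x\<bar> \<le> (1 + Q) * \<bar>x\<bar>" for x
    using lprim_abs_le_linear[OF C(2) cb, of x 0] C(1) by simp
  ultimately show ?thesis using C(1) lprim_continuous_on[OF C(2)] by blast
qed

section \<open>Comparison of Pruefer angles\<close>

lemma pot_bound:
  assumes "pot q" obtains Q where "\<And>x. \<bar>q x\<bar> \<le> Q"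
  using assms unfolding pot_def by blast

lemma pruf_less:
  assumes "pot q" "pruf q \<theta>1" "pruf q \<theta>2" "\<theta>1 0 < \<theta>2 0" shows "\<theta>1 x < \<theta>2 x"
proof -
  obtain Q where Q: "\<And>x. \<bar>q x\<bar> \<le> Q" using pot_bound[OF assms(1)] by blast
  obtain C where C: "C 0 = 0" "lprim (\<lambda>x. (\<theta>1 x - \<theta>2 x) * exp (- C x)) (\<lambda>x. (q x - q x) * (sin (\<theta>2 x))\<^sup>2 * exp (- C x))"
    using pruf_difference[OF assms(1) assms(1) assms(2,3) Q] by blast
  then have "(\<theta>1 x - \<theta>2 x) * exp (- C x) = (\<theta>1 0 - \<theta>2 0) * exp (- C 0)"
    by (intro lprim_zero_const) simp
  then have "(\<theta>1 x - \<theta>2 x) * exp (- C x) < 0" using C assms(4) by simp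
  then show ?thesis by (simp add: mult_less_0_iff)
qed

lemma pruf_unique:
  assumes "pot q" "pruf q \<theta>1" "pruf q \<theta>2" "\<theta>1 0 = \<theta>2 0" shows "\<theta>1 = \<theta>2"
proof
  fix x
  obtain Q where Q: "\<And>x. \<bar>q x\<bar> \<le> Q" using pot_bound[OF assms(1)] by blast
  obtain C where C: "C 0 = 0" "lprim (\<lambda>x. (\<theta>1 x - \<theta>2 x) * exp (- C x)) (\<lambda>x. (q x - q x) * (sin (\<theta>2 x))\<^sup>2 * exp (- C x))"
    using pruf_difference[OF assms(1) assms(1) assms(2,3) Q] by blast
  then have "(\<theta>1 x - \<theta>2 x) * exp (- C x) = (\<theta>1 0 - \<theta>2 0) * exp (- C 0)"
    by (intro lprim_zero_const) simp
  then show "\<theta>1 x = \<theta>2 x" using assms(4) by simp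
qed

lemma pruf_mono_q:
  assumes "pot q1" "pot q2" "pruf q1 \<theta>1" "pruf q2 \<theta>2" "\<theta>1 0 = \<theta>2 0" "x \<ge> 0" "\<And>x. q1 x \<le> q2 x"
  shows "\<theta>2 x \<le> \<theta>1 x"
proof -
  obtain Q where Q: "\<And>x. \<bar>q1 x\<bar> \<le> Q" using pot_bound[OF assms(1)] by blast
  obtain C where C: "C 0 = 0" "lprim (\<lambda>x. (\<theta>1 x - \<theta>2 x) * exp (- C x)) (\<lambda>x. (q2 x - q1 x) * (sin (\<theta>2 x))\<^sup>2 * exp (- C x))"
    using pruf_difference[OF assms(1-4) Q] by blast
  have "(\<theta>1 0 - \<theta>2 0) * exp (- C 0) \<le> (\<theta>1 x - \<theta>2 x) * exp (- C x)"
    by (rule lprim_mono[OF C(2) assms(6)]) (use assms(7) in auto)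
  then show ?thesis using assms(5) by (simp add: zero_le_mult_iff)
qed

text \<open>At multiples of \<pi> the equation reads \<theta>' = 1, so the angle cannot rest
  there.\<close>

lemma pruf_not_const_zero:
  assumes "pruf q \<theta>" "a < b" shows "\<exists>s\<in>{a..b}. sin (\<theta> s) \<noteq> 0"
proof (rule ccontr)
  assume "\<not> ?thesis"
  then have s: "sin (\<theta> s) = 0" if "s \<in> {a..b}" for s using that by blast
  then have 1: "((\<lambda>s. 1::real) has_integral (\<theta> y - \<theta> x)) {x..y}" if "a \<le> x" "x \<le> y" "y \<le> b" for x y
    using lprim_integral[OF assms(1)[unfolded pruf_def] that(2)] that
    by (subst has_integral_cong[where g="\<lambda>x. (cos (\<theta> x))\<^sup>2 - q x * (sin (\<theta> x))\<^sup>2"]) (auto simp: cos_squared_eq)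
  have inc: "\<theta> y - \<theta> x = y - x" if "a \<le> x" "x \<le> y" "y \<le> b" for x y
  proof -
    have "((\<lambda>s. 1::real) has_integral (y - x)) {x..y}" using has_integral_const_real[of "1::real" x y] that by simp
    with 1[OF that] show ?thesis using has_integral_unique by blast
  qed
  \<comment> \<open>\<open>h \<le> 1 < pi\<close> ensures \<open>sin h > 0\<close>.\<close>
  define h where "h = min (b - a) 1"
  have h: "h > 0" "h \<le> 1" "a + h \<le> b" using assms(2) by (auto simp: h_def)
  have "\<theta> (a + h) = \<theta> a + h" using inc[of a "a + h"] h by auto
  then have "sin (\<theta> a + h) = 0" "sin (\<theta> a) = 0" using s[of "a+h"] s[of a] h by auto
  then have "cos (\<theta> a) * sin h = 0" "cos (\<theta> a) \<noteq> 0"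
    using sin_cos_squared_add[of "\<theta> a"] by (auto simp: sin_add)
  moreover have "sin h > 0" using h pi_gt3 by (intro sin_gt_zero) auto
  ultimately show False by simp
qed

text \<open>With a constant difference \<open>D\<close> the integrand is continuous, so one point
  with nonzero sine makes the integral positive.\<close>

lemma pruf_strict_mono_q:
  assumes "pot q1" "pot q2" "pruf q1 \<theta>1" "pruf q2 \<theta>2" "\<theta>1 0 = \<theta>2 0" "x > 0" "D > 0" "\<And>x. q2 x = q1 x + D"
  shows "\<theta>2 x < \<theta>1 x"
proof -
  obtain Q where Q: "\<And>x. \<bar>q1 x\<bar> \<le> Q" using pot_bound[OF assms(1)] by blast
  obtain C where C: "C 0 = 0" "continuous_on UNIV C"
      "lprim (\<lambda>x. (\<theta>1 x - \<theta>2 x) * exp (- C x)) (\<lambda>x. (q2 x - q1 x) * (sin (\<theta>2 x))\<^sup>2 * exp (- C x))"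
    using pruf_difference[OF assms(1-4) Q] by blast
  obtain s where s: "s \<in> {0..x}" "sin (\<theta>2 s) \<noteq> 0" using pruf_not_const_zero[OF assms(4,6)] by blast
  have C': "lprim (\<lambda>x. (\<theta>1 x - \<theta>2 x) * exp (- C x)) (\<lambda>x. D * (sin (\<theta>2 x))\<^sup>2 * exp (- C x))"
    using C(3) assms(8) by simp
  have "(\<theta>1 0 - \<theta>2 0) * exp (- C 0) < (\<theta>1 x - \<theta>2 x) * exp (- C x)"
  proof (rule lprim_strict_mono[OF C' assms(6) _ _ s(1)])
    show "continuous_on {0..x} (\<lambda>x. D * (sin (\<theta>2 x))\<^sup>2 * exp (- C x))"
      by (intro continuous_intros lprim_continuous_on[OF assms(4)[unfolded pruf_def]] continuous_on_subset[OF C(2)]) auto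
  qed (use assms(7) s(2) in auto)
  then show ?thesis using assms(5) by (simp add: zero_less_mult_iff)
qed

text \<open>The 2 in the exponent: one factor bounds \<open>exp (- C s)\<close> under the integral,
  the other undoes the integrating factor at the end point.\<close>

lemma pruf_lipschitz:
  assumes "pot q1" "pot q2" "pruf q1 \<theta>1" "pruf q2 \<theta>2" "\<And>x. \<bar>q1 x\<bar> \<le> Q" "\<And>x. \<bar>q2 x - q1 x\<bar> \<le> \<epsilon>" "x \<ge> 0"
  shows "\<bar>\<theta>1 x - \<theta>2 x\<bar> \<le> exp (2 * (1 + Q) * x) * (\<bar>\<theta>1 0 - \<theta>2 0\<bar> + \<epsilon> * x)"
proof -
  have Q0: "Q \<ge> 0" "\<epsilon> \<ge> 0" using assms(5)[of 0] assms(6)[of 0] by auto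
  obtain C where C: "C 0 = 0" "\<And>x. \<bar>C x\<bar> \<le> (1 + Q) * \<bar>x\<bar>"
      "lprim (\<lambda>x. (\<theta>1 x - \<theta>2 x) * exp (- C x)) (\<lambda>x. (q2 x - q1 x) * (sin (\<theta>2 x))\<^sup>2 * exp (- C x))"
    using pruf_difference[OF assms(1-5)] by blast
  have Cs: "- C s \<le> (1 + Q) * x" if "s \<in> {0..x}" for s
  proof -
    have "- C s \<le> (1 + Q) * \<bar>s\<bar>" using C(2)[of s] by linarith
    also have "\<dots> \<le> (1 + Q) * x" using that Q0 by (intro mult_left_mono) auto
    finally show ?thesis .
  qed
  have Cx: "C x \<le> (1 + Q) * x" using C(2)[of x] assms(7) by simp
  define M where "M = \<epsilon> * exp ((1 + Q) * x)"
  have "\<bar>(\<theta>1 x - \<theta>2 x) * exp (- C x) - (\<theta>1 0 - \<theta>2 0) * exp (- C 0)\<bar> \<le> M * x - M * 0"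
  proof (rule lprim_abs_le[OF C(3) lprim_linear assms(7)])
    fix s assume s: "s \<in> {0..x}"
    have "\<bar>(q2 s - q1 s) * (sin (\<theta>2 s))\<^sup>2\<bar> \<le> \<epsilon> * 1" unfolding abs_mult
      by (rule mult_mono) (use Q0 assms(6) in \<open>auto simp: abs_square_le_1\<close>)
    then show "\<bar>(q2 s - q1 s) * (sin (\<theta>2 s))\<^sup>2 * exp (- C s)\<bar> \<le> M"
      unfolding M_def abs_mult by (intro mult_mono) (use Cs[OF s] Q0 in auto)
  qed
  then have 1: "\<bar>(\<theta>1 x - \<theta>2 x) * exp (- C x)\<bar> \<le> \<bar>\<theta>1 0 - \<theta>2 0\<bar> + M * x" using C(1) by simp
  have "\<bar>\<theta>1 x - \<theta>2 x\<bar> = exp (C x) * \<bar>(\<theta>1 x - \<theta>2 x) * exp (- C x)\<bar>"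
    by (simp add: abs_mult flip: exp_add)
  also have "\<dots> \<le> exp ((1 + Q) * x) * (\<bar>\<theta>1 0 - \<theta>2 0\<bar> + M * x)"
    using 1 Cx by (intro mult_mono) auto
  also have "\<dots> \<le> exp ((1 + Q) * x) * (exp ((1 + Q) * x) * \<bar>\<theta>1 0 - \<theta>2 0\<bar> + M * x)"
  proof -
    have "1 * \<bar>\<theta>1 0 - \<theta>2 0\<bar> \<le> exp ((1 + Q) * x) * \<bar>\<theta>1 0 - \<theta>2 0\<bar>"
      using Q0 assms(7) by (intro mult_right_mono) auto
    then show ?thesis by (intro mult_left_mono add_right_mono) auto
  qed
  also have "\<dots> = exp ((1 + Q) * x + (1 + Q) * x) * (\<bar>\<theta>1 0 - \<theta>2 0\<bar> + \<epsilon> * x)"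
    by (simp only: exp_add M_def) (simp add: algebra_simps)
  finally show ?thesis by (simp add: algebra_simps)
qed

section \<open>Linear second-order equations\<close>

text \<open>Scalar multiplication lets one notion cover the real solutions and the complex ones of
  the Bloch problem.\<close>

definition sol :: "(real \<Rightarrow> real) \<Rightarrow> (real \<Rightarrow> 'a::euclidean_space) \<Rightarrow> (real \<Rightarrow> 'a) \<Rightarrow> bool" where
  "sol q y y' \<longleftrightarrow> lprim y y' \<and> lprim y' (\<lambda>x. q x *\<^sub>R y x)"

lemma sol_wronskian:
  fixes y z :: "real \<Rightarrow> 'a::{euclidean_space,real_normed_field}"
  assumes "sol q y y'" "sol p z z'"
  shows "lprim (\<lambda>x. y x * z' x - y' x * z x) (\<lambda>x. (p x - q x) *\<^sub>R (y x * z x))"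
proof -
  have "lprim (\<lambda>x. y x * z' x - y' x * z x)
    (\<lambda>x. (y' x * z' x + y x * (p x *\<^sub>R z x)) - ((q x *\<^sub>R y x) * z x + y' x * z' x))"
    using assms unfolding sol_def by (intro lprim_diff lprim_mult) auto
  then show ?thesis by (simp add: algebra_simps)
qed

lemma sol_add: "sol q y y' \<Longrightarrow> sol q z z' \<Longrightarrow> sol q (\<lambda>x. y x + z x) (\<lambda>x. y' x + z' x)"
  unfolding sol_def using lprim_add[of y y' z z'] lprim_add[of y' "\<lambda>x. q x *\<^sub>R y x" z' "\<lambda>x. q x *\<^sub>R z x"]
  by (simp add: scaleR_add_right)

lemma sol_bounded_linear:
  assumes "sol q y y'" "bounded_linear h" shows "sol q (\<lambda>x. h (y x)) (\<lambda>x. h (y' x))"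
proof -
  interpret bounded_linear h by fact
  show ?thesis using assms(1) lprim_bounded_linear[OF _ assms(2)] unfolding sol_def
    by (auto simp: scaleR dest: lprim_bounded_linear[OF _ assms(2)])
qed

lemma sol_cmult:
  fixes y :: "real \<Rightarrow> 'a::{euclidean_space,real_normed_field}"
  shows "sol q y y' \<Longrightarrow> sol q (\<lambda>x. c * y x) (\<lambda>x. c * y' x)"
  by (rule sol_bounded_linear[OF _ bounded_linear_mult_right])

text \<open>The inverse of the Pruefer substitution: a radius with
  \<open>r'/r = (1 + q) sin \<theta> cos \<theta>\<close> turns an angle into a solution. In this
  way existence for the linear equation is inherited from the nonlinear one, whose right-hand side
  is bounded.\<close>

lemma pruf_radius:
  assumes q: "pot q" and t: "pruf q \<theta>" and Q: "\<And>x. \<bar>q x\<bar> \<le> Q"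
  shows "\<exists>r. r 0 = 1 \<and> (\<forall>x. r x > 0) \<and> (\<forall>x. r x \<le> exp ((1 + Q) * \<bar>x\<bar>))
     \<and> sol q (\<lambda>x. r x * sin (\<theta> x)) (\<lambda>x. r x * cos (\<theta> x))"
proof -
  have [measurable]: "q \<in> borel_measurable borel" "\<theta> \<in> borel_measurable borel"
    using q t by (auto simp: pot_def pruf_def intro: lprim_measurable_prim)
  define g where "g = (\<lambda>x. (1 + q x) * (sin (\<theta> x) * cos (\<theta> x)))"
  have gm: "g \<in> borel_measurable borel" unfolding g_def by measurable
  have gb: "\<bar>g x\<bar> \<le> 1 + Q" for x
  proof -
    have "\<bar>sin (\<theta> x)\<bar> * \<bar>cos (\<theta> x)\<bar> \<le> 1 * 1" by (intro mult_mono) auto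
    then have "\<bar>1 + q x\<bar> * (\<bar>sin (\<theta> x)\<bar> * \<bar>cos (\<theta> x)\<bar>) \<le> (1 + Q) * 1" using Q[of x] by (intro mult_mono) auto
    then show ?thesis by (simp add: g_def abs_mult)
  qed
  obtain G where G: "G 0 = 0" "lprim G g" by (rule lprim_obtain[of g 0]) (use gm gb in auto)
  have t': "lprim \<theta> (\<lambda>x. (cos (\<theta> x))\<^sup>2 - q x * (sin (\<theta> x))\<^sup>2)" using t by (simp add: pruf_def)
  have E: "lprim (\<lambda>x. exp (G x)) (\<lambda>x. exp (G x) * g x)"
    by (rule lprim_chain[OF G(2)]) (auto intro: continuous_intros derivative_eq_intros)
  have S: "lprim (\<lambda>x. sin (\<theta> x)) (\<lambda>x. cos (\<theta> x) * ((cos (\<theta> x))\<^sup>2 - q x * (sin (\<theta> x))\<^sup>2))"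
    by (rule lprim_chain[OF t']) (auto intro!: continuous_intros derivative_eq_intros)
  have C: "lprim (\<lambda>x. cos (\<theta> x)) (\<lambda>x. - sin (\<theta> x) * ((cos (\<theta> x))\<^sup>2 - q x * (sin (\<theta> x))\<^sup>2))"
    by (rule lprim_chain[OF t', where \<phi>'="\<lambda>x. - sin x"]) (auto intro!: continuous_intros derivative_eq_intros)
  have "lprim (\<lambda>x. exp (G x) * sin (\<theta> x)) (\<lambda>x. exp (G x) * cos (\<theta> x))"
  proof (rule back_subst[of "lprim _", OF lprim_mult[OF E S]], rule ext)
    fix x
    have "(1 + q x) * (s * c) * s + c * (c\<^sup>2 - q x * s\<^sup>2) = c * (s\<^sup>2 + c\<^sup>2)" for s c :: real
      by (simp add: algebra_simps power2_eq_square)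
    from this[of "sin (\<theta> x)" "cos (\<theta> x)"]
    have "(1 + q x) * (sin (\<theta> x) * cos (\<theta> x)) * sin (\<theta> x) + cos (\<theta> x) * ((cos (\<theta> x))\<^sup>2 - q x * (sin (\<theta> x))\<^sup>2) = cos (\<theta> x)" by simp
    then have "exp (G x) * ((1 + q x) * (sin (\<theta> x) * cos (\<theta> x)) * sin (\<theta> x) + cos (\<theta> x) * ((cos (\<theta> x))\<^sup>2 - q x * (sin (\<theta> x))\<^sup>2)) = exp (G x) * cos (\<theta> x)" by simp
    then show "exp (G x) * g x * sin (\<theta> x) + exp (G x) * (cos (\<theta> x) * ((cos (\<theta> x))\<^sup>2 - q x * (sin (\<theta> x))\<^sup>2)) = exp (G x) * cos (\<theta> x)"
      by (simp add: g_def distrib_left mult.assoc)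
  qed
  moreover have "lprim (\<lambda>x. exp (G x) * cos (\<theta> x)) (\<lambda>x. q x *\<^sub>R (exp (G x) * sin (\<theta> x)))"
  proof (rule back_subst[of "lprim _", OF lprim_mult[OF E C]], rule ext)
    fix x
    have "(1 + q x) * (s * c) * c - s * (c\<^sup>2 - q x * s\<^sup>2) = q x * s * (s\<^sup>2 + c\<^sup>2)" for s c :: real
      by (simp add: algebra_simps power2_eq_square)
    from this[of "sin (\<theta> x)" "cos (\<theta> x)"]
    have "(1 + q x) * (sin (\<theta> x) * cos (\<theta> x)) * cos (\<theta> x) - sin (\<theta> x) * ((cos (\<theta> x))\<^sup>2 - q x * (sin (\<theta> x))\<^sup>2) = q x * sin (\<theta> x)" by simp
    then have "exp (G x) * ((1 + q x) * (sin (\<theta> x) * cos (\<theta> x)) * cos (\<theta> x) - sin (\<theta> x) * ((cos (\<theta> x))\<^sup>2 - q x * (sin (\<theta> x))\<^sup>2)) = exp (G x) * (q x * sin (\<theta> x))" by simp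
    then show "exp (G x) * g x * cos (\<theta> x) + exp (G x) * (- sin (\<theta> x) * ((cos (\<theta> x))\<^sup>2 - q x * (sin (\<theta> x))\<^sup>2)) = q x *\<^sub>R (exp (G x) * sin (\<theta> x))"
      by (simp add: g_def right_diff_distrib mult.assoc mult.left_commute)
  qed
  moreover have "exp (G x) \<le> exp ((1 + Q) * \<bar>x\<bar>)" for x
    using lprim_abs_le_linear[OF G(2) gb, of x 0] G(1) by simp
  ultimately show ?thesis using G(1) by (intro exI[of _ "\<lambda>x. exp (G x)"]) (auto simp: sol_def)
qed

lemma polar_coordinates: "\<exists>R t. R \<ge> 0 \<and> a = R * sin t \<and> b = R * cos t \<and> R = sqrt (a\<^sup>2 + b\<^sup>2)" for a b :: real
proof (cases "a = 0 \<and> b = 0")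
  case False
  define R where "R = sqrt (a\<^sup>2 + b\<^sup>2)"
  have R: "R > 0" using False by (simp add: R_def sum_power2_gt_zero_iff)
  have "(b / R)\<^sup>2 + (a / R)\<^sup>2 = 1" using R False
    by (simp add: R_def power_divide flip: add_divide_distrib)
  then obtain t where "b / R = cos t" "a / R = sin t" using sincos_total_2pi by metis
  then have "a = R * sin t" "b = R * cos t" using R by (auto simp: field_simps)
  with R show ?thesis unfolding R_def by (metis less_imp_le)
qed auto

lemma ivp_exists:
  assumes "pot q" shows "\<exists>y y'. sol q y y' \<and> y 0 = (a::real) \<and> y' 0 = b"
proof -
  obtain R t where R: "R \<ge> 0" "a = R * sin t" "b = R * cos t" using polar_coordinates by metis
  obtain \<theta> where th: "\<theta> 0 = t" "pruf q \<theta>" using pruf_exists[OF assms] by blast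
  obtain Q where Q: "\<And>x. \<bar>q x\<bar> \<le> Q" using pot_bound[OF assms] by blast
  obtain r where r: "r 0 = 1" "sol q (\<lambda>x. r x * sin (\<theta> x)) (\<lambda>x. r x * cos (\<theta> x))"
    using pruf_radius[OF assms th(2) Q] by blast
  have "sol q (\<lambda>x. R * (r x * sin (\<theta> x))) (\<lambda>x. R * (r x * cos (\<theta> x)))"
    by (rule sol_cmult[OF r(2)])
  then show ?thesis using r(1) th(1) R 
    by (intro exI[of _ "\<lambda>x. R * (r x * sin (\<theta> x))"] exI[of _ "\<lambda>x. R * (r x * cos (\<theta> x))"]) auto
qed

definition ivp :: "(real \<Rightarrow> real) \<Rightarrow> real \<Rightarrow> real \<Rightarrow> (real \<Rightarrow> real) \<times> (real \<Rightarrow> real)" where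
  "ivp q a b = (SOME p. sol q (fst p) (snd p) \<and> fst p 0 = a \<and> snd p 0 = b)"

definition iv :: "(real \<Rightarrow> real) \<Rightarrow> real \<Rightarrow> real \<Rightarrow> real \<Rightarrow> real" where "iv q a b = fst (ivp q a b)"
definition ivd :: "(real \<Rightarrow> real) \<Rightarrow> real \<Rightarrow> real \<Rightarrow> real \<Rightarrow> real" where "ivd q a b = snd (ivp q a b)"

lemma ivp_sol:
  assumes "pot q" shows "sol q (iv q a b) (ivd q a b)" "iv q a b 0 = a" "ivd q a b 0 = b"
proof -
  have "\<exists>p. sol q (fst p) (snd p) \<and> fst p 0 = a \<and> snd p 0 = b"
    using ivp_exists[OF assms, of a b] by auto
  from someI_ex[OF this] show "sol q (iv q a b) (ivd q a b)" "iv q a b 0 = a" "ivd q a b 0 = b"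
    by (auto simp: ivp_def iv_def ivd_def)
qed

section \<open>Variation of parameters and dependence on the potential\<close>

lemma wronskian_one:
  assumes "pot q" shows "iv q 1 0 x * ivd q 0 1 x - ivd q 1 0 x * iv q 0 1 x = 1"
proof -
  have "lprim (\<lambda>x. iv q 1 0 x * ivd q 0 1 x - ivd q 1 0 x * iv q 0 1 x) (\<lambda>_. 0)"
    using sol_wronskian[OF ivp_sol(1)[OF assms] ivp_sol(1)[OF assms]] by simp
  from lprim_zero_const[OF this, of x 0] show ?thesis using ivp_sol(2,3)[OF assms] by simp
qed

text \<open>\<open>A\<close> and \<open>B\<close> are the Wronskians of \<open>z\<close> with the
  two fundamental solutions, and \<open>wronskian_one\<close> recovers \<open>z\<close> from them.
  They are constant when \<open>p = q\<close> and drift slowly when the potentials are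
  close.\<close>

lemma sol_duhamel:
  fixes z :: "real \<Rightarrow> 'a::{euclidean_space,real_normed_field}"
  assumes q: "pot q" and z: "sol p z z'"
  obtains A B where "lprim A (\<lambda>x. (p x - q x) *\<^sub>R (of_real (iv q 1 0 x) * z x))"
    "lprim B (\<lambda>x. (p x - q x) *\<^sub>R (of_real (iv q 0 1 x) * z x))" "A 0 = z' 0" "B 0 = - z 0"
    "\<And>x. z x = of_real (iv q 0 1 x) * A x - of_real (iv q 1 0 x) * B x"
    "\<And>x. z' x = of_real (ivd q 0 1 x) * A x - of_real (ivd q 1 0 x) * B x"
proof -
  have s: "sol q (\<lambda>x. of_real (iv q a b x) :: 'a) (\<lambda>x. of_real (ivd q a b x))" for a b
    by (rule sol_bounded_linear[OF ivp_sol(1)[OF q] bounded_linear_of_real])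
  define A where "A = (\<lambda>x. of_real (iv q 1 0 x) * z' x - of_real (ivd q 1 0 x) * z x)"
  define B where "B = (\<lambda>x. of_real (iv q 0 1 x) * z' x - of_real (ivd q 0 1 x) * z x)"
  have w: "of_real (iv q 1 0 x) * of_real (ivd q 0 1 x) - of_real (ivd q 1 0 x) * of_real (iv q 0 1 x) = (1::'a)" for x
    using wronskian_one[OF q, of x] by (metis of_real_1 of_real_diff of_real_mult)
  show thesis
  proof (rule that[of A B])
    show "lprim A (\<lambda>x. (p x - q x) *\<^sub>R (of_real (iv q 1 0 x) * z x))" unfolding A_def by (rule sol_wronskian[OF s z])
    show "lprim B (\<lambda>x. (p x - q x) *\<^sub>R (of_real (iv q 0 1 x) * z x))" unfolding B_def by (rule sol_wronskian[OF s z])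
    show "A 0 = z' 0" "B 0 = - z 0" by (simp_all add: A_def B_def ivp_sol[OF q])
    fix x
    have "of_real (iv q 0 1 x) * A x - of_real (iv q 1 0 x) * B x
       = (of_real (iv q 1 0 x) * of_real (ivd q 0 1 x) - of_real (ivd q 1 0 x) * of_real (iv q 0 1 x)) * z x"
      unfolding A_def B_def by (simp add: algebra_simps)
    then show "z x = of_real (iv q 0 1 x) * A x - of_real (iv q 1 0 x) * B x" by (simp add: w)
    have "of_real (ivd q 0 1 x) * A x - of_real (ivd q 1 0 x) * B x
       = (of_real (iv q 1 0 x) * of_real (ivd q 0 1 x) - of_real (ivd q 1 0 x) * of_real (iv q 0 1 x)) * z' x"
      unfolding A_def B_def by (simp add: algebra_simps)
    then show "z' x = of_real (ivd q 0 1 x) * A x - of_real (ivd q 1 0 x) * B x" by (simp add: w)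
  qed
qed

lemma sol_fundamental:
  fixes z :: "real \<Rightarrow> 'a::{euclidean_space,real_normed_field}"
  assumes q: "pot q" and z: "sol q z z'"
  shows "z x = of_real (iv q 1 0 x) * z 0 + of_real (iv q 0 1 x) * z' 0"
    "z' x = of_real (ivd q 1 0 x) * z 0 + of_real (ivd q 0 1 x) * z' 0"
proof -
  obtain A B where AB: "lprim A (\<lambda>x. (q x - q x) *\<^sub>R (of_real (iv q 1 0 x) * z x))"
    "lprim B (\<lambda>x. (q x - q x) *\<^sub>R (of_real (iv q 0 1 x) * z x))" "A 0 = z' 0" "B 0 = - z 0"
    "\<And>x. z x = of_real (iv q 0 1 x) * A x - of_real (iv q 1 0 x) * B x"
    "\<And>x. z' x = of_real (ivd q 0 1 x) * A x - of_real (ivd q 1 0 x) * B x"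
    using sol_duhamel[OF q z] by blast
  have "A x = z' 0" "B x = - z 0"
    using lprim_zero_const[of A x 0] lprim_zero_const[of B x 0] AB(1-4) by simp_all
  then show "z x = of_real (iv q 1 0 x) * z 0 + of_real (iv q 0 1 x) * z' 0"
    "z' x = of_real (ivd q 1 0 x) * z 0 + of_real (ivd q 0 1 x) * z' 0"
    using AB(5,6)[of x] by (simp_all add: algebra_simps)
qed

lemma sol_unique:
  fixes z w :: "real \<Rightarrow> 'a::{euclidean_space,real_normed_field}"
  assumes "pot q" "sol q z z'" "sol q w w'" "z 0 = w 0" "z' 0 = w' 0"
  shows "z = w" "z' = w'"
proof -
  show "z = w"
  proof
    fix x show "z x = w x"
      unfolding sol_fundamental(1)[OF assms(1,2), of x] sol_fundamental(1)[OF assms(1,3), of x] assms(4,5) ..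
  qed
  show "z' = w'"
  proof
    fix x show "z' x = w' x"
      unfolding sol_fundamental(2)[OF assms(1,2), of x] sol_fundamental(2)[OF assms(1,3), of x] assms(4,5) ..
  qed
qed

lemma iv_linear:
  assumes "pot q"
  shows "iv q a b x = iv q 1 0 x * a + iv q 0 1 x * b" "ivd q a b x = ivd q 1 0 x * a + ivd q 0 1 x * b"
  using sol_fundamental[OF assms ivp_sol(1)[OF assms, of a b], of x] unfolding ivp_sol(2,3)[OF assms] by simp_all

lemma iv_pruf:
  assumes q: "pot q" and t: "pruf q \<theta>" and Q: "\<And>x. \<bar>q x\<bar> \<le> Q"
  shows "\<exists>r. (\<forall>x. r x > 0) \<and> (\<forall>x. r x \<le> exp ((1 + Q) * \<bar>x\<bar>))
     \<and> iv q (sin (\<theta> 0)) (cos (\<theta> 0)) = (\<lambda>x. r x * sin (\<theta> x)) \<and> ivd q (sin (\<theta> 0)) (cos (\<theta> 0)) = (\<lambda>x. r x * cos (\<theta> x))"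
proof -
  obtain r where r: "r 0 = 1" "\<forall>x. r x > 0" "\<forall>x. r x \<le> exp ((1 + Q) * \<bar>x\<bar>)"
      "sol q (\<lambda>x. r x * sin (\<theta> x)) (\<lambda>x. r x * cos (\<theta> x))"
    using pruf_radius[OF q t Q] by blast
  have "iv q (sin (\<theta> 0)) (cos (\<theta> 0)) = (\<lambda>x. r x * sin (\<theta> x))" "ivd q (sin (\<theta> 0)) (cos (\<theta> 0)) = (\<lambda>x. r x * cos (\<theta> x))"
    by (rule sol_unique[OF q ivp_sol(1)[OF q] r(4)]; simp add: r(1) ivp_sol[OF q])+
  then show ?thesis using r by blast
qed

lemma iv_bound:
  assumes q: "pot q" and Q: "\<And>x. \<bar>q x\<bar> \<le> Q"
  shows "\<bar>iv q a b x\<bar> \<le> sqrt (a\<^sup>2 + b\<^sup>2) * exp ((1 + Q) * \<bar>x\<bar>)"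
    "\<bar>ivd q a b x\<bar> \<le> sqrt (a\<^sup>2 + b\<^sup>2) * exp ((1 + Q) * \<bar>x\<bar>)"
proof -
  obtain R t where R: "R \<ge> 0" "a = R * sin t" "b = R * cos t" "R = sqrt (a\<^sup>2 + b\<^sup>2)" using polar_coordinates by metis
  obtain \<theta> where th: "\<theta> 0 = t" "pruf q \<theta>" using pruf_exists[OF q] by blast
  obtain r where r: "r 0 = 1" "\<forall>x. r x > 0" "\<forall>x. r x \<le> exp ((1 + Q) * \<bar>x\<bar>)"
      "sol q (\<lambda>x. r x * sin (\<theta> x)) (\<lambda>x. r x * cos (\<theta> x))"
    using pruf_radius[OF q th(2) Q] by blast
  have "iv q a b = (\<lambda>x. R * (r x * sin (\<theta> x)))" "ivd q a b = (\<lambda>x. R * (r x * cos (\<theta> x)))"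
    by (rule sol_unique[OF q ivp_sol(1)[OF q] sol_cmult[OF r(4)]]; simp add: r(1) ivp_sol[OF q] R(2,3) th(1))+
  moreover have "R * (r x * c) \<le> R * exp ((1 + Q) * \<bar>x\<bar>)" if "0 \<le> c" "c \<le> 1" for c
  proof -
    have "r x * c \<le> exp ((1 + Q) * \<bar>x\<bar>) * 1" using r(2,3) that by (intro mult_mono) auto
    then show ?thesis using R(1) by (simp add: mult_left_mono)
  qed
  moreover have "r x > 0" using r by auto
  ultimately show "\<bar>iv q a b x\<bar> \<le> sqrt (a\<^sup>2 + b\<^sup>2) * exp ((1 + Q) * \<bar>x\<bar>)"
    "\<bar>ivd q a b x\<bar> \<le> sqrt (a\<^sup>2 + b\<^sup>2) * exp ((1 + Q) * \<bar>x\<bar>)"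
    using R(1) by (simp_all add: abs_mult R(4)[symmetric])
qed

text \<open>Of the three exponential factors, two come from the pair of solutions in the integrals
  for \<open>A\<close> and \<open>B\<close>, the third from the coefficients that rebuild the
  solution. The 2 counts the two terms of that reconstruction.\<close>

lemma iv_lipschitz:
  assumes q: "pot q" and p: "pot p" and Q: "\<And>x. \<bar>q x\<bar> \<le> Q" "\<And>x. \<bar>p x\<bar> \<le> Q" and e: "\<And>x. \<bar>p x - q x\<bar> \<le> \<epsilon>"
    and x: "0 \<le> x" "x \<le> X"
  shows "\<bar>iv p a b x - iv q a b x\<bar> \<le> 2 * sqrt (a\<^sup>2 + b\<^sup>2) * exp ((1 + Q) * X) ^ 3 * X * \<epsilon>"
    "\<bar>ivd p a b x - ivd q a b x\<bar> \<le> 2 * sqrt (a\<^sup>2 + b\<^sup>2) * exp ((1 + Q) * X) ^ 3 * X * \<epsilon>"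
proof -
  define K where "K = exp ((1 + Q) * X)"
  define R where "R = sqrt (a\<^sup>2 + b\<^sup>2)"
  have Q0: "Q \<ge> 0" "\<epsilon> \<ge> 0" using Q(1)[of 0] e[of 0] by auto
  have K0: "K > 0" "R \<ge> 0" by (auto simp: K_def R_def)
  have le: "exp ((1 + Q) * \<bar>s\<bar>) \<le> K" if "s \<in> {0..X}" for s
    using that Q0 unfolding K_def by (auto intro!: mult_left_mono)
  have b1: "\<bar>iv q 1 0 s\<bar> \<le> K" "\<bar>ivd q 1 0 s\<bar> \<le> K" "\<bar>iv q 0 1 s\<bar> \<le> K" "\<bar>ivd q 0 1 s\<bar> \<le> K" if "s \<in> {0..X}" for s
    using iv_bound[OF q Q(1), of 1 0 s] iv_bound[OF q Q(1), of 0 1 s] le[OF that] by auto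
  have b2: "\<bar>iv p a b s\<bar> \<le> R * K" if "s \<in> {0..X}" for s
    using iv_bound(1)[OF p Q(2), of a b s] mult_left_mono[OF le[OF that] K0(2)] by (simp add: R_def)
  obtain A B where AB: "lprim A (\<lambda>x. (p x - q x) *\<^sub>R (of_real (iv q 1 0 x) * iv p a b x))"
    "lprim B (\<lambda>x. (p x - q x) *\<^sub>R (of_real (iv q 0 1 x) * iv p a b x))" "A 0 = ivd p a b 0" "B 0 = - iv p a b 0"
    "\<And>x. iv p a b x = of_real (iv q 0 1 x) * A x - of_real (iv q 1 0 x) * B x"
    "\<And>x. ivd p a b x = of_real (ivd q 0 1 x) * A x - of_real (ivd q 1 0 x) * B x"
    using sol_duhamel[OF q ivp_sol(1)[OF p]] by blast
  define M where "M = \<epsilon> * (K * (R * K))"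
  have M0: "M \<ge> 0" using Q0 K0 by (simp add: M_def)
  have bd: "\<bar>(p s - q s) *\<^sub>R (of_real y * iv p a b s)\<bar> \<le> M" if "s \<in> {0..X}" "\<bar>y\<bar> \<le> K" for s y
    unfolding M_def real_scaleR_def abs_mult of_real_eq_id id_apply
    by (intro mult_mono e b2 that) (use K0 Q0 in auto)
  have "\<bar>A x - A 0\<bar> \<le> M * x - M * 0"
    by (rule lprim_abs_le[OF AB(1) lprim_linear x(1)]) (rule bd; use x b1 in auto)
  then have A: "\<bar>A x - b\<bar> \<le> M * X" using mult_left_mono[OF x(2) M0] ivp_sol[OF p] AB(3) by simp
  have "\<bar>B x - B 0\<bar> \<le> M * x - M * 0"
    by (rule lprim_abs_le[OF AB(2) lprim_linear x(1)]) (rule bd; use x b1 in auto)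
  then have B: "\<bar>B x + a\<bar> \<le> M * X" using mult_left_mono[OF x(2) M0] ivp_sol[OF p] AB(4) by simp
  have fin: "\<bar>u * (A x - b) - v * (B x + a)\<bar> \<le> 2 * R * K ^ 3 * X * \<epsilon>" if "\<bar>u\<bar> \<le> K" "\<bar>v\<bar> \<le> K" for u v
  proof -
    have "\<bar>u\<bar> * \<bar>A x - b\<bar> \<le> K * (M * X)" "\<bar>v\<bar> * \<bar>B x + a\<bar> \<le> K * (M * X)"
      using that A B K0 by (auto intro!: mult_mono)
    then have "\<bar>u * (A x - b) - v * (B x + a)\<bar> \<le> K * (M * X) + K * (M * X)"
      using abs_triangle_ineq4[of "u * (A x - b)" "v * (B x + a)"] by (simp add: abs_mult)
    also have "\<dots> = 2 * R * K ^ 3 * X * \<epsilon>" by (simp add: M_def power3_eq_cube)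
    finally show ?thesis .
  qed
  have xX: "x \<in> {0..X}" using x by simp
  have "iv p a b x - iv q a b x = iv q 0 1 x * (A x - b) - iv q 1 0 x * (B x + a)"
    using AB(5)[of x] iv_linear(1)[OF q, of a b x] by (simp add: algebra_simps)
  then show "\<bar>iv p a b x - iv q a b x\<bar> \<le> 2 * sqrt (a\<^sup>2 + b\<^sup>2) * exp ((1 + Q) * X) ^ 3 * X * \<epsilon>"
    using fin[OF b1(3)[OF xX] b1(1)[OF xX]] by (simp add: K_def R_def)
  have "ivd p a b x - ivd q a b x = ivd q 0 1 x * (A x - b) - ivd q 1 0 x * (B x + a)"
    using AB(6)[of x] iv_linear(2)[OF q, of a b x] by (simp add: algebra_simps)
  then show "\<bar>ivd p a b x - ivd q a b x\<bar> \<le> 2 * sqrt (a\<^sup>2 + b\<^sup>2) * exp ((1 + Q) * X) ^ 3 * X * \<epsilon>"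
    using fin[OF b1(4)[OF xX] b1(2)[OF xX]] by (simp add: K_def R_def)
qed

section \<open>Rotation over one period\<close>

definition prufer :: "(real \<Rightarrow> real) \<Rightarrow> real \<Rightarrow> real \<Rightarrow> real" where
  "prufer q t = (THE \<theta>. \<theta> 0 = t \<and> pruf q \<theta>)"

lemma prufer_ex1: "pot q \<Longrightarrow> \<exists>!\<theta>. \<theta> 0 = t \<and> pruf q \<theta>"
  using pruf_exists[of q t] pruf_unique[of q] by blast

lemma prufer_sol: "pot q \<Longrightarrow> prufer q t 0 = t" "pot q \<Longrightarrow> pruf q (prufer q t)"
  using theI'[OF prufer_ex1, of q t] by (simp_all add: prufer_def)

lemma prufer_eqI: "pot q \<Longrightarrow> pruf q \<theta> \<Longrightarrow> prufer q (\<theta> 0) = \<theta>"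
  using pruf_unique[of q "prufer q (\<theta> 0)" \<theta>] prufer_sol[of q] by simp

definition rot :: "real \<Rightarrow> (real \<Rightarrow> real) \<Rightarrow> real \<Rightarrow> real" where
  "rot X q t = prufer q t X - t"

lemma pot_const [simp]: "pot (\<lambda>_. c)"
  unfolding pot_def by auto

lemma pot_shift: "pot V \<Longrightarrow> pot (\<lambda>x. V x - c)"
proof -
  assume V: "pot V"
  obtain Q where "\<And>x. \<bar>V x\<bar> \<le> Q" using pot_bound[OF V] by blast
  then have "\<bar>V x - c\<bar> \<le> Q + \<bar>c\<bar>" for x using abs_triangle_ineq4[of "V x" c] by (meson add_right_mono order_trans)
  then show ?thesis using V unfolding pot_def by auto
qed

text \<open>Only squares of sine and cosine enter the equation, since a solution and its negative
  span the same line.\<close>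

lemma prufer_shift_pi:
  assumes "pot q" shows "prufer q (t + of_int n * pi) = (\<lambda>x. prufer q t x + of_int n * pi)"
proof -
  have s: "sin (of_int n * pi) = 0" by (simp add: sin_zero_iff_int2)
  have c: "(cos (of_int n * pi))\<^sup>2 = 1" using sin_cos_squared_add[of "of_int n * pi"] s by simp
  have "(sin (x + of_int n * pi))\<^sup>2 = (sin x)\<^sup>2" "(cos (x + of_int n * pi))\<^sup>2 = (cos x)\<^sup>2" for x
    by (simp_all add: sin_add cos_add s power_mult_distrib c)
  moreover have "lprim (\<lambda>x. prufer q t x + of_int n * pi) (\<lambda>x. ((cos (prufer q t x))\<^sup>2 - q x * (sin (prufer q t x))\<^sup>2) + 0)"
    using prufer_sol(2)[OF assms, of t] unfolding pruf_def by (intro lprim_add) (auto simp: lprim_def)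
  ultimately have "pruf q (\<lambda>x. prufer q t x + of_int n * pi)" unfolding pruf_def by simp
  from prufer_eqI[OF assms this] show ?thesis using prufer_sol(1)[OF assms] by simp
qed

lemma rot_periodic: "pot q \<Longrightarrow> rot X q (t + of_int n * pi) = rot X q t"
  by (simp add: rot_def prufer_shift_pi)

lemma prufer_strict_mono: "pot q \<Longrightarrow> s < t \<Longrightarrow> prufer q s x < prufer q t x"
  by (rule pruf_less) (auto simp: prufer_sol)

lemma mod_pi_shift: "\<exists>n::int. t \<le> s + of_int n * pi \<and> s + of_int n * pi < t + pi"
proof -
  define n where "n = \<lceil>(t - s) / pi\<rceil>"
  have "(t - s) / pi \<le> of_int n" "of_int n < (t - s) / pi + 1"
    unfolding n_def by linarith+
  then have "t - s \<le> of_int n * pi" "of_int n * pi < t - s + pi"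
    using pi_gt_zero by (simp_all add: field_simps)
  then show ?thesis by (intro exI[of _ n]) linarith
qed

text \<open>The terminal angle is increasing in the initial one and commutes with translation by
  \<pi>, like a lift of a circle map; this limits the oscillation of the displacement. The strict
  bound separates consecutive gaps and gives every band positive length.\<close>

lemma rot_osc:
  assumes "pot q" shows "rot X q s - rot X q t < pi"
proof -
  obtain n :: int where n: "t \<le> s + of_int n * pi" "s + of_int n * pi < t + pi" using mod_pi_shift by blast
  have "prufer q (s + of_int n * pi) X < prufer q (t + of_int 1 * pi) X"
    using prufer_strict_mono[OF assms, of "s + of_int n * pi" "t + of_int 1 * pi" X] n by simp
  also have "\<dots> = prufer q t X + pi" by (subst prufer_shift_pi[OF assms]) simp
  finally have "rot X q (s + of_int n * pi) + (s + of_int n * pi) < rot X q t + t + pi" by (simp add: rot_def)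
  with n show ?thesis by (simp add: rot_periodic[OF assms])
qed

lemma rot_lipschitz:
  assumes "pot q1" "pot q2" "\<And>x. \<bar>q1 x\<bar> \<le> Q" "\<And>x. \<bar>q2 x - q1 x\<bar> \<le> \<epsilon>" "X \<ge> 0"
  shows "\<bar>rot X q1 s - rot X q2 t\<bar> \<le> exp (2 * (1 + Q) * X) * (\<bar>s - t\<bar> + \<epsilon> * X) + \<bar>s - t\<bar>"
  using pruf_lipschitz[OF assms(1,2) prufer_sol(2)[OF assms(1)] prufer_sol(2)[OF assms(2)] assms(3-5), of s t]
  by (simp add: rot_def prufer_sol(1)[OF assms(1)] prufer_sol(1)[OF assms(2)])

lemma rot_continuous:
  assumes "pot q" "X \<ge> 0" shows "continuous_on S (rot X q)"
proof -
  obtain Q where Q: "\<And>x. \<bar>q x\<bar> \<le> Q" using pot_bound[OF assms(1)] by blast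
  have "\<bar>rot X q s - rot X q t\<bar> \<le> (exp (2 * (1 + Q) * X) + 1) * \<bar>s - t\<bar>" for s t
    using rot_lipschitz[OF assms(1) assms(1) Q, of 0 X s t] assms(2) by (simp add: algebra_simps)
  then have "(exp (2 * (1 + Q) * X) + 1)-lipschitz_on S (rot X q)"
    by (intro lipschitz_onI) (auto simp: dist_real_def)
  then show ?thesis by (rule lipschitz_on_continuous_on)
qed

lemma rot_mono_q:
  assumes "pot q1" "pot q2" "X \<ge> 0" "\<And>x. q1 x \<le> q2 x" shows "rot X q2 t \<le> rot X q1 t"
  using pruf_mono_q[OF assms(1,2) prufer_sol(2)[OF assms(1)] prufer_sol(2)[OF assms(2)] _ assms(3,4), of t t]
  by (simp add: rot_def prufer_sol(1)[OF assms(1)] prufer_sol(1)[OF assms(2)])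

lemma rot_strict_mono_q:
  assumes "pot q1" "pot q2" "X > 0" "D > 0" "\<And>x. q1 x + D \<le> q2 x" shows "rot X q2 t < rot X q1 t"
proof -
  have p: "pot (\<lambda>x. q1 x + D)" using pot_shift[OF assms(1), of "-D"] by simp
  have "rot X q2 t \<le> rot X (\<lambda>x. q1 x + D) t" by (rule rot_mono_q) (use assms p in auto)
  also have "\<dots> < rot X q1 t"
    using pruf_strict_mono_q[OF assms(1) p prufer_sol(2)[OF assms(1)] prufer_sol(2)[OF p] _ assms(3,4), of t t]
    by (simp add: rot_def prufer_sol(1)[OF assms(1)] prufer_sol(1)[OF p])
  finally show ?thesis .
qed

text \<open>Exponential or constant solutions have a constant angle; they serve as barriers in the
  next two lemmas.\<close>

lemma rot_equilibrium:
  assumes "(cos t)\<^sup>2 = c * (sin t)\<^sup>2" shows "rot X (\<lambda>_. c) t = 0"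
proof -
  have "pruf (\<lambda>_. c) (\<lambda>_. t)" unfolding pruf_def using assms by (auto simp: lprim_def)
  from prufer_eqI[OF pot_const this] show ?thesis by (simp add: rot_def)
qed

text \<open>Comparison with the potential 0, whose constant solution stays at angle \<pi>/2.\<close>

lemma rot_negative:
  assumes "pot q" "X > 0" "D > 0" "\<And>x. D \<le> q x" shows "rot X q (pi / 2) < 0"
  using rot_strict_mono_q[OF pot_const assms(1-3), of 0 "pi / 2"] assms(4) rot_equilibrium[of "pi/2" 0 X] by simp

lemma rot_positive:
  assumes "pot q" "X > 0" shows "\<exists>t. rot X q t > 0"
proof -
  obtain Q where Q: "\<And>x. \<bar>q x\<bar> \<le> Q" using pot_bound[OF assms(1)] by blast
  have Q0: "Q \<ge> 0" using Q[of 0] by linarith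
  define R where "R = sqrt (Q + 1)"
  have R: "R > 0" "R\<^sup>2 = Q + 1" using Q0 by (auto simp: R_def)
  \<comment> \<open>The angle of \<open>exp (R * x)\<close>, an equilibrium for the constant
    potential \<open>Q + 1\<close>, which exceeds \<open>q\<close> by at least 1.\<close>
  define t where "t = arctan (1 / R)"
  have "cos t \<noteq> 0" by (simp add: t_def)
  then have "sin t = cos t / R" using tan_arctan[of "1/R"] by (simp add: t_def tan_def field_simps)
  then have "(cos t)\<^sup>2 = (Q + 1) * (sin t)\<^sup>2" using R Q0 by (simp add: power_divide)
  then have "rot X (\<lambda>_. Q + 1) t = 0" by (rule rot_equilibrium)
  moreover have "q x + 1 \<le> Q + 1" for x using Q[of x] by linarith
  ultimately show ?thesis using rot_strict_mono_q[OF assms(1) pot_const assms(2), of 1 "Q + 1" t] by auto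
qed

text \<open>For \<open>q \<le> - N\<^sup>2\<close> the rescaled angle \<open>arctan (N tan \<theta>)\<close> grows at least at rate \<open>N\<close>; the map below
  is its continuous branch that stays within \<open>\<pi>/2\<close> of \<open>\<theta>\<close>.\<close>

lemma rescaled_angle_deriv:
  fixes N :: real assumes N: "N > 0"
  shows "((\<lambda>t. t + arctan ((N - 1) * (sin t * cos t) / ((cos t)\<^sup>2 + N * (sin t)\<^sup>2)))
    has_real_derivative N / ((cos t)\<^sup>2 + N\<^sup>2 * (sin t)\<^sup>2)) (at t)"
proof -
  define s c where "s = sin t" and "c = cos t"
  have sc: "s\<^sup>2 + c\<^sup>2 = 1" by (simp add: s_def c_def)
  have sum_pos: "c\<^sup>2 + k * s\<^sup>2 > 0" if "k > 0" for k
  proof (cases "s = 0")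
    case True then show ?thesis using sc by simp
  next
    case False then show ?thesis using that by (intro add_nonneg_pos mult_pos_pos) auto
  qed
  define d where "d = c\<^sup>2 + N * s\<^sup>2"
  define e where "e = c\<^sup>2 + N\<^sup>2 * s\<^sup>2"
  have d: "d > 0" and e: "e > 0" using sum_pos[of N] sum_pos[of "N\<^sup>2"] N by (auto simp: d_def e_def)
  define w where "w = (N - 1) * (s * c) / d"
  have "((\<lambda>t. t + arctan ((N - 1) * (sin t * cos t) / ((cos t)\<^sup>2 + N * (sin t)\<^sup>2))) has_real_derivative
     1 + ((N - 1) * (c * c - s * s) * d - (N - 1) * (s * c) * (- 2 * c * s + N * (2 * s * c))) / (d * d) / (1 + w\<^sup>2)) (at t)"
  proof -
    have u: "((\<lambda>t. (N - 1) * (sin t * cos t)) has_real_derivative (N - 1) * (c * c - s * s)) (at t)"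
      by (auto intro!: derivative_eq_intros simp: s_def c_def algebra_simps)
    have v: "((\<lambda>t. (cos t)\<^sup>2 + N * (sin t)\<^sup>2) has_real_derivative - 2 * c * s + N * (2 * s * c)) (at t)"
      by (auto intro!: derivative_eq_intros simp: s_def c_def algebra_simps)
    have d': "(cos t)\<^sup>2 + N * (sin t)\<^sup>2 = d" by (simp add: d_def s_def c_def)
    have "((\<lambda>t. (N - 1) * (sin t * cos t) / ((cos t)\<^sup>2 + N * (sin t)\<^sup>2)) has_real_derivative
       ((N - 1) * (c * c - s * s) * d - (N - 1) * (s * c) * (- 2 * c * s + N * (2 * s * c))) / (d * d)) (at t)"
      using DERIV_divide[OF u v] d unfolding d' by (simp add: s_def c_def)
    from DERIV_add[OF DERIV_ident DERIV_chain2[OF DERIV_arctan this]]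
    show ?thesis unfolding d' by (simp add: w_def s_def c_def divide_inverse mult.commute)
  qed
  \<comment> \<open>The target is the derivative of \<open>arctan (N * tan t)\<close>. The formula
    differentiated here comes from the subtraction theorem for arctan and has no pole where the
    cosine vanishes.\<close>
  moreover have "1 + ((N - 1) * (c * c - s * s) * d - (N - 1) * (s * c) * (- 2 * c * s + N * (2 * s * c))) / (d * d) / (1 + w\<^sup>2) = N / e"
  proof -
    have e2: "d\<^sup>2 * (1 + w\<^sup>2) = e"
    proof -
      have "d\<^sup>2 * (1 + w\<^sup>2) = d\<^sup>2 + (N - 1)\<^sup>2 * (s * c)\<^sup>2"
        using d by (simp add: w_def power_divide power_mult_distrib distrib_left)
      also have "\<dots> = (c\<^sup>2 + N\<^sup>2 * s\<^sup>2) * (s\<^sup>2 + c\<^sup>2)" unfolding d_def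
        by (simp add: power2_eq_square algebra_simps)
      finally show ?thesis by (simp add: sc e_def)
    qed
    have num: "(N - 1) * (c * c - s * s) * d - (N - 1) * (s * c) * (- 2 * c * s + N * (2 * s * c)) = (N - 1) * (c\<^sup>2 - N * s\<^sup>2)"
    proof -
      have "(N - 1) * (c * c - s * s) * d - (N - 1) * (s * c) * (- 2 * c * s + N * (2 * s * c)) = (N - 1) * (c\<^sup>2 - N * s\<^sup>2) * (s\<^sup>2 + c\<^sup>2)"
        unfolding d_def by (simp add: power2_eq_square algebra_simps)
      then show ?thesis by (simp add: sc)
    qed
    have "((N - 1) * (c * c - s * s) * d - (N - 1) * (s * c) * (- 2 * c * s + N * (2 * s * c))) / (d * d) / (1 + w\<^sup>2) = (N - 1) * (c\<^sup>2 - N * s\<^sup>2) / e"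
      unfolding num e2[symmetric] by (simp add: power2_eq_square)
    also have "1 + \<dots> = (e + (N - 1) * (c\<^sup>2 - N * s\<^sup>2)) / e" using e by (simp add: field_simps)
    also have "e + (N - 1) * (c\<^sup>2 - N * s\<^sup>2) = N * (s\<^sup>2 + c\<^sup>2)"
      unfolding e_def by (simp add: power2_eq_square algebra_simps)
    finally show ?thesis by (simp add: sc)
  qed
  ultimately show ?thesis by (simp add: e_def s_def c_def)
qed

lemma rot_large:
  assumes q: "pot q" and X: "X \<ge> 0" and N: "N > 0" and le: "\<And>x. q x \<le> - N\<^sup>2"
  shows "rot X q t \<ge> N * X - pi"
proof -
  define \<phi> where "\<phi> = (\<lambda>t. t + arctan ((N - 1) * (sin t * cos t) / ((cos t)\<^sup>2 + N * (sin t)\<^sup>2)))"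
  define \<theta> where "\<theta> = prufer q t"
  have th: "\<theta> 0 = t" "lprim \<theta> (\<lambda>x. (cos (\<theta> x))\<^sup>2 - q x * (sin (\<theta> x))\<^sup>2)"
    using prufer_sol[OF q, of t] by (simp_all add: \<theta>_def pruf_def)
  have pos: "(cos t)\<^sup>2 + N\<^sup>2 * (sin t)\<^sup>2 > 0" for t
  proof (cases "sin t = 0")
    case True then show ?thesis using sin_cos_squared_add[of t] by simp
  next
    case False then show ?thesis using N by (intro add_nonneg_pos mult_pos_pos) auto
  qed
  have "lprim (\<lambda>x. \<phi> (\<theta> x)) (\<lambda>x. N / ((cos (\<theta> x))\<^sup>2 + N\<^sup>2 * (sin (\<theta> x))\<^sup>2) * ((cos (\<theta> x))\<^sup>2 - q x * (sin (\<theta> x))\<^sup>2))"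
  proof (rule lprim_chain[OF th(2)])
    show "(\<phi> has_real_derivative N / ((cos x)\<^sup>2 + N\<^sup>2 * (sin x)\<^sup>2)) (at x)" for x
      unfolding \<phi>_def by (rule rescaled_angle_deriv[OF N])
    show "continuous_on UNIV (\<lambda>x. N / ((cos x)\<^sup>2 + N\<^sup>2 * (sin x)\<^sup>2))"
      by (intro continuous_intros) (use pos in \<open>auto simp: less_imp_neq[symmetric]\<close>)
  qed
  from lprim_mono[OF lprim_diff[OF this lprim_linear[of N]] X]
  have "\<phi> (\<theta> 0) - N * 0 \<le> \<phi> (\<theta> X) - N * X"
  proof -
    have "N \<le> N / ((cos (\<theta> x))\<^sup>2 + N\<^sup>2 * (sin (\<theta> x))\<^sup>2) * ((cos (\<theta> x))\<^sup>2 - q x * (sin (\<theta> x))\<^sup>2)" for x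
    proof -
      have "N\<^sup>2 * (sin (\<theta> x))\<^sup>2 \<le> - q x * (sin (\<theta> x))\<^sup>2" using le[of x] by (intro mult_right_mono) auto
      then have "(cos (\<theta> x))\<^sup>2 + N\<^sup>2 * (sin (\<theta> x))\<^sup>2 \<le> (cos (\<theta> x))\<^sup>2 - q x * (sin (\<theta> x))\<^sup>2" by simp
      then have "N * ((cos (\<theta> x))\<^sup>2 + N\<^sup>2 * (sin (\<theta> x))\<^sup>2) \<le> N * ((cos (\<theta> x))\<^sup>2 - q x * (sin (\<theta> x))\<^sup>2)"
        using N by (intro mult_left_mono) auto
      then show ?thesis using pos[of "\<theta> x"] by (simp add: pos_le_divide_eq)
    qed
    then show ?thesis using lprim_mono[OF lprim_diff[OF \<open>lprim (\<lambda>x. \<phi> (\<theta> x)) _\<close> lprim_linear[of N]] X] by simp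
  qed
  \<comment> \<open>Passing between the angle and its rescaled version costs less than \<pi>/2 at
    each end of the period, whence the loss of \<pi>.\<close>
  moreover have "\<bar>\<phi> x - x\<bar> < pi / 2" for x
  proof -
    define a where "a = (N - 1) * (sin x * cos x) / ((cos x)\<^sup>2 + N * (sin x)\<^sup>2)"
    have "\<bar>arctan a\<bar> < pi / 2" using arctan_lbound[of a] arctan_ubound[of a] by linarith
    then show ?thesis unfolding \<phi>_def a_def by simp
  qed
  ultimately have "\<theta> X - \<theta> 0 \<ge> N * X - pi" using \<open>\<And>x. \<bar>\<phi> x - x\<bar> < pi / 2\<close>[of "\<theta> 0"] \<open>\<And>x. \<bar>\<phi> x - x\<bar> < pi / 2\<close>[of "\<theta> X"] by linarith
  then show ?thesis by (simp add: rot_def \<theta>_def prufer_sol(1)[OF q])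
qed

section \<open>Extremal rotation over all initial angles\<close>

definition rmax :: "real \<Rightarrow> (real \<Rightarrow> real) \<Rightarrow> real" where "rmax X q = Sup (range (rot X q))"
definition rmin :: "real \<Rightarrow> (real \<Rightarrow> real) \<Rightarrow> real" where "rmin X q = Inf (range (rot X q))"

lemma rmax_attained:
  assumes "pot q" "X \<ge> 0"
  shows "\<exists>t. rot X q t = rmax X q" "rot X q s \<le> rmax X q" "\<exists>t. rot X q t = rmin X q" "rmin X q \<le> rot X q s"
proof -
  \<comment> \<open>Periodicity reduces all initial angles to a compact interval, where continuity
    yields extrema.\<close>
  have red: "\<exists>u\<in>{0..pi}. rot X q u = rot X q s" for s
  proof -
    obtain n :: int where n: "0 \<le> s + of_int n * pi" "s + of_int n * pi < 0 + pi" using mod_pi_shift[of 0 s] by blast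
    then show ?thesis using rot_periodic[OF assms(1), of X s n] by (intro bexI[of _ "s + of_int n * pi"]) auto
  qed
  obtain t where t: "t \<in> {0..pi}" "\<forall>u\<in>{0..pi}. rot X q u \<le> rot X q t"
    using continuous_attains_sup[OF compact_Icc _ rot_continuous[OF assms], of 0 pi] by auto
  have tt: "rot X q u \<le> rot X q t" for u using red[of u] t(2) by fastforce
  then have T: "rmax X q = rot X q t" unfolding rmax_def by (intro cSup_eq_maximum) auto
  then show "\<exists>t. rot X q t = rmax X q" "rot X q s \<le> rmax X q" using tt by auto
  obtain t where t: "t \<in> {0..pi}" "\<forall>u\<in>{0..pi}. rot X q t \<le> rot X q u"
    using continuous_attains_inf[OF compact_Icc _ rot_continuous[OF assms], of 0 pi] by auto
  have tt: "rot X q t \<le> rot X q u" for u using red[of u] t(2) by fastforce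
  then have T: "rmin X q = rot X q t" unfolding rmin_def by (intro cInf_eq_minimum) auto
  then show "\<exists>t. rot X q t = rmin X q" "rmin X q \<le> rot X q s" using tt by auto
qed

lemma rmax_rmin_osc: "pot q \<Longrightarrow> X \<ge> 0 \<Longrightarrow> rmax X q < rmin X q + pi"
  using rmax_attained(1,3)[of q X] rot_osc[of q X] by (metis add.commute diff_less_eq)

lemma rmin_le_rmax: "pot q \<Longrightarrow> X \<ge> 0 \<Longrightarrow> rmin X q \<le> rmax X q"
  using rmax_attained(2,4)[of q X 0] by linarith

lemma rmax_pos: "pot q \<Longrightarrow> X > 0 \<Longrightarrow> rmax X q > 0"
  using rot_positive[of q X] rmax_attained(2)[of q X] by (metis less_imp_le less_le_trans)

lemma extremal_rot_strict_mono:
  assumes "pot V" "X > 0" "\<mu> < \<nu>"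
  shows "rmax X (\<lambda>x. V x - \<mu>) < rmax X (\<lambda>x. V x - \<nu>)" "rmin X (\<lambda>x. V x - \<mu>) < rmin X (\<lambda>x. V x - \<nu>)"
proof -
  note p = pot_shift[OF assms(1)]
  have lt: "rot X (\<lambda>x. V x - \<mu>) t < rot X (\<lambda>x. V x - \<nu>) t" for t
    by (rule rot_strict_mono_q[OF p p assms(2), of "\<nu> - \<mu>"]) (use assms(3) in auto)
  have X: "X \<ge> 0" using assms(2) by simp
  obtain t where "rot X (\<lambda>x. V x - \<mu>) t = rmax X (\<lambda>x. V x - \<mu>)" using rmax_attained(1)[OF p X] by blast
  then show "rmax X (\<lambda>x. V x - \<mu>) < rmax X (\<lambda>x. V x - \<nu>)"
    using lt[of t] rmax_attained(2)[OF p X, of \<nu> t] by linarith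
  obtain t where "rot X (\<lambda>x. V x - \<nu>) t = rmin X (\<lambda>x. V x - \<nu>)" using rmax_attained(3)[OF p X] by blast
  then show "rmin X (\<lambda>x. V x - \<mu>) < rmin X (\<lambda>x. V x - \<nu>)"
    using lt[of t] rmax_attained(4)[OF p X, of \<mu> t] by linarith
qed

lemma extremal_rot_lipschitz:
  assumes V: "pot V" and X: "X > 0" and Q: "\<And>x. \<bar>V x\<bar> \<le> Q" and m: "\<bar>\<mu>\<bar> \<le> N"
  shows "\<bar>rmax X (\<lambda>x. V x - \<mu>) - rmax X (\<lambda>x. V x - \<nu>)\<bar> \<le> exp (2 * (1 + (Q + N)) * X) * X * \<bar>\<mu> - \<nu>\<bar>"
    "\<bar>rmin X (\<lambda>x. V x - \<mu>) - rmin X (\<lambda>x. V x - \<nu>)\<bar> \<le> exp (2 * (1 + (Q + N)) * X) * X * \<bar>\<mu> - \<nu>\<bar>"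
proof -
  note p = pot_shift[OF V]
  have X0: "X \<ge> 0" using X by simp
  have b: "\<bar>V x - \<mu>\<bar> \<le> Q + N" for x using Q[of x] m by linarith
  have l: "\<bar>rot X (\<lambda>x. V x - \<mu>) t - rot X (\<lambda>x. V x - \<nu>) t\<bar> \<le> exp (2 * (1 + (Q + N)) * X) * X * \<bar>\<mu> - \<nu>\<bar>" for t
    using rot_lipschitz[OF p p b, of \<nu> "\<bar>\<mu> - \<nu>\<bar>" X t t] X by (simp add: mult_ac)
  obtain t where t: "rot X (\<lambda>x. V x - \<mu>) t = rmax X (\<lambda>x. V x - \<mu>)" using rmax_attained(1)[OF p X0] by blast
  obtain s where s: "rot X (\<lambda>x. V x - \<nu>) s = rmax X (\<lambda>x. V x - \<nu>)" using rmax_attained(1)[OF p X0] by blast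
  show "\<bar>rmax X (\<lambda>x. V x - \<mu>) - rmax X (\<lambda>x. V x - \<nu>)\<bar> \<le> exp (2 * (1 + (Q + N)) * X) * X * \<bar>\<mu> - \<nu>\<bar>"
    using l[of s] l[of t] s t rmax_attained(2)[OF p X0, of \<mu> s] rmax_attained(2)[OF p X0, of \<nu> t] by linarith
  obtain t where t: "rot X (\<lambda>x. V x - \<mu>) t = rmin X (\<lambda>x. V x - \<mu>)" using rmax_attained(3)[OF p X0] by blast
  obtain s where s: "rot X (\<lambda>x. V x - \<nu>) s = rmin X (\<lambda>x. V x - \<nu>)" using rmax_attained(3)[OF p X0] by blast
  show "\<bar>rmin X (\<lambda>x. V x - \<mu>) - rmin X (\<lambda>x. V x - \<nu>)\<bar> \<le> exp (2 * (1 + (Q + N)) * X) * X * \<bar>\<mu> - \<nu>\<bar>"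
    using l[of s] l[of t] s t rmax_attained(4)[OF p X0, of \<mu> s] rmax_attained(4)[OF p X0, of \<nu> t] by linarith
qed

lemma local_lipschitz_isCont:
  fixes f :: "real \<Rightarrow> real"
  assumes "\<And>y. \<bar>f x - f y\<bar> \<le> L * \<bar>x - y\<bar>" shows "isCont f x"
proof -
  have "((\<lambda>y. f y - f x) \<longlongrightarrow> 0) (at x)"
  proof (rule Lim_null_comparison)
    show "eventually (\<lambda>y. norm (f y - f x) \<le> L * \<bar>x - y\<bar>) (at x)"
      using assms by (simp add: abs_minus_commute)
    have "((\<lambda>y. L * \<bar>x - y\<bar>) \<longlongrightarrow> L * \<bar>x - x\<bar>) (at x)" by (intro tendsto_intros)
    then show "((\<lambda>y. L * \<bar>x - y\<bar>) \<longlongrightarrow> 0) (at x)" by simp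
  qed
  then show ?thesis unfolding isCont_def by (rule LIM_zero_cancel)
qed

lemma extremal_rot_isCont:
  assumes "pot V" "X > 0"
  shows "isCont (\<lambda>\<mu>. rmax X (\<lambda>x. V x - \<mu>)) \<mu>" "isCont (\<lambda>\<mu>. rmin X (\<lambda>x. V x - \<mu>)) \<mu>"
proof -
  obtain Q where Q: "\<And>x. \<bar>V x\<bar> \<le> Q" using pot_bound[OF assms(1)] by blast
  show "isCont (\<lambda>\<mu>. rmax X (\<lambda>x. V x - \<mu>)) \<mu>" "isCont (\<lambda>\<mu>. rmin X (\<lambda>x. V x - \<mu>)) \<mu>"
    by (rule local_lipschitz_isCont, rule extremal_rot_lipschitz[OF assms Q order_refl])+
qed

text \<open>\<open>alpha X V n\<close> and \<open>beta X V n\<close> are the lower and upper ends of the \<open>n\<close>-th gap: the first and the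
  last \<open>\<mu>\<close> for which some solution of \<open>- y'' + V y = \<mu> y\<close> turns by exactly \<open>n \<pi>\<close> over a period.\<close>

definition alpha :: "real \<Rightarrow> (real \<Rightarrow> real) \<Rightarrow> nat \<Rightarrow> real" where
  "alpha X V n = (SOME \<mu>. rmax X (\<lambda>x. V x - \<mu>) = n * pi)"
definition beta :: "real \<Rightarrow> (real \<Rightarrow> real) \<Rightarrow> nat \<Rightarrow> real" where
  "beta X V n = (SOME \<mu>. rmin X (\<lambda>x. V x - \<mu>) = n * pi)"

lemma rmin_unbounded:
  assumes "pot V" "X > 0" shows "\<exists>\<mu>>c. rmin X (\<lambda>x. V x - \<mu>) \<ge> M"
proof -
  obtain Q where Q: "\<And>x. \<bar>V x\<bar> \<le> Q" using pot_bound[OF assms(1)] by blast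
  \<comment> \<open>\<open>N\<close> makes the growth \<open>N * X - pi\<close> reach
    \<open>M\<close>; \<mu> is then taken so large that
    \<open>V x - \<mu> \<le> - N\<^sup>2\<close>.\<close>
  define N where "N = max 1 ((M + pi) / X)"
  define \<mu> where "\<mu> = max (c + 1) (Q + N\<^sup>2)"
  have "V x - \<mu> \<le> - N\<^sup>2" for x using Q[of x] unfolding \<mu>_def by linarith
  then have "rot X (\<lambda>x. V x - \<mu>) t \<ge> N * X - pi" for t
    by (intro rot_large pot_shift assms) (use assms in \<open>auto simp: N_def\<close>)
  moreover have "N * X \<ge> M + pi"
  proof -
    have "(M + pi) / X * X \<le> N * X" using assms(2) by (intro mult_right_mono) (auto simp: N_def)
    then show ?thesis using assms(2) by simp
  qed
  ultimately have "rot X (\<lambda>x. V x - \<mu>) t \<ge> M" for t by (smt (verit))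
  then have "rmin X (\<lambda>x. V x - \<mu>) \<ge> M"
    using rmax_attained(3)[OF pot_shift[OF assms(1)], of X \<mu>] assms(2) by (metis less_imp_le)
  moreover have "\<mu> > c" by (simp add: \<mu>_def)
  ultimately show ?thesis by blast
qed

lemma rmin_negative:
  assumes "pot V" "X > 0" "\<And>x. V x \<ge> 0" "\<mu> < 0" shows "rmin X (\<lambda>x. V x - \<mu>) < 0"
proof -
  have "rot X (\<lambda>x. V x - \<mu>) (pi / 2) < 0"
    by (rule rot_negative[OF pot_shift[OF assms(1)] assms(2), of "-\<mu>"]) (use assms in auto)
  then show ?thesis using rmax_attained(4)[OF pot_shift[OF assms(1)], of X \<mu> "pi/2"] assms(2) by linarith
qed

text \<open>Nonnegativity makes \<open>Rmin\<close> negative for \<mu> < 0, which starts the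
  intermediate value arguments and yields positive gap edges.\<close>

locale hill =
  fixes X :: real and V :: "real \<Rightarrow> real"
  assumes X: "X > 0" and V: "pot V" and V_nonneg: "\<And>x. V x \<ge> 0"
begin

abbreviation "Rmax \<mu> \<equiv> rmax X (\<lambda>x. V x - \<mu>)"
abbreviation "Rmin \<mu> \<equiv> rmin X (\<lambda>x. V x - \<mu>)"

lemma X0: "X \<ge> 0" using X by simp

lemma potV: "pot (\<lambda>x. V x - \<mu>)" by (rule pot_shift[OF V])

text \<open>This includes \<open>n = 0\<close>, where \<open>beta X V 0\<close> is the bottom of the
  spectrum.\<close>

lemma rmin_beta: "Rmin (beta X V n) = n * pi"
proof -
  obtain \<mu> where \<mu>: "\<mu> > -1" "Rmin \<mu> \<ge> n * pi" using rmin_unbounded[OF V X] by blast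
  have "Rmin (-1) \<le> n * pi" using rmin_negative[OF V X V_nonneg, of "-1"] by (smt (verit) mult_nonneg_nonneg of_nat_0_le_iff pi_ge_zero)
  then have "\<exists>\<nu>\<ge>-1. \<nu> \<le> \<mu> \<and> Rmin \<nu> = n * pi"
    by (intro IVT) (use \<mu> extremal_rot_isCont(2)[OF V X] in auto)
  then have "\<exists>\<nu>. Rmin \<nu> = n * pi" by blast
  from someI_ex[OF this] show ?thesis unfolding beta_def .
qed

lemma beta_le_iff: "beta X V n \<le> \<mu> \<longleftrightarrow> n * pi \<le> Rmin \<mu>"
  using extremal_rot_strict_mono(2)[OF V X, of "beta X V n" \<mu>] extremal_rot_strict_mono(2)[OF V X, of \<mu> "beta X V n"]
  by (cases "beta X V n" \<mu> rule: linorder_cases) (auto simp: rmin_beta)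

text \<open>\<open>n = 0\<close> is excluded since \<open>Rmax\<close> is always positive. The edge
  is trapped between neighbouring values of \<open>beta\<close>: at the lower one
  \<open>Rmax < Rmin + pi = n * pi\<close>, at the upper one
  \<open>Rmax \<ge> Rmin = n * pi\<close>.\<close>

lemma rmax_alpha:
  assumes "n \<ge> 1" shows "Rmax (alpha X V n) = n * pi"
proof -
  let ?b = "beta X V (n - 1)" and ?c = "beta X V n"
  have "Rmax ?b < Rmin ?b + pi" by (rule rmax_rmin_osc[OF potV X0])
  also have "\<dots> = n * pi" using assms by (simp add: rmin_beta of_nat_diff algebra_simps)
  finally have 1: "Rmax ?b \<le> n * pi" by simp
  have 2: "n * pi \<le> Rmax ?c" using rmin_le_rmax[OF potV X0, of ?c] by (simp add: rmin_beta)
  have "real (n - 1) * pi \<le> real n * pi" by (intro mult_right_mono) auto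
  then have "?b \<le> ?c" unfolding beta_le_iff rmin_beta .
  then have "\<exists>\<nu>\<ge>?b. \<nu> \<le> ?c \<and> Rmax \<nu> = n * pi"
    by (intro IVT) (use 1 2 extremal_rot_isCont(1)[OF V X] in auto)
  then have "\<exists>\<nu>. Rmax \<nu> = n * pi" by blast
  from someI_ex[OF this] show ?thesis unfolding alpha_def .
qed

lemma le_alpha_iff: "n \<ge> 1 \<Longrightarrow> \<mu> \<le> alpha X V n \<longleftrightarrow> Rmax \<mu> \<le> n * pi"
  using extremal_rot_strict_mono(1)[OF V X, of "alpha X V n" \<mu>] extremal_rot_strict_mono(1)[OF V X, of \<mu> "alpha X V n"]
  by (cases "alpha X V n" \<mu> rule: linorder_cases) (auto simp: rmax_alpha)

lemma alpha_le_iff: "n \<ge> 1 \<Longrightarrow> alpha X V n \<le> \<mu> \<longleftrightarrow> n * pi \<le> Rmax \<mu>"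
  using extremal_rot_strict_mono(1)[OF V X, of "alpha X V n" \<mu>] extremal_rot_strict_mono(1)[OF V X, of \<mu> "alpha X V n"]
  by (cases "alpha X V n" \<mu> rule: linorder_cases) (auto simp: rmax_alpha)

lemma le_beta_iff: "\<mu> \<le> beta X V n \<longleftrightarrow> Rmin \<mu> \<le> n * pi"
  using extremal_rot_strict_mono(2)[OF V X, of "beta X V n" \<mu>] extremal_rot_strict_mono(2)[OF V X, of \<mu> "beta X V n"]
  by (cases "beta X V n" \<mu> rule: linorder_cases) (auto simp: rmin_beta)

lemma alpha_le_beta: "n \<ge> 1 \<Longrightarrow> alpha X V n \<le> beta X V n"
  unfolding le_beta_iff using rmin_le_rmax[OF potV X0, of "alpha X V n"] by (simp add: rmax_alpha)

text \<open>Bands have positive length because the oscillation bound is strict.\<close>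

lemma beta_less_alpha: "beta X V n < alpha X V (Suc n)"
proof -
  have "Rmax (beta X V n) < Rmin (beta X V n) + pi" by (rule rmax_rmin_osc[OF potV X0])
  then have "\<not> real (Suc n) * pi \<le> Rmax (beta X V n)" by (simp add: rmin_beta algebra_simps)
  then show ?thesis using alpha_le_iff[of "Suc n" "beta X V n"] by simp
qed

lemma beta_nonneg: "beta X V n \<ge> 0"
proof (rule ccontr)
  assume "\<not> ?thesis"
  then have "Rmin (beta X V n) < 0" by (intro rmin_negative[OF V X V_nonneg]) auto
  then show False by (simp add: rmin_beta mult_less_0_iff)
qed

lemma alpha_pos: "n \<ge> 1 \<Longrightarrow> alpha X V n > 0"
  using beta_less_alpha[of "n - 1"] beta_nonneg[of "n - 1"] by simp

end

section \<open>The discriminant\<close>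

lemma quadratic_form_zero:
  fixes a b d :: real assumes "b\<^sup>2 + 4 * a * d \<ge> 0"
  shows "\<exists>t. a * (cos t)\<^sup>2 + b * (sin t * cos t) - d * (sin t)\<^sup>2 = 0"
proof (cases "a = 0")
  case True then show ?thesis by (intro exI[of _ 0]) simp
next
  case False
  \<comment> \<open>A root of the dehomogenised form, that is, the cotangent of the angle
    sought.\<close>
  define c where "c = (- b + sqrt (b\<^sup>2 + 4 * a * d)) / (2 * a)"
  have "2 * a * c + b = sqrt (b\<^sup>2 + 4 * a * d)" using False by (simp add: c_def)
  then have "(2 * a * c + b)\<^sup>2 = b\<^sup>2 + 4 * a * d" using assms by simp
  then have "4 * a * (a * c\<^sup>2 + b * c - d) = 0" by (simp add: power2_eq_square algebra_simps)
  then have r: "a * c\<^sup>2 + b * c - d = 0" using False by simp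
  obtain R t where R: "R \<ge> 0" "1 = R * sin t" "c = R * cos t" using polar_coordinates[of 1 c] by blast
  then have "R \<noteq> 0" by auto
  have "R\<^sup>2 * (a * (cos t)\<^sup>2 + b * (sin t * cos t) - d * (sin t)\<^sup>2) = a * (R * cos t)\<^sup>2 + b * ((R * sin t) * (R * cos t)) - d * (R * sin t)\<^sup>2"
    by (simp add: power2_eq_square algebra_simps)
  also have "\<dots> = 0" using r unfolding R(2,3)[symmetric] by simp
  finally show ?thesis using \<open>R \<noteq> 0\<close> by (intro exI[of _ t]) simp
qed

lemma quadratic_form_indefinite:
  fixes a b d :: real assumes "b\<^sup>2 + 4 * a * d > 0"
  shows "\<exists>t. a * (cos t)\<^sup>2 + b * (sin t * cos t) - d * (sin t)\<^sup>2 > 0"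
    "\<exists>t. a * (cos t)\<^sup>2 + b * (sin t * cos t) - d * (sin t)\<^sup>2 < 0"
proof -
  define F where "F = (\<lambda>s c::real. a * c\<^sup>2 + b * (s * c) - d * s\<^sup>2)"
  have sc: "\<exists>R t. R > 0 \<and> F s c = R * F (sin t) (cos t)" if "F s c \<noteq> 0" for s c
  proof -
    obtain R t where R: "R \<ge> 0" "s = R * sin t" "c = R * cos t" using polar_coordinates by metis
    have "F s c = R\<^sup>2 * F (sin t) (cos t)" unfolding F_def R(2,3) by (simp add: power2_eq_square algebra_simps)
    moreover have "R \<noteq> 0" using that by (auto simp: F_def R(2,3))
    ultimately show ?thesis using R(1) by (intro exI[of _ "R\<^sup>2"] exI[of _ t]) auto
  qed
  have "\<exists>s c s' c'. F s c > 0 \<and> F s' c' < 0"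
  proof (cases "a = 0")
    case True
    then have b: "b \<noteq> 0" using assms by auto
    have "F 1 ((d + 1) / b) > 0" "F 1 ((d - 1) / b) < 0" using b True by (simp_all add: F_def)
    then show ?thesis by blast
  next
    case False
    \<comment> \<open>This point annihilates the completed square, so the sign there is opposite to
      that of \<open>a\<close>, the value at \<open>(0, 1)\<close>.\<close>
    have "F (2 * a) (- b) = - a * (b\<^sup>2 + 4 * a * d)" by (simp add: F_def power2_eq_square algebra_simps)
    moreover have "F 0 1 = a" by (simp add: F_def)
    ultimately consider "F 0 1 > 0" "F (2 * a) (- b) < 0" | "F 0 1 < 0" "F (2 * a) (- b) > 0"
      using False assms by (cases "a > 0") (auto simp: zero_less_mult_iff mult_less_0_iff)
    then show ?thesis by cases blast+
  qed
  then obtain s c s' c' where f: "F s c > 0" "F s' c' < 0" by blast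
  obtain R t where "R > 0" "F s c = R * F (sin t) (cos t)" using sc[of s c] f by auto
  with f(1) have "F (sin t) (cos t) > 0" by (simp add: zero_less_mult_iff)
  then show "\<exists>t. a * (cos t)\<^sup>2 + b * (sin t * cos t) - d * (sin t)\<^sup>2 > 0" unfolding F_def by blast
  obtain R t where "R > 0" "F s' c' = R * F (sin t) (cos t)" using sc[of s' c'] f by auto
  with f(2) have "F (sin t) (cos t) < 0" by (simp add: mult_less_0_iff)
  then show "\<exists>t. a * (cos t)\<^sup>2 + b * (sin t * cos t) - d * (sin t)\<^sup>2 < 0" unfolding F_def by blast
qed

text \<open>Completing the square after multiplication by \<open>4 * a\<close>; the factor
  \<open>a\<close> in the conclusion spares a distinction by its sign.\<close>

lemma quadratic_form_definite:
  fixes a b d s c :: real assumes "b\<^sup>2 + 4 * a * d \<le> 0"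
  shows "0 \<le> a * (a * c\<^sup>2 + b * (s * c) - d * s\<^sup>2)"
    "b\<^sup>2 + 4 * a * d < 0 \<Longrightarrow> s \<noteq> 0 \<or> c \<noteq> 0 \<Longrightarrow> 0 < a * (a * c\<^sup>2 + b * (s * c) - d * s\<^sup>2)"
proof -
  have *: "4 * (a * (a * c\<^sup>2 + b * (s * c) - d * s\<^sup>2)) = (2 * a * c + b * s)\<^sup>2 - (b\<^sup>2 + 4 * a * d) * s\<^sup>2"
    by (simp add: power2_eq_square algebra_simps)
  have "(b\<^sup>2 + 4 * a * d) * s\<^sup>2 \<le> 0" using assms by (simp add: mult_nonpos_nonneg)
  then show "0 \<le> a * (a * c\<^sup>2 + b * (s * c) - d * s\<^sup>2)" using * zero_le_power2[of "2 * a * c + b * s"] by linarith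
  show "0 < a * (a * c\<^sup>2 + b * (s * c) - d * s\<^sup>2)" if lt: "b\<^sup>2 + 4 * a * d < 0" and nz: "s \<noteq> 0 \<or> c \<noteq> 0"
  proof (cases "s = 0")
    case True
    moreover have "a \<noteq> 0" using lt by auto
    moreover have "a * (a * c\<^sup>2) = (a * c)\<^sup>2" by (simp add: power2_eq_square)
    ultimately show ?thesis using nz by simp
  next
    case False
    then have "(b\<^sup>2 + 4 * a * d) * s\<^sup>2 < 0" using lt by (simp add: mult_neg_pos)
    then show ?thesis using * zero_le_power2[of "2 * a * c + b * s"] by linarith
  qed
qed

lemma quadratic_form_signs:
  fixes a b d s c s' c' :: real
  assumes "a * c\<^sup>2 + b * (s * c) - d * s\<^sup>2 > 0" "a * c'\<^sup>2 + b * (s' * c') - d * s'\<^sup>2 < 0"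
  shows "b\<^sup>2 + 4 * a * d > 0"
proof (rule ccontr)
  assume n: "\<not> ?thesis"
  then have 1: "0 \<le> a * (a * c\<^sup>2 + b * (s * c) - d * s\<^sup>2)" "0 \<le> a * (a * c'\<^sup>2 + b * (s' * c') - d * s'\<^sup>2)"
    using quadratic_form_definite(1)[of b a d] by auto
  then have "a = 0" using assms by (auto simp: zero_le_mult_iff)
  with n have "b = 0" by simp
  have "d * s'\<^sup>2 > 0" "d * s\<^sup>2 < 0" using assms \<open>a = 0\<close> \<open>b = 0\<close> by auto
  then show False by (auto simp: zero_less_mult_iff mult_less_0_iff)
qed

lemma sin_shift_npi: "sin (x + real n * pi) = (- 1) ^ n * sin x"
proof (induction n)
  case (Suc n)
  have "sin (x + real (Suc n) * pi) = sin ((x + real n * pi) + pi)" by (simp add: algebra_simps)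
  then show ?case using Suc by simp
qed simp

lemma cos_shift_npi: "cos (x + real n * pi) = (- 1) ^ n * cos x"
proof (induction n)
  case (Suc n)
  have "cos (x + real (Suc n) * pi) = cos ((x + real n * pi) + pi)" by (simp add: algebra_simps)
  then show ?case using Suc by simp
qed simp

section \<open>The monodromy matrix and its rotation\<close>

context hill begin

abbreviation shifted where "shifted \<mu> \<equiv> \<lambda>x. V x - \<mu>"

text \<open>Entries of the monodromy matrix, which propagates \<open>(y, y')\<close> over one
  period; its trace \<open>disc\<close> is Hill's discriminant.\<close>

definition m11 where "m11 \<mu> = iv (shifted \<mu>) 1 0 X"
definition m12 where "m12 \<mu> = iv (shifted \<mu>) 0 1 X"
definition m21 where "m21 \<mu> = ivd (shifted \<mu>) 1 0 X"
definition m22 where "m22 \<mu> = ivd (shifted \<mu>) 0 1 X"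
definition disc where "disc \<mu> = m11 \<mu> + m22 \<mu>"

abbreviation "Rot \<mu> \<equiv> rot X (shifted \<mu>)"

lemma det: "m11 \<mu> * m22 \<mu> - m21 \<mu> * m12 \<mu> = 1"
  using wronskian_one[OF potV, of \<mu> X] by (simp add: m11_def m12_def m21_def m22_def)

text \<open>Cross product of the image of \<open>(sin t, cos t)\<close> under the monodromy with
  that vector; it vanishes exactly when the direction is an eigenvector.\<close>

abbreviation form where
  "form \<mu> t \<equiv> m12 \<mu> * (cos t)\<^sup>2 + (m11 \<mu> - m22 \<mu>) * (sin t * cos t) - m21 \<mu> * (sin t)\<^sup>2"

text \<open>Because the determinant is one, the trace alone decides whether the form is definite or
  indefinite.\<close>

lemma form_discriminant: "(m11 \<mu> - m22 \<mu>)\<^sup>2 + 4 * m12 \<mu> * m21 \<mu> = (disc \<mu>)\<^sup>2 - 4"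
  using det[of \<mu>] by (simp add: disc_def power2_eq_square algebra_simps)

lemma monodromy_polar:
  "\<exists>R>0. m11 \<mu> * sin t + m12 \<mu> * cos t = R * sin (t + Rot \<mu> t) \<and> m21 \<mu> * sin t + m22 \<mu> * cos t = R * cos (t + Rot \<mu> t)"
proof -
  define \<theta> where "\<theta> = prufer (shifted \<mu>) t"
  have th: "\<theta> 0 = t" "pruf (shifted \<mu>) \<theta>" "\<theta> X = t + Rot \<mu> t"
    using prufer_sol[OF potV, of \<mu> t] by (simp_all add: \<theta>_def rot_def)
  obtain Q where Q: "\<And>x. \<bar>V x - \<mu>\<bar> \<le> Q" using pot_bound[OF potV] by blast
  obtain r where r: "\<forall>x. r x > 0" "iv (shifted \<mu>) (sin (\<theta> 0)) (cos (\<theta> 0)) = (\<lambda>x. r x * sin (\<theta> x))"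
      "ivd (shifted \<mu>) (sin (\<theta> 0)) (cos (\<theta> 0)) = (\<lambda>x. r x * cos (\<theta> x))"
    using iv_pruf[OF potV th(2) Q] by blast
  have "m11 \<mu> * sin t + m12 \<mu> * cos t = r X * sin (\<theta> X)" "m21 \<mu> * sin t + m22 \<mu> * cos t = r X * cos (\<theta> X)"
    using fun_cong[OF r(2), of X] fun_cong[OF r(3), of X] iv_linear[OF potV, of \<mu> "sin t" "cos t" X] th(1)
    by (simp_all add: m11_def m12_def m21_def m22_def)
  then show ?thesis using r(1) th(3) by metis
qed

text \<open>The sign of the form tells on which side of a multiple of \<pi> the rotation lies.
  Together with \<open>form_discriminant\<close> this translates between rotation and
  discriminant.\<close>

lemma form_rot:
  "\<exists>R>0. form \<mu> t = R * sin (Rot \<mu> t)"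
proof -
  obtain R where R: "R > 0" "m11 \<mu> * sin t + m12 \<mu> * cos t = R * sin (t + Rot \<mu> t)" "m21 \<mu> * sin t + m22 \<mu> * cos t = R * cos (t + Rot \<mu> t)"
    using monodromy_polar by blast
  have "form \<mu> t
     = (m11 \<mu> * sin t + m12 \<mu> * cos t) * cos t - (m21 \<mu> * sin t + m22 \<mu> * cos t) * sin t"
    by (simp add: power2_eq_square algebra_simps)
  also have "\<dots> = R * (sin (t + Rot \<mu> t) * cos t - cos (t + Rot \<mu> t) * sin t)"
    unfolding R(2,3) by (simp add: algebra_simps)
  also have "\<dots> = R * sin (t + Rot \<mu> t - t)" by (simp only: sin_diff)
  finally show ?thesis using R(1) by auto
qed

text \<open>A discriminant of modulus at least 2 would provide a real eigenvector, whose rotation is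
  a multiple of \<pi>.\<close>

lemma disc_band_interior:
  assumes "n * pi < Rmin \<mu>" "Rmax \<mu> < Suc n * pi" shows "(disc \<mu>)\<^sup>2 < 4"
proof (rule ccontr)
  assume "\<not> ?thesis"
  then have "(m11 \<mu> - m22 \<mu>)\<^sup>2 + 4 * m12 \<mu> * m21 \<mu> \<ge> 0" unfolding form_discriminant by simp
  from quadratic_form_zero[OF this] obtain t where
    t: "form \<mu> t = 0" by blast
  have "sin (Rot \<mu> t) = 0" using form_rot[of \<mu> t] t by auto
  moreover have "n * pi < Rot \<mu> t" "Rot \<mu> t < Suc n * pi"
    using rmax_attained(2,4)[OF potV X0, of \<mu> t] assms by linarith+
  then have "sin (Rot \<mu> t - n * pi) > 0" by (intro sin_gt_zero) (auto simp: algebra_simps)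
  ultimately show False using sin_shift_npi[of "Rot \<mu> t - n * pi" n] by simp
qed

lemma disc_band:
  assumes "n * pi \<le> Rmin \<mu>" "Rmax \<mu> \<le> Suc n * pi" shows "(disc \<mu>)\<^sup>2 \<le> 4"
proof (rule ccontr)
  assume "\<not> ?thesis"
  then have *: "(m11 \<mu> - m22 \<mu>)\<^sup>2 + 4 * m12 \<mu> * m21 \<mu> > 0" unfolding form_discriminant by simp
  have nn: "0 \<le> (-1) ^ n * (form \<mu> t)" for t
  proof -
    obtain R where R: "R > 0" "form \<mu> t = R * sin (Rot \<mu> t)"
      using form_rot by blast
    have "n * pi \<le> Rot \<mu> t" "Rot \<mu> t \<le> Suc n * pi"
      using rmax_attained(2,4)[OF potV X0, of \<mu> t] assms by linarith+
    then have "sin (Rot \<mu> t - n * pi) \<ge> 0" by (intro sin_ge_zero) (auto simp: algebra_simps)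
    moreover have "(-1) ^ n * sin (Rot \<mu> t) = sin (Rot \<mu> t - n * pi)"
      using sin_shift_npi[of "Rot \<mu> t - n * pi" n] by (simp flip: mult.assoc power_mult_distrib)
    ultimately show ?thesis using R by (simp add: zero_le_mult_iff mult.left_commute[of "(-1)^n"])
  qed
  obtain t u where "form \<mu> t > 0"
     "form \<mu> u < 0"
    using quadratic_form_indefinite[OF *] by blast
  with nn[of t] nn[of u] show False
    by (cases "even n") (auto simp: zero_le_mult_iff)
qed

text \<open>Initial angles rotating by more and by less than \<open>n * pi\<close> give the form
  both signs; the oscillation bound keeps both rotations within \<pi> of that level.\<close>

lemma disc_gap:
  fixes n :: nat
  assumes "Rmin \<mu> < n * pi" "n * pi < Rmax \<mu>" shows "(disc \<mu>)\<^sup>2 > 4"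
proof -
  have osc: "Rmax \<mu> < Rmin \<mu> + pi" by (rule rmax_rmin_osc[OF potV X0])
  obtain t u where t: "Rot \<mu> t = Rmax \<mu>" "Rot \<mu> u = Rmin \<mu>" using rmax_attained(1,3)[OF potV X0] by blast
  have "sin (Rot \<mu> t - n * pi) > 0" by (rule sin_gt_zero) (use t assms osc in auto)
  then have 1: "(-1) ^ n * sin (Rot \<mu> t) > 0"
    using sin_shift_npi[of "Rot \<mu> t - n * pi" n] by (simp flip: mult.assoc power_mult_distrib)
  have "sin (n * pi - Rot \<mu> u) > 0" by (rule sin_gt_zero) (use t assms osc in auto)
  then have "sin (Rot \<mu> u - n * pi) < 0" using sin_minus[of "Rot \<mu> u - n * pi"] by simp
  then have 2: "(-1) ^ n * sin (Rot \<mu> u) < 0"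
    using sin_shift_npi[of "Rot \<mu> u - n * pi" n] by (simp flip: mult.assoc power_mult_distrib)
  obtain R where R: "R > 0" "form \<mu> t = R * sin (Rot \<mu> t)"
    using form_rot by blast
  obtain R' where R': "R' > 0" "form \<mu> u = R' * sin (Rot \<mu> u)"
    using form_rot by blast
  have "(m11 \<mu> - m22 \<mu>)\<^sup>2 + 4 * m12 \<mu> * m21 \<mu> > 0"
  proof (cases "even n")
    case True
    then have "R * sin (Rot \<mu> t) > 0" "R' * sin (Rot \<mu> u) < 0" using 1 2 R(1) R'(1) by (auto simp: mult_pos_neg)
    then show ?thesis unfolding R(2)[symmetric] R'(2)[symmetric] by (rule quadratic_form_signs)
  next
    case False
    then have "R' * sin (Rot \<mu> u) > 0" "R * sin (Rot \<mu> t) < 0" using 1 2 R(1) R'(1) by (auto simp: mult_pos_neg)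
    then show ?thesis unfolding R(2)[symmetric] R'(2)[symmetric] by (rule quadratic_form_signs)
  qed
  then show ?thesis unfolding form_discriminant by simp
qed

text \<open>A rotation by \<open>n * pi\<close> means a real eigenvalue \<open>l\<close> with the
  sign of \<open>(-1) ^ n\<close>, and with determinant one the trace is
  \<open>l + 1 / l\<close>.\<close>

lemma disc_eigen:
  fixes n :: nat
  assumes "Rot \<mu> t = n * pi" shows "(-1) ^ n * disc \<mu> \<ge> 2"
proof -
  obtain R where R: "R > 0" "m11 \<mu> * sin t + m12 \<mu> * cos t = R * sin (t + Rot \<mu> t)" "m21 \<mu> * sin t + m22 \<mu> * cos t = R * cos (t + Rot \<mu> t)"
    using monodromy_polar by blast
  define l where "l = R * (-1) ^ n"
  have l2: "l\<^sup>2 = R\<^sup>2" by (simp add: l_def power_mult_distrib flip: power_mult)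
  have e: "(m11 \<mu> - l) * sin t + m12 \<mu> * cos t = 0" "m21 \<mu> * sin t + (m22 \<mu> - l) * cos t = 0"
    using R(2,3) unfolding assms sin_shift_npi cos_shift_npi by (simp_all add: l_def algebra_simps)
  have "((m11 \<mu> - l) * (m22 \<mu> - l) - m12 \<mu> * m21 \<mu>) * sin t
     = (m22 \<mu> - l) * ((m11 \<mu> - l) * sin t + m12 \<mu> * cos t) - m12 \<mu> * (m21 \<mu> * sin t + (m22 \<mu> - l) * cos t)"
    by (simp add: algebra_simps)
  moreover have "((m11 \<mu> - l) * (m22 \<mu> - l) - m12 \<mu> * m21 \<mu>) * cos t
     = (m11 \<mu> - l) * (m21 \<mu> * sin t + (m22 \<mu> - l) * cos t) - m21 \<mu> * ((m11 \<mu> - l) * sin t + m12 \<mu> * cos t)"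
    by (simp add: algebra_simps)
  moreover have "sin t \<noteq> 0 \<or> cos t \<noteq> 0" using sin_zero_norm_cos_one[of t] by auto
  ultimately have "(m11 \<mu> - l) * (m22 \<mu> - l) - m12 \<mu> * m21 \<mu> = 0" unfolding e by auto
  then have "l * disc \<mu> = 1 + l\<^sup>2" using det[of \<mu>] by (simp add: disc_def power2_eq_square algebra_simps)
  then have "R * ((-1) ^ n * disc \<mu>) = 1 + R\<^sup>2" by (simp add: l2) (simp add: l_def mult.assoc)
  moreover have "1 + R\<^sup>2 \<ge> R * 2" using zero_le_power2[of "R - 1"] by (simp add: power2_eq_square algebra_simps)
  ultimately show ?thesis using R(1) by (metis mult_le_cancel_left_pos)
qed

text \<open>\<open>disc_eigen\<close> bounds the modulus from below; \<open>disc_band\<close> bounds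
  it from above, since this gap edge also closes a band.\<close>

lemma disc_beta: "disc (beta X V n) = 2 * (-1) ^ n"
proof -
  obtain t where "Rot (beta X V n) t = n * pi" using rmax_attained(3)[OF potV[of "beta X V n"] X0] by (auto simp: rmin_beta)
  then have 1: "(-1) ^ n * disc (beta X V n) \<ge> 2" by (rule disc_eigen)
  have "Rmax (beta X V n) < Rmin (beta X V n) + pi" by (rule rmax_rmin_osc[OF potV X0])
  then have "(disc (beta X V n))\<^sup>2 \<le> 2\<^sup>2" using disc_band[of n "beta X V n"] by (simp add: rmin_beta algebra_simps)
  then have "\<bar>disc (beta X V n)\<bar> \<le> \<bar>2\<bar>" by (simp only: abs_le_square_iff)
  with 1 show ?thesis by (cases "even n") auto
qed

lemma disc_alpha: "n \<ge> 1 \<Longrightarrow> disc (alpha X V n) = 2 * (-1) ^ n"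
proof -
  assume n: "n \<ge> 1"
  obtain t where "Rot (alpha X V n) t = n * pi" using rmax_attained(1)[OF potV[of "alpha X V n"] X0] by (auto simp: rmax_alpha[OF n])
  then have 1: "(-1) ^ n * disc (alpha X V n) \<ge> 2" by (rule disc_eigen)
  obtain k where k: "n = Suc k" using n by (cases n) auto
  have "Rmax (alpha X V n) < Rmin (alpha X V n) + pi" by (rule rmax_rmin_osc[OF potV X0])
  then have "(disc (alpha X V n))\<^sup>2 \<le> 2\<^sup>2" using disc_band[of k "alpha X V n"] rmax_alpha[OF n] k by (simp add: algebra_simps)
  then have "\<bar>disc (alpha X V n)\<bar> \<le> \<bar>2\<bar>" by (simp only: abs_le_square_iff)
  with 1 show ?thesis by (cases "even n") auto
qed

section \<open>Dependence of the discriminant on the energy\<close>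

definition kern where
  "kern \<mu> \<nu> s = (m12 \<mu> * iv (shifted \<mu>) 1 0 s - m11 \<mu> * iv (shifted \<mu>) 0 1 s) * iv (shifted \<nu>) 1 0 s
     + (m22 \<mu> * iv (shifted \<mu>) 1 0 s - m21 \<mu> * iv (shifted \<mu>) 0 1 s) * iv (shifted \<nu>) 0 1 s"

lemma iv_continuous_on: "pot q \<Longrightarrow> continuous_on S (iv q a b)"
  using ivp_sol(1)[of q a b] unfolding sol_def by (blast intro: lprim_continuous_on)

lemma kern_continuous: "continuous_on S (kern \<mu> \<nu>)"
  unfolding kern_def by (intro continuous_intros iv_continuous_on potV)

text \<open>An exact identity for arbitrary \<mu> and \<nu>, obtained by variation of parameters. It
  exhibits the difference quotient as an integral that is continuous in \<nu>, so the derivative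
  follows by Caratheodory's criterion.\<close>

lemma disc_difference: "disc \<nu> - disc \<mu> = - integral {0..X} (kern \<mu> \<nu>) * (\<nu> - \<mu>)"
proof -
  let ?p = "\<lambda>x. V x - \<mu>" and ?q = "\<lambda>x. V x - \<nu>"
  obtain A B where AB: "lprim A (\<lambda>x. (?q x - ?p x) *\<^sub>R (of_real (iv ?p 1 0 x) * iv ?q 1 0 x))"
    "lprim B (\<lambda>x. (?q x - ?p x) *\<^sub>R (of_real (iv ?p 0 1 x) * iv ?q 1 0 x))" "A 0 = ivd ?q 1 0 0" "B 0 = - iv ?q 1 0 0"
    "\<And>x. iv ?q 1 0 x = of_real (iv ?p 0 1 x) * A x - of_real (iv ?p 1 0 x) * B x"
    "\<And>x. ivd ?q 1 0 x = of_real (ivd ?p 0 1 x) * A x - of_real (ivd ?p 1 0 x) * B x"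
    using sol_duhamel[OF potV[of \<mu>] ivp_sol(1)[OF potV[of \<nu>], of 1 0]] by blast
  obtain A' B' where AB': "lprim A' (\<lambda>x. (?q x - ?p x) *\<^sub>R (of_real (iv ?p 1 0 x) * iv ?q 0 1 x))"
    "lprim B' (\<lambda>x. (?q x - ?p x) *\<^sub>R (of_real (iv ?p 0 1 x) * iv ?q 0 1 x))" "A' 0 = ivd ?q 0 1 0" "B' 0 = - iv ?q 0 1 0"
    "\<And>x. iv ?q 0 1 x = of_real (iv ?p 0 1 x) * A' x - of_real (iv ?p 1 0 x) * B' x"
    "\<And>x. ivd ?q 0 1 x = of_real (ivd ?p 0 1 x) * A' x - of_real (ivd ?p 1 0 x) * B' x"
    using sol_duhamel[OF potV[of \<mu>] ivp_sol(1)[OF potV[of \<nu>], of 0 1]] by blast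
  \<comment> \<open>The four coefficient functions are combined so that \<open>G 0\<close> and
    \<open>G X\<close> are the discriminants at \<mu> and \<nu>.\<close>
  define G where "G = (\<lambda>x. m12 \<mu> * A x - m11 \<mu> * B x + (m22 \<mu> * A' x - m21 \<mu> * B' x))"
  have "lprim G (\<lambda>x. m12 \<mu> * ((?q x - ?p x) *\<^sub>R (of_real (iv ?p 1 0 x) * iv ?q 1 0 x))
      - m11 \<mu> * ((?q x - ?p x) *\<^sub>R (of_real (iv ?p 0 1 x) * iv ?q 1 0 x))
      + (m22 \<mu> * ((?q x - ?p x) *\<^sub>R (of_real (iv ?p 1 0 x) * iv ?q 0 1 x))
      - m21 \<mu> * ((?q x - ?p x) *\<^sub>R (of_real (iv ?p 0 1 x) * iv ?q 0 1 x))))"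
    unfolding G_def by (intro lprim_add lprim_diff lprim_cmult AB(1,2) AB'(1,2))
  moreover have "(\<lambda>x. m12 \<mu> * ((?q x - ?p x) *\<^sub>R (of_real (iv ?p 1 0 x) * iv ?q 1 0 x))
      - m11 \<mu> * ((?q x - ?p x) *\<^sub>R (of_real (iv ?p 0 1 x) * iv ?q 1 0 x))
      + (m22 \<mu> * ((?q x - ?p x) *\<^sub>R (of_real (iv ?p 1 0 x) * iv ?q 0 1 x))
      - m21 \<mu> * ((?q x - ?p x) *\<^sub>R (of_real (iv ?p 0 1 x) * iv ?q 0 1 x)))) = (\<lambda>x. (\<mu> - \<nu>) * kern \<mu> \<nu> x)"
    by (rule ext) (simp add: kern_def algebra_simps)
  ultimately have "lprim G (\<lambda>x. (\<mu> - \<nu>) * kern \<mu> \<nu> x)" by simp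
  then have "((\<lambda>x. (\<mu> - \<nu>) * kern \<mu> \<nu> x) has_integral (G X - G 0)) {0..X}" by (rule lprim_integral[OF _ X0])
  then have "G X - G 0 = integral {0..X} (\<lambda>x. (\<mu> - \<nu>) * kern \<mu> \<nu> x)" by (rule integral_unique[symmetric])
  also have "\<dots> = (\<mu> - \<nu>) * integral {0..X} (kern \<mu> \<nu>)" by simp
  finally have "G X - G 0 = (\<mu> - \<nu>) * integral {0..X} (kern \<mu> \<nu>)" .
  moreover have "G X = disc \<nu>" using AB(5)[of X] AB'(6)[of X]
    by (simp add: G_def disc_def m11_def m12_def m21_def m22_def)
  moreover have "G 0 = disc \<mu>" using AB(3,4) AB'(3,4) ivp_sol(2,3)[OF potV] by (simp add: G_def disc_def)
  ultimately show ?thesis by (simp add: algebra_simps)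
qed

lemma disc_has_derivative: "(disc has_real_derivative - integral {0..X} (kern \<mu> \<mu>)) (at \<mu>)"
proof -
  obtain Q0 where Q0: "\<And>x. \<bar>V x\<bar> \<le> Q0" using pot_bound[OF V] by blast
  \<comment> \<open>The extra 1 makes this a common bound for all energies within distance 1 of
    \<mu>.\<close>
  define Q where "Q = Q0 + \<bar>\<mu>\<bar> + 1"
  have Q: "\<bar>V x - \<nu>\<bar> \<le> Q" if "\<bar>\<mu> - \<nu>\<bar> < 1" for \<nu> x using Q0[of x] that unfolding Q_def by linarith
  define L where "L = 2 * exp ((1 + Q) * X) ^ 3 * X"
  have cK1: "continuous_on UNIV (\<lambda>s. m12 \<mu> * iv (shifted \<mu>) 1 0 s - m11 \<mu> * iv (shifted \<mu>) 0 1 s)" by (intro continuous_intros iv_continuous_on potV)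
  obtain K1 where K1: "K1 \<ge> 0" "\<And>s. s \<in> {0..X} \<Longrightarrow> norm (m12 \<mu> * iv (shifted \<mu>) 1 0 s - m11 \<mu> * iv (shifted \<mu>) 0 1 s) \<le> K1"
    using locally_bounded_nonneg[OF bounded_on_continuous[OF cK1], of 0 X] by blast
  have cK2: "continuous_on UNIV (\<lambda>s. m22 \<mu> * iv (shifted \<mu>) 1 0 s - m21 \<mu> * iv (shifted \<mu>) 0 1 s)" by (intro continuous_intros iv_continuous_on potV)
  obtain K2 where K2: "K2 \<ge> 0" "\<And>s. s \<in> {0..X} \<Longrightarrow> norm (m22 \<mu> * iv (shifted \<mu>) 1 0 s - m21 \<mu> * iv (shifted \<mu>) 0 1 s) \<le> K2"
    using locally_bounded_nonneg[OF bounded_on_continuous[OF cK2], of 0 X] by blast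
  have main: "\<bar>integral {0..X} (kern \<mu> \<nu>) - integral {0..X} (kern \<mu> \<mu>)\<bar> \<le> (K1 + K2) * L * X * \<bar>\<nu> - \<mu>\<bar>" if "\<bar>\<mu> - \<nu>\<bar> < 1" for \<nu>
  proof -
    have "((\<lambda>s. kern \<mu> \<nu> s - kern \<mu> \<mu> s) has_integral (integral {0..X} (kern \<mu> \<nu>) - integral {0..X} (kern \<mu> \<mu>))) {0..X}"
      by (intro has_integral_diff integrable_integral integrable_continuous_real kern_continuous)
    moreover have "norm (kern \<mu> \<nu> s - kern \<mu> \<mu> s) \<le> (K1 + K2) * L * \<bar>\<nu> - \<mu>\<bar>" if s: "s \<in> {0..X}" for s
    proof -
      have l: "\<bar>iv (shifted \<nu>) a b s - iv (shifted \<mu>) a b s\<bar> \<le> L * \<bar>\<nu> - \<mu>\<bar>" if "a\<^sup>2 + b\<^sup>2 = 1" for a b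
        using iv_lipschitz(1)[OF potV[of \<mu>] potV[of \<nu>] Q Q, of "\<bar>\<nu> - \<mu>\<bar>" s X a b] s \<open>\<bar>\<mu> - \<nu>\<bar> < 1\<close> that
        by (simp add: L_def abs_minus_commute)
      have "kern \<mu> \<nu> s - kern \<mu> \<mu> s = (m12 \<mu> * iv (shifted \<mu>) 1 0 s - m11 \<mu> * iv (shifted \<mu>) 0 1 s) * (iv (shifted \<nu>) 1 0 s - iv (shifted \<mu>) 1 0 s)
        + (m22 \<mu> * iv (shifted \<mu>) 1 0 s - m21 \<mu> * iv (shifted \<mu>) 0 1 s) * (iv (shifted \<nu>) 0 1 s - iv (shifted \<mu>) 0 1 s)"
        unfolding kern_def by (simp add: algebra_simps)
      also have "\<bar>\<dots>\<bar> \<le> K1 * (L * \<bar>\<nu> - \<mu>\<bar>) + K2 * (L * \<bar>\<nu> - \<mu>\<bar>)"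
        by (rule order_trans[OF abs_triangle_ineq add_mono]; unfold abs_mult; intro mult_mono l)
           (use K1 K2 s in auto)
      finally show ?thesis by (simp add: algebra_simps)
    qed
    ultimately have "\<bar>integral {0..X} (kern \<mu> \<nu>) - integral {0..X} (kern \<mu> \<mu>)\<bar> \<le> (K1 + K2) * L * \<bar>\<nu> - \<mu>\<bar> * (X - 0)"
      using has_integral_interval_bound[of _ "integral {0..X} (kern \<mu> \<nu>) - integral {0..X} (kern \<mu> \<mu>)" 0 X "(K1 + K2) * L * \<bar>\<nu> - \<mu>\<bar>"] X K1 K2
      by (simp add: L_def)
    then show ?thesis by (simp add: mult_ac)
  qed
  have "((\<lambda>\<nu>. integral {0..X} (kern \<mu> \<nu>) - integral {0..X} (kern \<mu> \<mu>)) \<longlongrightarrow> 0) (at \<mu>)"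
  proof (rule Lim_null_comparison)
    have "eventually (\<lambda>\<nu>. \<nu> \<in> {\<mu>-1<..<\<mu>+1}) (at \<mu>)" by (rule eventually_at_in_open') auto
    then show "eventually (\<lambda>\<nu>. norm (integral {0..X} (kern \<mu> \<nu>) - integral {0..X} (kern \<mu> \<mu>)) \<le> (K1 + K2) * L * X * \<bar>\<nu> - \<mu>\<bar>) (at \<mu>)"
      by eventually_elim (use main in \<open>auto simp: abs_less_iff\<close>)
    have "((\<lambda>\<nu>. (K1 + K2) * L * X * \<bar>\<nu> - \<mu>\<bar>) \<longlongrightarrow> (K1 + K2) * L * X * \<bar>\<mu> - \<mu>\<bar>) (at \<mu>)" by (intro tendsto_intros)
    then show "((\<lambda>\<nu>. (K1 + K2) * L * X * \<bar>\<nu> - \<mu>\<bar>) \<longlongrightarrow> 0) (at \<mu>)" by simp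
  qed
  then have "isCont (\<lambda>\<nu>. integral {0..X} (kern \<mu> \<nu>)) \<mu>" unfolding isCont_def by (rule LIM_zero_cancel)
  then have "isCont (\<lambda>\<nu>. - integral {0..X} (kern \<mu> \<nu>)) \<mu>" by (intro continuous_intros)
  then show ?thesis unfolding CARAT_DERIV
    using disc_difference[of _ \<mu>] by (intro exI[of _ "\<lambda>\<nu>. - integral {0..X} (kern \<mu> \<nu>)"]) auto
qed

text \<open>On the diagonal \<open>kern\<close> is a quadratic form in the two fundamental
  solutions, again with discriminant \<open>(disc \<mu>)\<^sup>2 - 4\<close>; inside a band it is
  definite and its integral cannot vanish.\<close>

lemma disc_derivative_nonzero:
  assumes "(disc \<mu>)\<^sup>2 < 4" shows "integral {0..X} (kern \<mu> \<mu>) \<noteq> 0"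
proof -
  let ?f = "iv (shifted \<mu>) 1 0" and ?g = "iv (shifted \<mu>) 0 1"
  have d: "(m22 \<mu> - m11 \<mu>)\<^sup>2 + 4 * m12 \<mu> * m21 \<mu> < 0"
    using form_discriminant[of \<mu>] assms by (simp add: power2_commute)
  have k: "kern \<mu> \<mu> s = m12 \<mu> * (?f s)\<^sup>2 + (m22 \<mu> - m11 \<mu>) * (?g s * ?f s) - m21 \<mu> * (?g s)\<^sup>2" for s
    by (simp add: kern_def power2_eq_square algebra_simps)
  have nz: "?g s \<noteq> 0 \<or> ?f s \<noteq> 0" for s
    using wronskian_one[OF potV, of \<mu> s] by (metis diff_self mult_zero_left mult_zero_right zero_neq_one)
  have pos: "0 < m12 \<mu> * kern \<mu> \<mu> s" for s
    unfolding k by (rule quadratic_form_definite(2)[OF less_imp_le[OF d] d nz])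
  have "integral {0..X} (\<lambda>s. m12 \<mu> * kern \<mu> \<mu> s) \<noteq> 0"
  proof
    assume "integral {0..X} (\<lambda>s. m12 \<mu> * kern \<mu> \<mu> s) = 0"
    moreover have "continuous_on {0..X} (\<lambda>s. m12 \<mu> * kern \<mu> \<mu> s)" by (intro continuous_intros kern_continuous)
    ultimately have "m12 \<mu> * kern \<mu> \<mu> 0 = 0"
      using integral_eq_0_iff[of 0 X "\<lambda>s. m12 \<mu> * kern \<mu> \<mu> s"] X pos by (auto simp: less_imp_le)
    with pos[of 0] show False by simp
  qed
  then show ?thesis by auto
qed

lemma disc_isCont: "isCont disc \<mu>"
  using disc_has_derivative by (rule DERIV_isCont)

lemma band_bounds:
  assumes "beta X V n < \<mu>" "\<mu> < alpha X V (Suc n)" shows "(disc \<mu>)\<^sup>2 < 4"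
  by (rule disc_band_interior[of n]) (use assms le_beta_iff[of \<mu> n] alpha_le_iff[of "Suc n" \<mu>] in auto)

text \<open>Two equal values would force a critical point of \<open>disc\<close> in the interior of
  the band.\<close>

lemma band_unique:
  assumes "\<mu> \<in> {beta X V n..alpha X V (Suc n)}" "\<nu> \<in> {beta X V n..alpha X V (Suc n)}" "disc \<mu> = disc \<nu>"
  shows "\<mu> = \<nu>"
proof -
  have *: False if "\<mu> < \<nu>" "\<mu> \<in> {beta X V n..alpha X V (Suc n)}" "\<nu> \<in> {beta X V n..alpha X V (Suc n)}" "disc \<mu> = disc \<nu>" for \<mu> \<nu>
  proof -
    have "\<exists>z. \<mu> < z \<and> z < \<nu> \<and> (disc has_real_derivative 0) (at z)"
      by (rule Rolle) (use that disc_isCont disc_has_derivative in \<open>auto intro: continuous_at_imp_continuous_on simp: real_differentiable_def\<close>)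
    then obtain z where z: "\<mu> < z" "z < \<nu>" "(disc has_real_derivative 0) (at z)" by blast
    have "integral {0..X} (kern z z) = 0" using DERIV_unique[OF z(3) disc_has_derivative] by simp
    moreover have "(disc z)\<^sup>2 < 4" using band_bounds[of n z] z that by auto
    ultimately show False using disc_derivative_nonzero by blast
  qed
  show ?thesis using *[of \<mu> \<nu>] *[of \<nu> \<mu>] assms by (cases \<mu> \<nu> rule: linorder_cases) auto
qed

text \<open>The values at the two ends of the band are 2 and -2, in an order given by the parity of
  \<open>n\<close>.\<close>

lemma band_exists:
  assumes "\<bar>c\<bar> \<le> 2" shows "\<exists>\<mu>\<in>{beta X V n..alpha X V (Suc n)}. disc \<mu> = c"
proof (cases "even n")
  case True
  then have "\<exists>\<mu>\<ge>beta X V n. \<mu> \<le> alpha X V (Suc n) \<and> disc \<mu> = c"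
    by (intro IVT2) (use assms disc_isCont disc_beta[of n] disc_alpha[of "Suc n"] beta_less_alpha[of n] in auto)
  then show ?thesis by auto
next
  case False
  then have "\<exists>\<mu>\<ge>beta X V n. \<mu> \<le> alpha X V (Suc n) \<and> disc \<mu> = c"
    by (intro IVT) (use assms disc_isCont disc_beta[of n] disc_alpha[of "Suc n"] beta_less_alpha[of n] in auto)
  then show ?thesis by auto
qed

end

section \<open>Bloch eigenspaces\<close>

lemma lprim_shift: "lprim F f \<Longrightarrow> lprim (\<lambda>x. F (x + c)) (\<lambda>x. f (x + c))"
proof -
  assume F: "lprim F f"
  have "(\<lambda>x. f (x + c)) \<in> borel_measurable borel"
    using lprim_measurable[OF F] by (rule measurable_compose[rotated]) simp
  moreover have "\<exists>K. \<forall>x\<in>{a..b}. norm (f (x + c)) \<le> K" for a b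
  proof -
    obtain K where "\<And>x. x \<in> {a + c..b + c} \<Longrightarrow> norm (f x) \<le> K" using lprim_bounded[OF F] by blast
    then show ?thesis by (intro exI[of _ K]) auto
  qed
  moreover have "((\<lambda>x. f (x + c)) has_integral F (b + c) - F (a + c)) {a..b}" if "a \<le> b" for a b
    using lprim_integral[OF F, of "a + c" "b + c"] that
    by (simp add: has_integral_shift_Icc_real[of f c, symmetric] o_def add.commute)
  ultimately show ?thesis unfolding lprim_def by blast
qed

lemma sol_shift: "sol q y y' \<Longrightarrow> (\<And>x. q (x + c) = q x) \<Longrightarrow> sol q (\<lambda>x. y (x + c)) (\<lambda>x. y' (x + c))"
  unfolding sol_def using lprim_shift[of y y' c] lprim_shift[of y' "\<lambda>x. q x *\<^sub>R y x" c] by simp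

lemma sol_derivative_unique:
  fixes y :: "real \<Rightarrow> 'a::euclidean_space"
  assumes "sol q y y'" "sol q y z'" shows "y' = z'"
proof
  fix x
  have "(y has_vector_derivative y' x) (at x)" "(y has_vector_derivative z' x) (at x)"
    using assms unfolding sol_def by (blast intro: lprim_has_vector_derivative lprim_continuous_on)+
  then show "y' x = z' x" by (rule vector_derivative_unique_at)
qed

lemma indefinite_integral_continuous_on:
  fixes F :: "real \<Rightarrow> 'a::euclidean_space"
  assumes "\<And>a b. a \<le> b \<Longrightarrow> (f has_integral (F b - F a)) {a..b}"
  shows "continuous_on UNIV F"
proof -
  have "isCont F x" for x
  proof -
    have "f integrable_on {x-1..x+1}" using assms[of "x-1" "x+1"] by (auto simp: integrable_on_def)
    then have "continuous_on {x-1..x+1} (\<lambda>u. F (x-1) + integral {x-1..u} f)"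
      by (intro continuous_intros indefinite_integral_continuous_1)
    moreover have "F (x-1) + integral {x-1..u} f = F u" if "u \<in> {x-1..x+1}" for u
      using integral_unique[OF assms[of "x-1" u]] that by simp
    ultimately have "continuous_on {x-1..x+1} F" by (rule continuous_on_eq)
    then show ?thesis by (rule continuous_on_interior) auto
  qed
  then show ?thesis by (simp add: continuous_at_imp_continuous_on)
qed

lemma lprim_imp_H1_deriv:
  assumes "lprim u g" shows "H1_deriv u g"
proof -
  have m: "g \<in> borel_measurable borel" by (rule lprim_measurable[OF assms])
  have "set_integrable lebesgue {a..b} (\<lambda>x. (cmod (g x))\<^sup>2)" for a b
  proof -
    obtain K where K: "\<And>x. x \<in> {a..b} \<Longrightarrow> norm (g x) \<le> K" using lprim_bounded[OF assms] by blast
    have "set_integrable lborel {a..b} (\<lambda>x. (cmod (g x))\<^sup>2)"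
      by (rule borel_bounded_integrable_on(2)[where K="K\<^sup>2"]) (use m K in \<open>auto intro: power_mono\<close>)
    then show ?thesis unfolding set_integrable_def by (rule integrable_completion[THEN iffD2, rotated]) (use m in measurable)
  qed
  moreover have "g \<in> borel_measurable lebesgue" using m by (simp add: measurable_completion)
  ultimately show ?thesis using lprim_integral[OF assms] unfolding H1_deriv_def by blast
qed

lemma lprim_cis: "lprim (\<lambda>x. cis (k * x)) (\<lambda>x. \<i> * of_real k * cis (k * x))"
proof (rule lprim_of_C1)
  fix x
  have "((\<lambda>z. exp (\<i> * of_real k * z)) has_field_derivative exp (\<i> * of_real k * of_real x) * (\<i> * of_real k)) (at (of_real x))"
    by (auto intro!: derivative_eq_intros)
  from has_vector_derivative_real_field[OF this]
  show "((\<lambda>x. cis (k * x)) has_vector_derivative \<i> * of_real k * cis (k * x)) (at x)"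
    by (simp add: cis_conv_exp mult_ac)
qed (intro continuous_intros)

text \<open>\<open>V\<close> is a Borel representative with exact periodicity; the given potential
  enters below as a separate \<open>W\<close> that agrees with it almost everywhere.\<close>

locale hill_periodic = hill +
  assumes periodic: "\<And>x. V (x + X) = V x"
begin

text \<open>Multiplication by \<open>cis (k * x)\<close> turns \<partial> + ik into plain
  differentiation and moves \<open>k\<close> into the boundary condition.\<close>

lemma eigenspace_iff:
  assumes W: "AE x in lborel. W x = V x"
  shows "u \<in> bloch_eigenspace X W k \<mu> \<longleftrightarrow>
    (\<forall>x. u (x + X) = u x) \<and> (\<exists>\<psi>'. sol (shifted \<mu>) (\<lambda>x. cis (k * x) * u x) \<psi>')"
proof
  assume "u \<in> bloch_eigenspace X W k \<mu>"
  then obtain u1 u2 where per: "\<forall>x. u (x + X) = u x" and b: "bloch_deriv k u u1" "bloch_deriv k u1 u2"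
    and ae: "AE x in lebesgue. - u2 x + of_real (W x) * u x = of_real \<mu> * u x"
    unfolding bloch_eigenspace_def bloch_operator_def by auto
  obtain g where g: "H1_deriv u g" "u1 = (\<lambda>x. g x + \<i> * of_real k * u x)" using b(1) unfolding bloch_deriv_def by blast
  obtain g' where g': "H1_deriv u1 g'" "u2 = (\<lambda>x. g' x + \<i> * of_real k * u1 x)" using b(2) unfolding bloch_deriv_def by blast
  have cu: "continuous_on UNIV u" by (rule indefinite_integral_continuous_on[of g]) (use g(1) in \<open>auto simp: H1_deriv_def\<close>)
  have cu1: "continuous_on UNIV u1" by (rule indefinite_integral_continuous_on[of g']) (use g'(1) in \<open>auto simp: H1_deriv_def\<close>)
  \<comment> \<open>Both \<open>u\<close> and \<open>u1\<close> are indefinite integrals, hence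
    continuous, so the weak derivative of \<open>u\<close> is continuous.\<close>
  have "g = (\<lambda>x. u1 x - \<i> * of_real k * u x)" by (simp add: g(2))
  then have cg: "continuous_on UNIV g" using cu cu1 by (auto intro!: continuous_intros)
  have lu: "lprim u g"
    using g(1) borel_measurable_continuous_onI[OF cg] bounded_on_continuous[OF cg] unfolding lprim_def H1_deriv_def by blast
  \<comment> \<open>The eigenvalue equation solved for \<open>g'\<close>: an everywhere defined,
    locally bounded version, whereas \<open>g'\<close> itself is controlled only up to a null
    set.\<close>
  define G where "G = (\<lambda>x. (V x - \<mu>) *\<^sub>R u x - \<i> * of_real k * u1 x)"
  have [measurable]: "V \<in> borel_measurable borel" "u \<in> borel_measurable borel" "u1 \<in> borel_measurable borel"
    using V cu cu1 by (auto simp: pot_def intro: borel_measurable_continuous_onI)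
  have Gm: "G \<in> borel_measurable borel" unfolding G_def by measurable
  have Gb: "loc_bounded G"
  proof -
    have "loc_bounded (\<lambda>x. of_real (V x - \<mu>) * u x + - (\<i> * of_real k * u1 x))"
    proof (intro locally_bounded_add locally_bounded_mult)
      show "loc_bounded (\<lambda>x. of_real (V x - \<mu>) :: complex)"
        using pot_locally_bounded[OF potV[of \<mu>]] by (simp add: norm_of_real del: of_real_diff)
    qed (intro bounded_on_continuous continuous_intros cu cu1)+
    then show ?thesis by (simp add: G_def scaleR_conv_of_real)
  qed
  have "AE x in lborel. - u2 x + of_real (W x) * u x = of_real \<mu> * u x" using ae by (simp add: AE_completion_iff)
  with W have aeG: "AE x in lborel. g' x = G x"
  proof eventually_elim
    case (elim x)
    then show ?case by (simp add: g'(2) G_def scaleR_conv_of_real algebra_simps)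
  qed
  have lu1: "lprim u1 G"
  proof -
    have "(G has_integral (u1 b - u1 a)) {a..b}" if "a \<le> b" for a b
    proof -
      have "AE x in lborel. x \<in> {a..b} \<longrightarrow> g' x = G x" using aeG by eventually_elim simp
      moreover have "(g' has_integral (u1 b - u1 a)) {a..b}" using g'(1) that by (simp add: H1_deriv_def)
      ultimately show ?thesis using has_integral_AE by blast
    qed
    then show ?thesis using Gm Gb unfolding lprim_def by blast
  qed
  have "sol (shifted \<mu>) (\<lambda>x. cis (k * x) * u x) (\<lambda>x. cis (k * x) * u1 x)"
    unfolding sol_def
  proof
    show "lprim (\<lambda>x. cis (k * x) * u x) (\<lambda>x. cis (k * x) * u1 x)"
      by (rule back_subst[of "lprim _", OF lprim_mult[OF lprim_cis lu]]) (simp add: g(2) fun_eq_iff algebra_simps)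
    show "lprim (\<lambda>x. cis (k * x) * u1 x) (\<lambda>x. (V x - \<mu>) *\<^sub>R (cis (k * x) * u x))"
      by (rule back_subst[of "lprim _", OF lprim_mult[OF lprim_cis lu1]]) (simp add: G_def fun_eq_iff algebra_simps)
  qed
  with per show "(\<forall>x. u (x + X) = u x) \<and> (\<exists>\<psi>'. sol (shifted \<mu>) (\<lambda>x. cis (k * x) * u x) \<psi>')" by blast
next
  assume "(\<forall>x. u (x + X) = u x) \<and> (\<exists>\<psi>'. sol (shifted \<mu>) (\<lambda>x. cis (k * x) * u x) \<psi>')"
  then obtain \<psi>' where per: "\<forall>x. u (x + X) = u x" and s: "sol (shifted \<mu>) (\<lambda>x. cis (k * x) * u x) \<psi>'" by blast
  have c: "cis (- k * x) * (cis (k * x) * z) = z" for x z by (simp add: cis_mult flip: mult.assoc)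
  define u1 where "u1 = (\<lambda>x. cis (- k * x) * \<psi>' x)"
  have lu: "lprim u (\<lambda>x. u1 x - \<i> * of_real k * u x)"
  proof -
    have "lprim (\<lambda>x. cis (- k * x) * (cis (k * x) * u x)) (\<lambda>x. \<i> * of_real (- k) * cis (- k * x) * (cis (k * x) * u x) + cis (- k * x) * \<psi>' x)"
      using s unfolding sol_def by (intro lprim_mult lprim_cis) auto
    moreover have "(\<lambda>x. \<i> * of_real (- k) * cis (- k * x) * (cis (k * x) * u x) + cis (- k * x) * \<psi>' x) = (\<lambda>x. u1 x - \<i> * of_real k * u x)"
      unfolding mult.assoc c by (simp add: u1_def fun_eq_iff)
    ultimately show ?thesis unfolding c by (simp only:)
  qed
  have lu1: "lprim u1 (\<lambda>x. (V x - \<mu>) *\<^sub>R u x - \<i> * of_real k * u1 x)"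
  proof -
    have "lprim (\<lambda>x. cis (- k * x) * \<psi>' x) (\<lambda>x. \<i> * of_real (- k) * cis (- k * x) * \<psi>' x + cis (- k * x) * ((V x - \<mu>) *\<^sub>R (cis (k * x) * u x)))"
      using s unfolding sol_def by (intro lprim_mult lprim_cis) auto
    moreover have "(\<lambda>x. \<i> * of_real (- k) * cis (- k * x) * \<psi>' x + cis (- k * x) * ((V x - \<mu>) *\<^sub>R (cis (k * x) * u x))) = (\<lambda>x. (V x - \<mu>) *\<^sub>R u x - \<i> * of_real k * u1 x)"
      unfolding mult_scaleR_right mult.assoc c by (simp add: u1_def fun_eq_iff)
    ultimately show ?thesis unfolding u1_def by (simp only:)
  qed
  define u2 where "u2 = (\<lambda>x. (V x - \<mu>) *\<^sub>R u x)"
  have "bloch_deriv k u u1" unfolding bloch_deriv_def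
    by (intro exI[of _ "\<lambda>x. u1 x - \<i> * of_real k * u x"] conjI lprim_imp_H1_deriv lu) auto
  moreover have "bloch_deriv k u1 u2" unfolding bloch_deriv_def
    by (intro exI[of _ "\<lambda>x. (V x - \<mu>) *\<^sub>R u x - \<i> * of_real k * u1 x"] conjI lprim_imp_H1_deriv lu1) (auto simp: u2_def)
  ultimately have "bloch_operator X W k u (\<lambda>x. - u2 x + of_real (W x) * u x)"
    unfolding bloch_operator_def using per by blast
  moreover have "AE x in lborel. - u2 x + of_real (W x) * u x = of_real \<mu> * u x"
    using W by eventually_elim (simp add: u2_def scaleR_conv_of_real algebra_simps)
  then have "AE x in lebesgue. - u2 x + of_real (W x) * u x = of_real \<mu> * u x" by (simp add: AE_completion_iff)
  ultimately show "u \<in> bloch_eigenspace X W k \<mu>" unfolding bloch_eigenspace_def by blast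
qed

text \<open>The parameters are the initial data of \<open>cis (k * x) * u x\<close>. The map is
  linear and injective in \<open>(a, b)\<close>, so dimensions can be counted among pairs of complex
  numbers.\<close>

definition bvec where
  "bvec k \<mu> a b = (\<lambda>x. cis (- k * x) * (of_real (iv (shifted \<mu>) 1 0 x) * a + of_real (iv (shifted \<mu>) 0 1 x) * b))"

lemma fundamental_sol:
  "sol (shifted \<mu>) (\<lambda>x. of_real (iv (shifted \<mu>) 1 0 x) * a + of_real (iv (shifted \<mu>) 0 1 x) * b)
     (\<lambda>x. of_real (ivd (shifted \<mu>) 1 0 x) * a + of_real (ivd (shifted \<mu>) 0 1 x) * (b :: complex))"
proof -
  have "sol (shifted \<mu>) (\<lambda>x. of_real (iv (shifted \<mu>) p r x) * c) (\<lambda>x. of_real (ivd (shifted \<mu>) p r x) * (c :: complex))" for p r c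
    by (rule sol_bounded_linear[OF sol_bounded_linear[OF ivp_sol(1)[OF potV] bounded_linear_of_real] bounded_linear_mult_left])
  then show ?thesis by (intro sol_add)
qed

lemma cis_cancel: "cis (k * x) * (cis (- k * x) * z) = z"
  by (simp add: cis_mult flip: mult.assoc)

text \<open>Floquet condition: \<open>u\<close> is periodic exactly when its initial data form an
  eigenvector of the monodromy with multiplier \<open>cis (k * X)\<close>.\<close>

lemma eigenspace_eq:
  assumes W: "AE x in lborel. W x = V x"
  shows "bloch_eigenspace X W k \<mu> = {bvec k \<mu> a b | a b. of_real (m11 \<mu>) * a + of_real (m12 \<mu>) * b = cis (k * X) * a
     \<and> of_real (m21 \<mu>) * a + of_real (m22 \<mu>) * b = cis (k * X) * b}"
proof (intro set_eqI iffI)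
  fix u assume "u \<in> bloch_eigenspace X W k \<mu>"
  then obtain \<psi>' where per: "\<And>x. u (x + X) = u x" and s: "sol (shifted \<mu>) (\<lambda>x. cis (k * x) * u x) \<psi>'"
    unfolding eigenspace_iff[OF W] by blast
  define a b where "a = u 0" and "b = \<psi>' 0"
  have f: "cis (k * x) * u x = of_real (iv (shifted \<mu>) 1 0 x) * a + of_real (iv (shifted \<mu>) 0 1 x) * b"
      "\<psi>' x = of_real (ivd (shifted \<mu>) 1 0 x) * a + of_real (ivd (shifted \<mu>) 0 1 x) * b" for x
    using sol_fundamental[OF potV s, of x] by (simp_all add: a_def b_def)
  have "u = bvec k \<mu> a b"
  proof
    fix x
    have "u x = cis (- k * x) * (cis (k * x) * u x)" by (simp add: cis_mult flip: mult.assoc)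
    then show "u x = bvec k \<mu> a b x" unfolding f bvec_def .
  qed
  moreover have "of_real (m11 \<mu>) * a + of_real (m12 \<mu>) * b = cis (k * X) * a"
    using f(1)[of X] per[of 0] by (simp add: m11_def m12_def a_def)
  moreover have "of_real (m21 \<mu>) * a + of_real (m22 \<mu>) * b = cis (k * X) * b"
  proof -
    \<comment> \<open>Periodicity is given for \<open>u\<close> only; uniqueness of the derivative
      carries the multiplier over to \<open>\<psi>'\<close>.\<close>
    have "sol (shifted \<mu>) (\<lambda>x. cis (k * (x + X)) * u (x + X)) (\<lambda>x. \<psi>' (x + X))"
      by (rule sol_shift[OF s]) (simp add: periodic)
    moreover have "(\<lambda>x. cis (k * (x + X)) * u (x + X)) = (\<lambda>x. cis (k * X) * (cis (k * x) * u x))"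
      by (simp add: per distrib_left cis_mult fun_eq_iff add.commute flip: mult.assoc)
    ultimately have "(\<lambda>x. \<psi>' (x + X)) = (\<lambda>x. cis (k * X) * \<psi>' x)"
      using sol_derivative_unique sol_cmult[OF s] by metis
    from fun_cong[OF this, of 0] show ?thesis using f(2)[of X] by (simp add: m21_def m22_def b_def)
  qed
  ultimately show "u \<in> {bvec k \<mu> a b | a b. of_real (m11 \<mu>) * a + of_real (m12 \<mu>) * b = cis (k * X) * a
     \<and> of_real (m21 \<mu>) * a + of_real (m22 \<mu>) * b = cis (k * X) * b}" by blast
next
  fix u assume "u \<in> {bvec k \<mu> a b | a b. of_real (m11 \<mu>) * a + of_real (m12 \<mu>) * b = cis (k * X) * a
     \<and> of_real (m21 \<mu>) * a + of_real (m22 \<mu>) * b = cis (k * X) * b}"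
  then obtain a b where u: "u = bvec k \<mu> a b" and e: "of_real (m11 \<mu>) * a + of_real (m12 \<mu>) * b = cis (k * X) * a"
     "of_real (m21 \<mu>) * a + of_real (m22 \<mu>) * b = cis (k * X) * b" by blast
  let ?f = "\<lambda>x. of_real (iv (shifted \<mu>) 1 0 x) * a + of_real (iv (shifted \<mu>) 0 1 x) * b"
  let ?f' = "\<lambda>x. of_real (ivd (shifted \<mu>) 1 0 x) * a + of_real (ivd (shifted \<mu>) 0 1 x) * b"
  have uf: "(\<lambda>x. cis (k * x) * u x) = ?f" unfolding u bvec_def cis_cancel ..
  have "(\<lambda>x. ?f (x + X)) = (\<lambda>x. cis (k * X) * ?f x)"
  proof (rule sol_unique(1)[OF potV])
    show "sol (shifted \<mu>) (\<lambda>x. ?f (x + X)) (\<lambda>x. ?f' (x + X))"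
      by (rule sol_shift[OF fundamental_sol]) (simp add: periodic)
    show "sol (shifted \<mu>) (\<lambda>x. cis (k * X) * ?f x) (\<lambda>x. cis (k * X) * ?f' x)"
      by (rule sol_cmult[OF fundamental_sol])
  qed (use e in \<open>simp_all add: ivp_sol[OF potV] flip: m11_def m12_def m21_def m22_def\<close>)
  then have sh: "?f (x + X) = cis (k * X) * ?f x" for x by metis
  have "u (x + X) = u x" for x
  proof -
    have "u (x + X) = cis (- k * (x + X)) * ?f (x + X)" unfolding u bvec_def ..
    also have "\<dots> = cis (- k * (x + X)) * cis (k * X) * ?f x" unfolding sh by simp
    also have "cis (- k * (x + X)) * cis (k * X) = cis (- k * x)" by (simp add: cis_mult algebra_simps)
    finally show ?thesis unfolding u bvec_def .
  qed
  moreover have "sol (shifted \<mu>) (\<lambda>x. cis (k * x) * u x) ?f'" unfolding uf by (rule fundamental_sol)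
  ultimately show "u \<in> bloch_eigenspace X W k \<mu>" unfolding eigenspace_iff[OF W] by blast
qed

lemma bvec_eq_zero: "bvec k \<mu> a b = 0 \<Longrightarrow> a = 0 \<and> b = 0"
proof -
  assume z: "bvec k \<mu> a b = 0"
  let ?f = "\<lambda>x. of_real (iv (shifted \<mu>) 1 0 x) * a + of_real (iv (shifted \<mu>) 0 1 x) * b"
  let ?f' = "\<lambda>x. of_real (ivd (shifted \<mu>) 1 0 x) * a + of_real (ivd (shifted \<mu>) 0 1 x) * b"
  have f0: "?f = (\<lambda>x. 0)"
  proof
    fix x show "?f x = 0" using fun_cong[OF z, of x] by (simp add: bvec_def)
  qed
  have s0: "sol (shifted \<mu>) (\<lambda>x. 0 :: complex) (\<lambda>x. 0)" by (auto simp: sol_def lprim_def)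
  have "?f' = (\<lambda>x. 0)" using sol_derivative_unique[OF fundamental_sol[of \<mu> a b, unfolded f0] s0] .
  from fun_cong[OF f0, of 0] fun_cong[OF this, of 0] show ?thesis by (simp add: ivp_sol[OF potV])
qed

section \<open>Multiplicities of Bloch eigenvalues\<close>

lemma bvec_scale: "(\<lambda>x. c * bvec k \<mu> a b x) = bvec k \<mu> (c * a) (c * b)"
  by (simp add: bvec_def fun_eq_iff algebra_simps)

lemma bvec_add: "bvec k \<mu> a b + bvec k \<mu> a' b' = bvec k \<mu> (a + a') (b + b')"
  by (simp add: bvec_def fun_eq_iff algebra_simps)

text \<open>With determinant one this means plus or minus the identity, the monodromy at a closed
  gap.\<close>

definition scalar where "scalar \<mu> \<longleftrightarrow> m12 \<mu> = 0 \<and> m21 \<mu> = 0 \<and> m11 \<mu> = m22 \<mu>"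

text \<open>The characteristic equation for determinant one: elimination shows that
  \<open>c\<close>, the characteristic polynomial at \<open>l\<close>, annihilates both components
  of the eigenvector.\<close>

lemma eigenvalue_iff:
  assumes "l \<noteq> 0" "of_real (m11 \<mu>) * a + of_real (m12 \<mu>) * b = l * a" "of_real (m21 \<mu>) * a + of_real (m22 \<mu>) * b = l * b"
    "a \<noteq> 0 \<or> b \<noteq> (0::complex)"
  shows "of_real (disc \<mu>) * l = l\<^sup>2 + 1"
proof -
  have dt: "of_real (m11 \<mu>) * of_real (m22 \<mu>) - of_real (m21 \<mu>) * of_real (m12 \<mu>) = (1::complex)"
    using det[of \<mu>] by (metis of_real_1 of_real_diff of_real_mult)
  define c where "c = (of_real (m11 \<mu>) - l) * (of_real (m22 \<mu>) - l) - of_real (m12 \<mu>) * of_real (m21 \<mu>)"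
  have e: "(of_real (m11 \<mu>) - l) * a + of_real (m12 \<mu>) * b = 0" "of_real (m21 \<mu>) * a + (of_real (m22 \<mu>) - l) * b = 0"
    using assms(2,3) by (simp_all add: algebra_simps)
  have "c * a = (of_real (m22 \<mu>) - l) * ((of_real (m11 \<mu>) - l) * a + of_real (m12 \<mu>) * b) - of_real (m12 \<mu>) * (of_real (m21 \<mu>) * a + (of_real (m22 \<mu>) - l) * b)"
    "c * b = (of_real (m11 \<mu>) - l) * (of_real (m21 \<mu>) * a + (of_real (m22 \<mu>) - l) * b) - of_real (m21 \<mu>) * ((of_real (m11 \<mu>) - l) * a + of_real (m12 \<mu>) * b)"
    by (simp_all add: c_def algebra_simps)
  then have "c = 0" using assms(4) unfolding e by auto
  then have "l\<^sup>2 - of_real (disc \<mu>) * l + (of_real (m11 \<mu>) * of_real (m22 \<mu>) - of_real (m21 \<mu>) * of_real (m12 \<mu>)) = 0"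
    by (simp add: c_def disc_def power2_eq_square algebra_simps)
  then show ?thesis unfolding dt by (simp add: algebra_simps eq_diff_eq)
qed

lemma cis_trace: "of_real d * cis t = (cis t)\<^sup>2 + 1 \<longleftrightarrow> d = 2 * cos t"
proof -
  have "(cis t)\<^sup>2 + 1 = cis t * (cis t + cis (- t))" by (simp add: power2_eq_square distrib_left cis_mult)
  also have "cis t + cis (- t) = of_real (2 * cos t)" by (simp add: complex_eq_iff)
  finally have "(cis t)\<^sup>2 + 1 = of_real (2 * cos t) * cis t" by (simp add: mult.commute)
  then have "of_real d * cis t = (cis t)\<^sup>2 + 1 \<longleftrightarrow> (of_real d :: complex) = of_real (2 * cos t)" by simp
  then show ?thesis unfolding of_real_eq_iff .
qed

lemma multiplicity_zero:
  assumes W: "AE x in lborel. W x = V x" and d: "disc \<mu> \<noteq> 2 * cos (k * X)"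
  shows "bloch_multiplicity X W k \<mu> = 0"
proof -
  have "bloch_eigenspace X W k \<mu> \<subseteq> {0}"
  proof
    fix u assume "u \<in> bloch_eigenspace X W k \<mu>"
    then obtain a b where u: "u = bvec k \<mu> a b" and e: "of_real (m11 \<mu>) * a + of_real (m12 \<mu>) * b = cis (k * X) * a"
      "of_real (m21 \<mu>) * a + of_real (m22 \<mu>) * b = cis (k * X) * b" unfolding eigenspace_eq[OF W] by blast
    have "a = 0 \<and> b = 0" using eigenvalue_iff[OF _ e] cis_trace d by auto
    then show "u \<in> {0}" by (simp add: u bvec_def fun_eq_iff)
  qed
  then have "cfun.dim (bloch_eigenspace X W k \<mu>) \<le> card ({} :: (real \<Rightarrow> complex) set)"
    by (intro cfun.dim_le_card) (auto simp: cfun.span_empty)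
  then show ?thesis by (simp add: bloch_multiplicity_def)
qed

lemma multiplicity_two:
  assumes W: "AE x in lborel. W x = V x" and d: "disc \<mu> = 2 * cos (k * X)" and s: "scalar \<mu>"
  shows "bloch_multiplicity X W k \<mu> = 2"
proof -
  have m: "m12 \<mu> = 0" "m21 \<mu> = 0" "m22 \<mu> = m11 \<mu>" "m11 \<mu> = cos (k * X)"
    using s d by (auto simp: scalar_def disc_def)
  \<comment> \<open>Determinant one forces the multiplier to be real, so both rows of the Floquet
    condition become trivial.\<close>
  have "(cos (k * X))\<^sup>2 = 1" using det[of \<mu>] m by (simp add: power2_eq_square)
  then have "sin (k * X) = 0" using sin_cos_squared_add[of "k * X"] by simp
  then have l: "cis (k * X) = of_real (m11 \<mu>)" using m by (simp add: complex_eq_iff)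
  have E: "bloch_eigenspace X W k \<mu> = {bvec k \<mu> a b | a b. True}"
    unfolding eigenspace_eq[OF W] l m(1-3) by simp
  let ?B = "{bvec k \<mu> 1 0, bvec k \<mu> 0 1}"
  have ne: "bvec k \<mu> 1 0 \<notin> range (\<lambda>c x. c * bvec k \<mu> 0 1 x)"
  proof
    assume "bvec k \<mu> 1 0 \<in> range (\<lambda>c x. c * bvec k \<mu> 0 1 x)"
    then obtain c where "bvec k \<mu> 1 0 = bvec k \<mu> 0 c" unfolding bvec_scale by auto
    then have "bvec k \<mu> 1 (- c) = 0" by (simp add: bvec_def fun_eq_iff algebra_simps)
    then show False using bvec_eq_zero by fastforce
  qed
  have nz: "bvec k \<mu> 0 1 \<noteq> 0" using bvec_eq_zero[of k \<mu> 0 1] by auto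
  have neq: "bvec k \<mu> 1 0 \<noteq> bvec k \<mu> 0 1"
  proof
    assume "bvec k \<mu> 1 0 = bvec k \<mu> 0 1"
    then have "bvec k \<mu> 1 0 = (\<lambda>x. 1 * bvec k \<mu> 0 1 x)" by simp
    then show False using ne by blast
  qed
  show ?thesis unfolding bloch_multiplicity_def
  proof (rule cfun.dim_unique[of ?B])
    show "?B \<subseteq> bloch_eigenspace X W k \<mu>" unfolding E by blast
    show "bloch_eigenspace X W k \<mu> \<subseteq> cfun.span ?B"
    proof
      fix u assume "u \<in> bloch_eigenspace X W k \<mu>"
      then obtain a b where "u = bvec k \<mu> a b" unfolding E by blast
      then have "u = (\<lambda>x. a * bvec k \<mu> 1 0 x) + (\<lambda>x. b * bvec k \<mu> 0 1 x)" unfolding bvec_scale bvec_add by simp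
      then show "u \<in> cfun.span ?B" using cfun.span_add[OF cfun.span_scale[OF cfun.span_base] cfun.span_scale[OF cfun.span_base]] by blast
    qed
    show "cfun.independent ?B" using ne nz neq by (simp add: cfun.independent_insert cfun.span_singleton cfun.dependent_single)
    show "card ?B = 2" using neq by simp
  qed
qed

lemma multiplicity_one:
  assumes W: "AE x in lborel. W x = V x" and d: "disc \<mu> = 2 * cos (k * X)" and s: "\<not> scalar \<mu>"
  shows "bloch_multiplicity X W k \<mu> = 1"
proof -
  define l where "l = cis (k * X)"
  have l0: "l \<noteq> 0" by (simp add: l_def)
  have tr: "of_real (disc \<mu>) * l = l\<^sup>2 + 1" unfolding l_def cis_trace by (rule d)
  have dt: "of_real (m11 \<mu>) * of_real (m22 \<mu>) - of_real (m21 \<mu>) * of_real (m12 \<mu>) = (1::complex)"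
    using det[of \<mu>] by (metis of_real_1 of_real_diff of_real_mult)
  have ch: "(of_real (m11 \<mu>) - l) * (of_real (m22 \<mu>) - l) = of_real (m12 \<mu>) * of_real (m21 \<mu>)"
  proof -
    have "(of_real (m11 \<mu>) - l) * (of_real (m22 \<mu>) - l) - of_real (m12 \<mu>) * of_real (m21 \<mu>)
       = (of_real (m11 \<mu>) * of_real (m22 \<mu>) - of_real (m21 \<mu>) * of_real (m12 \<mu>)) + l\<^sup>2 - of_real (disc \<mu>) * l"
      by (simp add: disc_def power2_eq_square algebra_simps)
    then show ?thesis unfolding dt tr by simp
  qed
  \<comment> \<open>For a diagonal monodromy the trace condition gives
    \<open>(m11 \<mu> - m22 \<mu>)\<^sup>2 \<le> 0\<close>, which would make it scalar.\<close>
  have nz: "m12 \<mu> \<noteq> 0 \<or> m21 \<mu> \<noteq> 0"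
  proof (rule ccontr)
    assume z: "\<not> ?thesis"
    then have "(m11 \<mu> - m22 \<mu>)\<^sup>2 = (2 * cos (k * X))\<^sup>2 - 4" using form_discriminant[of \<mu>] d by simp
    moreover have "(cos (k * X))\<^sup>2 \<le> 1" by (simp add: abs_square_le_1)
    ultimately have "(m11 \<mu> - m22 \<mu>)\<^sup>2 \<le> 0" by (simp add: power_mult_distrib)
    then show False using s z by (simp add: scalar_def)
  qed
  define P where "P = (\<lambda>a b. of_real (m11 \<mu>) * a + of_real (m12 \<mu>) * b = l * a \<and> of_real (m21 \<mu>) * a + of_real (m22 \<mu>) * b = l * b)"
  \<comment> \<open>The eigenvector is read off a row with a nonzero off-diagonal entry; that row
    alone fixes it up to a factor.\<close>
  have "\<exists>a b. (a \<noteq> 0 \<or> b \<noteq> 0) \<and> P a b \<and> (\<forall>a' b'. P a' b' \<longrightarrow> (\<exists>c. a' = c * a \<and> b' = c * b))"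
  proof (cases "m12 \<mu> = 0")
    case False
    show ?thesis
    proof (intro exI conjI allI impI)
      show "of_real (m12 \<mu>) \<noteq> (0::complex) \<or> l - of_real (m11 \<mu>) \<noteq> 0" using False by simp
      show "P (of_real (m12 \<mu>)) (l - of_real (m11 \<mu>))"
        unfolding P_def using ch by (simp add: algebra_simps)
      fix a' b' assume "P a' b'"
      then have e: "of_real (m12 \<mu>) * b' = (l - of_real (m11 \<mu>)) * a'" by (simp add: P_def algebra_simps)
      show "a' = (a' / of_real (m12 \<mu>)) * of_real (m12 \<mu>)" using False by simp
      show "b' = (a' / of_real (m12 \<mu>)) * (l - of_real (m11 \<mu>))" using False e by (simp add: field_simps)
    qed
  next
    case True
    then have n: "m21 \<mu> \<noteq> 0" using nz by simp
    show ?thesis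
    proof (intro exI conjI allI impI)
      show "l - of_real (m22 \<mu>) \<noteq> 0 \<or> of_real (m21 \<mu>) \<noteq> (0::complex)" using n by simp
      show "P (l - of_real (m22 \<mu>)) (of_real (m21 \<mu>))"
        unfolding P_def using ch by (simp add: algebra_simps)
      fix a' b' assume "P a' b'"
      then have e: "of_real (m21 \<mu>) * a' = (l - of_real (m22 \<mu>)) * b'" by (simp add: P_def algebra_simps)
      show "b' = (b' / of_real (m21 \<mu>)) * of_real (m21 \<mu>)" using n by simp
      show "a' = (b' / of_real (m21 \<mu>)) * (l - of_real (m22 \<mu>))" using n e by (simp add: field_simps)
    qed
  qed
  then obtain a b where ab: "a \<noteq> 0 \<or> b \<noteq> 0" "P a b" "\<And>a' b'. P a' b' \<Longrightarrow> \<exists>c. a' = c * a \<and> b' = c * b" by blast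
  have E: "bloch_eigenspace X W k \<mu> = {bvec k \<mu> a b | a b. P a b}"
    unfolding eigenspace_eq[OF W] P_def l_def ..
  show ?thesis unfolding bloch_multiplicity_def
  proof (rule cfun.dim_unique[of "{bvec k \<mu> a b}"])
    show "{bvec k \<mu> a b} \<subseteq> bloch_eigenspace X W k \<mu>" using ab(2) unfolding E by blast
    show "bloch_eigenspace X W k \<mu> \<subseteq> cfun.span {bvec k \<mu> a b}"
    proof
      fix u assume "u \<in> bloch_eigenspace X W k \<mu>"
      then obtain a' b' where u: "u = bvec k \<mu> a' b'" "P a' b'" unfolding E by blast
      then obtain c where "u = bvec k \<mu> (c * a) (c * b)" using ab(3) by blast
      then have "u = (\<lambda>x. c * bvec k \<mu> a b x)" unfolding bvec_scale .
      then show "u \<in> cfun.span {bvec k \<mu> a b}" using cfun.span_scale[OF cfun.span_base] by blast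
    qed
    have "bvec k \<mu> a b \<noteq> 0" using bvec_eq_zero ab(1) by blast
    then show "cfun.independent {bvec k \<mu> a b}" by (simp add: cfun.dependent_single)
  qed simp
qed

end

section \<open>Band functions and spectral gaps\<close>

text \<open>At the first disagreement the smaller value \<open>e n\<close> would occur strictly more
  often in \<open>e\<close>: by monotonicity \<open>e'\<close> can take it only before
  \<open>n\<close>, where the sequences agree.\<close>

lemma enumerates_unique_aux:
  assumes e: "mono e" "mono e'" and c: "\<And>\<mu>::real. finite {n::nat. e n = \<mu>}" "\<And>\<mu>. card {n. e n = \<mu>} = card {n. e' n = \<mu>}"
    and eq: "\<And>j. j < n \<Longrightarrow> e j = e' j"
  shows "\<not> e n < e' n"
proof
  assume lt: "e n < e' n"
  have "{j. e' j = e n} \<subset> {j. e j = e n}"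
  proof (rule psubsetI)
    show "{j. e' j = e n} \<subseteq> {j. e j = e n}"
    proof safe
      fix j assume j: "e' j = e n"
      have "j < n" using lt j monoD[OF e(2), of n j] by (cases "j < n") auto
      then show "e j = e n" using eq j by simp
    qed
    show "{j. e' j = e n} \<noteq> {j. e j = e n}"
    proof
      assume h: "{j. e' j = e n} = {j. e j = e n}"
      have "n \<in> {j. e' j = e n}" unfolding h by simp
      then show False using lt by simp
    qed
  qed
  then have "card {j. e' j = e n} < card {j. e j = e n}" using c(1) by (intro psubset_card_mono) auto
  then show False using c(2)[of "e n"] by simp
qed

lemma enumerates_eigenvalues_unique:
  assumes "enumerates_eigenvalues X V k e" "enumerates_eigenvalues X V k e'"
  shows "e = e'"
proof
  fix n show "e n = e' n"
  proof (induction n rule: less_induct)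
    case (less n)
    have "\<not> e n < e' n" by (rule enumerates_unique_aux) (use assms less in \<open>auto simp: enumerates_eigenvalues_def\<close>)
    moreover have "\<not> e' n < e n" by (rule enumerates_unique_aux) (use assms less in \<open>auto simp: enumerates_eigenvalues_def\<close>)
    ultimately show ?case by simp
  qed
qed

context hill_periodic begin

text \<open>Every direction is an eigenvector, so all rotations are multiples of \<pi>, and extremes
  less than \<pi> apart must coincide. Positivity of \<open>Rmax\<close> gives
  \<open>n \<ge> 1\<close>.\<close>

lemma rot_constant_of_scalar:
  assumes "scalar \<mu>" shows "\<exists>n\<ge>1. Rmin \<mu> = real n * pi \<and> Rmax \<mu> = real n * pi"
proof -
  have z: "sin (Rot \<mu> t) = 0" for t
  proof -
    obtain R where "R > 0" "form \<mu> t = R * sin (Rot \<mu> t)"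
      using form_rot by blast
    then show ?thesis using assms by (simp add: scalar_def)
  qed
  obtain t u where t: "Rot \<mu> t = Rmax \<mu>" "Rot \<mu> u = Rmin \<mu>" using rmax_attained(1,3)[OF potV[of \<mu>] X0] by blast
  obtain i j :: int where ij: "Rmax \<mu> = of_int i * pi" "Rmin \<mu> = of_int j * pi"
    using z[of t] z[of u] unfolding t sin_zero_iff_int2 by blast
  have "Rmax \<mu> < Rmin \<mu> + pi" "Rmin \<mu> \<le> Rmax \<mu>" "Rmax \<mu> > 0"
    using rmax_rmin_osc[OF potV X0] rmin_le_rmax[OF potV X0] rmax_pos[OF potV X] by auto
  then have "of_int i * pi < (of_int j + 1) * pi" "of_int j * pi \<le> of_int i * pi" "0 < of_int i * pi"
    unfolding ij by (simp_all add: algebra_simps)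
  then have "of_int i < (of_int (j + 1) :: real)" "of_int j \<le> (of_int i :: real)" "0 < (of_int i :: real)"
    using pi_gt_zero by (simp_all add: zero_less_mult_iff)
  then have "i = j" "i > 0" by linarith+
  then show ?thesis using ij by (intro exI[of _ "nat i"]) auto
qed

text \<open>The form vanishes identically; the angles 0, \<pi>/2 and \<pi>/4 isolate its three
  coefficients.\<close>

lemma scalar_of_rot_constant:
  fixes n :: nat
  assumes "Rmin \<mu> = n * pi" "Rmax \<mu> = n * pi" shows "scalar \<mu>"
proof -
  have F: "form \<mu> t = 0" for t
  proof -
    have "Rot \<mu> t = n * pi" using rmax_attained(2,4)[OF potV X0, of \<mu> t] assms by linarith
    then show ?thesis using form_rot[of \<mu> t] by auto
  qed
  have 1: "m12 \<mu> = 0" using F[of 0] by simp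
  have 2: "m21 \<mu> = 0" using F[of "pi/2"] by simp
  have "(m11 \<mu> - m22 \<mu>) * (sin (pi/4) * cos (pi/4)) = 0" using F[of "pi/4"] 1 2 by simp
  then have "m11 \<mu> = m22 \<mu>" by (simp add: sin_45 cos_45)
  with 1 2 show ?thesis by (simp add: scalar_def)
qed

text \<open>Bands are numbered from 0: band \<open>n\<close> runs from the top of gap
  \<open>n\<close> to the bottom of gap \<open>n + 1\<close>. This is the shift by one in
  \<open>bloch_E_eq\<close>.\<close>

definition level :: "real \<Rightarrow> nat \<Rightarrow> real" where
  "level k n = (THE \<mu>. \<mu> \<in> {beta X V n..alpha X V (Suc n)} \<and> disc \<mu> = 2 * cos (k * X))"

lemma level_iff:
  "level k n = \<mu> \<longleftrightarrow> \<mu> \<in> {beta X V n..alpha X V (Suc n)} \<and> disc \<mu> = 2 * cos (k * X)"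
proof -
  have "\<bar>2 * cos (k * X)\<bar> \<le> 2" by (simp add: abs_mult)
  then obtain \<nu> where \<nu>: "\<nu> \<in> {beta X V n..alpha X V (Suc n)}" "disc \<nu> = 2 * cos (k * X)" using band_exists by blast
  have "level k n = \<nu>" unfolding level_def by (rule the_equality) (use \<nu> band_unique in auto)
  then show ?thesis using \<nu> band_unique by metis
qed

lemma level_bounds: "beta X V n \<le> level k n" "level k n \<le> alpha X V (Suc n)"
  using level_iff[of k n "level k n"] by auto

lemma level_less: "n < l \<Longrightarrow> level k n \<le> alpha X V (Suc n) \<and> alpha X V (Suc n) \<le> beta X V (Suc n) \<and> beta X V (Suc n) \<le> beta X V l \<and> beta X V l \<le> level k l"
proof (intro conjI level_bounds alpha_le_beta)
  assume "n < l"
  then have "real (Suc n) * pi \<le> real l * pi" by (intro mult_right_mono) auto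
  then show "beta X V (Suc n) \<le> beta X V l" unfolding beta_le_iff rmin_beta .
qed simp

lemma level_mono: "mono (level k)"
proof (rule monoI)
  fix n l :: nat assume "n \<le> l"
  then show "level k n \<le> level k l" using level_less[of n l k] by (cases "n = l") auto
qed

lemma in_some_band:
  assumes "(disc \<mu>)\<^sup>2 \<le> 4" shows "\<exists>n. \<mu> \<in> {beta X V n..alpha X V (Suc n)}"
proof -
  have ng: "\<not> (Rmin \<mu> < real n * pi \<and> real n * pi < Rmax \<mu>)" for n using disc_gap[of \<mu> n] assms by auto
  \<comment> \<open>The case \<open>n = 0\<close> of \<open>ng\<close>: zero cannot lie strictly
    between \<open>Rmin\<close> and the positive \<open>Rmax\<close>.\<close>
  have "Rmin \<mu> \<ge> 0" using ng[of 0] rmax_pos[OF potV X, of \<mu>] by auto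
  \<comment> \<open>The last gap whose top does not exceed \<mu>.\<close>
  define n where "n = nat \<lfloor>Rmin \<mu> / pi\<rfloor>"
  have n: "real n \<le> Rmin \<mu> / pi" "Rmin \<mu> / pi < real n + 1"
    using \<open>Rmin \<mu> \<ge> 0\<close> pi_gt_zero by (simp_all add: n_def)
  then have n': "real n * pi \<le> Rmin \<mu>" "Rmin \<mu> < real (Suc n) * pi" using pi_gt_zero by (simp_all add: field_simps)
  then have "Rmax \<mu> \<le> real (Suc n) * pi" using ng[of "Suc n"] by auto
  then show ?thesis using n'(1) beta_le_iff le_alpha_iff[of "Suc n" \<mu>] by (intro exI[of _ n]) simp
qed

text \<open>A value is repeated exactly where two adjacent bands touch, and there the rotation is
  constant and the monodromy scalar; this matches the multiplicities of the eigenspaces.\<close>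

lemma level_enumerates:
  assumes W: "AE x in lborel. W x = V x"
  shows "enumerates_eigenvalues X W k (level k)"
  unfolding enumerates_eigenvalues_def
proof (intro conjI allI level_mono)
  fix \<mu>
  have "finite {n. level k n = \<mu>} \<and> card {n. level k n = \<mu>} = bloch_multiplicity X W k \<mu>"
  proof (cases "disc \<mu> = 2 * cos (k * X)")
    case False
    then have "{n. level k n = \<mu>} = {}" using level_iff by auto
    then show ?thesis by (simp add: multiplicity_zero[OF W False])
  next
    case d: True
    have lv: "level k n = \<mu> \<longleftrightarrow> \<mu> \<in> {beta X V n..alpha X V (Suc n)}" for n using level_iff d by auto
    have two: "n < l \<Longrightarrow> level k n = \<mu> \<Longrightarrow> level k l = \<mu> \<Longrightarrow> alpha X V (Suc n) = \<mu> \<and> beta X V (Suc n) = \<mu> \<and> beta X V l = \<mu>" for n l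
      using level_less[of n l k] by auto
    show ?thesis
    proof (cases "scalar \<mu>")
      case True
      then obtain n where n: "n \<ge> 1" "Rmin \<mu> = real n * pi" "Rmax \<mu> = real n * pi" using rot_constant_of_scalar by blast
      have "{j. level k j = \<mu>} = {n - 1, n}"
      proof (rule set_eqI)
        fix j
        have "level k j = \<mu> \<longleftrightarrow> real j * pi \<le> real n * pi \<and> real n * pi \<le> real (Suc j) * pi"
          unfolding lv atLeastAtMost_iff beta_le_iff using le_alpha_iff[of "Suc j" \<mu>] n by simp
        also have "\<dots> \<longleftrightarrow> j \<le> n \<and> n \<le> Suc j" by (simp del: of_nat_Suc)
        also have "\<dots> \<longleftrightarrow> j \<in> {n - 1, n}" using n(1) by auto
        finally show "j \<in> {j. level k j = \<mu>} \<longleftrightarrow> j \<in> {n - 1, n}" by simp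
      qed
      then show ?thesis using n(1) by (simp add: multiplicity_two[OF W d True])
    next
      case False
      have "(disc \<mu>)\<^sup>2 \<le> 4" using d by (simp add: power_mult_distrib abs_square_le_1)
      then obtain n where n: "level k n = \<mu>" using in_some_band lv by blast
      \<comment> \<open>A repeated value would be both ends of the gap between two bands, hence a
        point of constant rotation.\<close>
      have no: False if "i < j" "level k i = \<mu>" "level k j = \<mu>" for i j
      proof -
        have "alpha X V (Suc i) = \<mu>" "beta X V (Suc i) = \<mu>" using two[OF that] by auto
        then have "Rmin \<mu> = real (Suc i) * pi" "Rmax \<mu> = real (Suc i) * pi"
          using rmin_beta[of "Suc i"] rmax_alpha[of "Suc i"] by auto
        then show False using scalar_of_rot_constant False by blast
      qed
      have "{j. level k j = \<mu>} = {n}"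
      proof (rule set_eqI)
        fix j show "j \<in> {j. level k j = \<mu>} \<longleftrightarrow> j \<in> {n}"
          using n no[of j n] no[of n j] by (cases j n rule: linorder_cases) auto
      qed
      then show ?thesis by (simp add: multiplicity_one[OF W d False])
    qed
  qed
  then show "finite {n. level k n = \<mu>}" "card {n. level k n = \<mu>} = bloch_multiplicity X W k \<mu>" by auto
qed

lemma bloch_E_eq:
  assumes W: "AE x in lborel. W x = V x" shows "bloch_E X W m k = level k (m - 1)"
proof -
  have "(THE e. enumerates_eigenvalues X W k e) = level k"
    by (rule the_equality) (use level_enumerates[OF W] enumerates_eigenvalues_unique in auto)
  then show ?thesis by (simp add: bloch_E_def)
qed

text \<open>Gap edges occur at the centre of the Brillouin zone for even \<open>n\<close> and at its
  boundary for odd \<open>n\<close>.\<close>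

lemma quasimomentum_exists: "\<exists>k\<in>{- pi / X..pi / X}. 2 * cos (k * X) = 2 * (-1) ^ n"
proof (cases "even n")
  case True then show ?thesis using X by (intro bexI[of _ 0]) auto
next
  case False then show ?thesis using X by (intro bexI[of _ "pi / X"]) (auto intro: order_trans[of _ 0])
qed

lemma gap_bottom_eq:
  assumes W: "AE x in lborel. W x = V x" and m: "m \<ge> 1" shows "gap_bottom X m W = alpha X V m"
proof -
  obtain k where k: "k \<in> {- pi / X..pi / X}" "2 * cos (k * X) = 2 * (-1) ^ m" using quasimomentum_exists by blast
  have S: "Suc (m - 1) = m" using m by simp
  have "alpha X V m \<in> {beta X V (m - 1)..alpha X V (Suc (m - 1))}"
    using beta_less_alpha[of "m - 1"] unfolding S by simp
  then have "level k (m - 1) = alpha X V m" unfolding level_iff using disc_alpha[OF m] k(2) by simp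
  then have mem: "alpha X V m \<in> (\<lambda>k. level k (m - 1)) ` {- pi / X..pi / X}" using k(1) by (metis image_eqI)
  have "gap_bottom X m W = Sup ((\<lambda>k. level k (m - 1)) ` {- pi / X..pi / X})"
    unfolding gap_bottom_def bloch_E_eq[OF W] ..
  also have "\<dots> = alpha X V m"
    by (rule cSup_eq_maximum[OF mem]) (use level_bounds(2)[of _ "m - 1", unfolded S] in auto)
  finally show ?thesis .
qed

lemma gap_top_eq:
  assumes W: "AE x in lborel. W x = V x" shows "gap_top X m W = beta X V m"
proof -
  obtain k where k: "k \<in> {- pi / X..pi / X}" "2 * cos (k * X) = 2 * (-1) ^ m" using quasimomentum_exists by blast
  have "beta X V m \<in> {beta X V m..alpha X V (Suc m)}"
    using beta_less_alpha[of m] by simp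
  then have "level k m = beta X V m" unfolding level_iff using disc_beta k(2) by simp
  then have mem: "beta X V m \<in> (\<lambda>k. level k m) ` {- pi / X..pi / X}" using k(1) by (metis image_eqI)
  have "gap_top X m W = Inf ((\<lambda>k. level k m) ` {- pi / X..pi / X})"
    unfolding gap_top_def bloch_E_eq[OF W] by simp
  also have "\<dots> = beta X V m"
    by (rule cInf_eq_minimum[OF mem]) (use level_bounds(1)[of m] in auto)
  finally show ?thesis .
qed

end

section \<open>Zeros of the switching function and first-order perturbation\<close>

text \<open>The set of separators to the left of a point determines the point, which embeds
  \<open>S\<close> into the finite power set of \<open>Z\<close>.\<close>

lemma finite_if_separated:
  fixes S Z :: "real set"
  assumes "finite Z" "\<And>s t. s \<in> S \<Longrightarrow> t \<in> S \<Longrightarrow> s < t \<Longrightarrow> \<exists>z\<in>Z. s < z \<and> z < t"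
  shows "finite S"
proof (rule inj_on_finite)
  have lt: "{z\<in>Z. z < s} \<noteq> {z\<in>Z. z < t}" if st: "s \<in> S" "t \<in> S" "s < t" for s t
  proof -
    obtain z where "z \<in> Z" "s < z" "z < t" using assms(2)[OF st] by blast
    then have "z \<in> {z\<in>Z. z < t}" "z \<notin> {z\<in>Z. z < s}" by auto
    then show ?thesis by blast
  qed
  show "inj_on (\<lambda>s. {z\<in>Z. z < s}) S"
  proof (rule inj_onI)
    fix s t assume "s \<in> S" "t \<in> S" "{z\<in>Z. z < s} = {z\<in>Z. z < t}"
    then show "s = t" using lt[of s t] lt[of t s] by (cases s t rule: linorder_cases) auto
  qed
  show "(\<lambda>s. {z\<in>Z. z < s}) ` S \<subseteq> Pow Z" by blast
  show "finite (Pow Z)" using assms(1) by simp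
qed

text \<open>An accumulation point of zeros would be a zero with vanishing derivative.\<close>

lemma finite_simple_zeros:
  fixes y :: "real \<Rightarrow> real"
  assumes d: "\<And>x. (y has_real_derivative y' x) (at x)" and s: "\<And>x. y x = 0 \<Longrightarrow> y' x \<noteq> 0"
  shows "finite {x\<in>{a..b}. y x = 0}"
proof (rule ccontr)
  let ?S = "{x\<in>{a..b}. y x = 0}"
  assume "infinite ?S"
  moreover have "?S \<subseteq> {a..b}" by blast
  ultimately obtain x where x: "x \<in> {a..b}" "x islimpt ?S"
    using Heine_Borel_imp_Bolzano_Weierstrass[OF compact_Icc] by blast
  have cont: "isCont y z" for z using d by (rule DERIV_isCont)
  have "closed {x. y x = 0}"
    by (intro closed_Collect_eq continuous_intros continuous_at_imp_continuous_on ballI cont)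
  moreover have "x islimpt {x. y x = 0}" by (rule islimpt_subset[OF x(2)]) auto
  ultimately have y0: "y x = 0" unfolding closed_limpt by blast
  have "((\<lambda>z. (y z - y x) / (z - x)) \<longlongrightarrow> y' x) (at x)" using d[of x] by (simp add: has_field_derivative_iff)
  then have "eventually (\<lambda>z. (y z - y x) / (z - x) \<noteq> 0) (at x)" using s[OF y0] by (rule tendsto_imp_eventually_ne)
  then have "eventually (\<lambda>z. y z \<noteq> 0) (at x)" by eventually_elim (use y0 in auto)
  then obtain e where e: "e > 0" "\<And>z. z \<noteq> x \<Longrightarrow> dist z x < e \<Longrightarrow> y z \<noteq> 0" unfolding eventually_at by auto
  obtain z where "z \<in> ?S" "z \<noteq> x" "dist z x < e" using x(2) e(1) unfolding islimpt_approachable by blast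
  then show False using e(2) by auto
qed

lemma finite_zeros_Rolle:
  fixes y :: "real \<Rightarrow> real"
  assumes d: "\<And>x. (y has_real_derivative y' x) (at x)" and f: "finite {x\<in>{a..b}. y' x = 0}"
  shows "finite {x\<in>{a..b}. y x = 0}"
proof (rule finite_if_separated[OF f])
  fix s t assume st: "s \<in> {x\<in>{a..b}. y x = 0}" "t \<in> {x\<in>{a..b}. y x = 0}" "s < t"
  have cont: "isCont y z" for z using d by (rule DERIV_isCont)
  have "\<exists>z. s < z \<and> z < t \<and> (y has_real_derivative 0) (at z)"
    by (rule Rolle) (use st d cont in \<open>auto intro: continuous_at_imp_continuous_on simp: real_differentiable_def\<close>)
  then obtain z where z: "s < z" "z < t" "(y has_real_derivative 0) (at z)" by blast
  then have "y' z = 0" using DERIV_unique[OF d] by blast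
  with z st show "\<exists>z\<in>{x\<in>{a..b}. y' x = 0}. s < z \<and> z < t" by (intro bexI[of _ z]) auto
qed

lemma sol_has_real_derivative:
  assumes "sol q y y'" shows "(y has_real_derivative y' x) (at x)"
  using assms lprim_has_vector_derivative[of y y' x] lprim_continuous_on[of y' _ UNIV]
  by (auto simp: sol_def has_real_derivative_iff_has_vector_derivative)

text \<open>Where \<open>u \<noteq> 0\<close>, the zeros of \<open>g v\<^sup>2 - h u\<^sup>2\<close> are points where \<open>v / u\<close> takes one of two fixed values.
  Between two such points the Wronskian \<open>u v' - u' v\<close> vanishes, and its derivative is \<open>(a - b) u v\<close>.\<close>

lemma finite_zeros_quadratic:
  assumes u: "sol (\<lambda>x. V x - a) u u'" and v: "sol (\<lambda>x. V x - b) v v'" and ab: "a \<noteq> b" and gh: "0 < g" "0 < h"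
    and su: "\<And>x. u x = 0 \<Longrightarrow> u' x \<noteq> 0" and sv: "\<And>x. v x = 0 \<Longrightarrow> v' x \<noteq> (0::real)"
  shows "finite {x\<in>{c..d}. g * (v x)\<^sup>2 - h * (u x)\<^sup>2 = 0}"
proof -
  note du = sol_has_real_derivative[OF u] and dv = sol_has_real_derivative[OF v]
  have fu: "finite {x\<in>{c..d}. u x = 0}" by (rule finite_simple_zeros[OF du su])
  have fv: "finite {x\<in>{c..d}. v x = 0}" by (rule finite_simple_zeros[OF dv sv])
  define R where "R = (\<lambda>x. u x * v' x - u' x * v x)"
  have R: "lprim R (\<lambda>x. (a - b) * (u x * v x))"
    using sol_wronskian[OF u v] by (simp add: R_def)
  have cu: "continuous_on UNIV u" "continuous_on UNIV v"
    using u v by (auto simp: sol_def intro: lprim_continuous_on)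
  have dR: "(R has_real_derivative (a - b) * (u x * v x)) (at x)" for x
    unfolding has_real_derivative_iff_has_vector_derivative
    by (rule lprim_has_vector_derivative[OF R]) (intro continuous_intros cu)
  have "{x\<in>{c..d}. (a - b) * (u x * v x) = 0} \<subseteq> {x\<in>{c..d}. u x = 0} \<union> {x\<in>{c..d}. v x = 0}" using ab by auto
  then have "finite {x\<in>{c..d}. (a - b) * (u x * v x) = 0}" using fu fv finite_subset by blast
  from finite_zeros_Rolle[OF dR this] have fR: "finite {x\<in>{c..d}. R x = 0}" .
  \<comment> \<open>The zeros of \<open>u\<close> count as separators too, because the quotient
    \<open>v / u\<close> is meaningful only between them.\<close>
  define Z where "Z = {x\<in>{c..d}. u x = 0} \<union> {x\<in>{c..d}. R x = 0}"
  have fS: "finite {x\<in>{c..d}. u x \<noteq> 0 \<and> v x = k * u x}" for k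
  proof (rule finite_if_separated)
    show "finite Z" using fu fR by (simp add: Z_def)
    fix s t assume s: "s \<in> {x\<in>{c..d}. u x \<noteq> 0 \<and> v x = k * u x}" and t: "t \<in> {x\<in>{c..d}. u x \<noteq> 0 \<and> v x = k * u x}" and st: "s < t"
    show "\<exists>z\<in>Z. s < z \<and> z < t"
    proof (cases "\<exists>z\<in>{s..t}. u z = 0")
      case True
      then obtain z where z: "z \<in> {s..t}" "u z = 0" by blast
      then have "z \<noteq> s" "z \<noteq> t" using s t by auto
      with z s t show ?thesis by (intro bexI[of _ z]) (auto simp: Z_def)
    next
      case False
      have dq: "((\<lambda>x. v x / u x) has_real_derivative (v' x * u x - v x * u' x) / (u x * u x)) (at x)" if "x \<in> {s..t}" for x
        by (rule DERIV_divide[OF dv du]) (use False that in auto)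
      have "\<exists>z. s < z \<and> z < t \<and> ((\<lambda>x. v x / u x) has_real_derivative 0) (at z)"
      proof (rule Rolle[OF st])
        show "v s / u s = v t / u t" using s t by simp
        show "continuous_on {s..t} (\<lambda>x. v x / u x)"
          by (intro continuous_intros continuous_on_subset[OF cu(1)] continuous_on_subset[OF cu(2)]) (use False in auto)
        show "(\<lambda>x. v x / u x) differentiable (at x)" if "s < x" "x < t" for x
          using dq[of x] that by (auto simp: real_differentiable_def)
      qed
      then obtain z where z: "s < z" "z < t" "((\<lambda>x. v x / u x) has_real_derivative 0) (at z)" by blast
      then have "(v' z * u z - v z * u' z) / (u z * u z) = 0" using DERIV_unique[OF dq[of z] z(3)] by simp
      moreover have "u z \<noteq> 0" using False z by auto
      ultimately have "R z = 0" by (simp add: R_def mult.commute)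
      with z s t show ?thesis by (intro bexI[of _ z]) (auto simp: Z_def)
    qed
  qed
  \<comment> \<open>Positivity of \<open>g\<close> and \<open>h\<close> splits the equation into
    \<open>v = k u\<close> and \<open>v = - k u\<close>.\<close>
  define k where "k = sqrt (h / g)"
  have k2: "k\<^sup>2 = h / g" using gh by (simp add: k_def)
  have "{x\<in>{c..d}. g * (v x)\<^sup>2 - h * (u x)\<^sup>2 = 0} \<subseteq> {x\<in>{c..d}. u x = 0}
     \<union> {x\<in>{c..d}. u x \<noteq> 0 \<and> v x = k * u x} \<union> {x\<in>{c..d}. u x \<noteq> 0 \<and> v x = (- k) * u x}"
  proof
    fix x assume x: "x \<in> {x\<in>{c..d}. g * (v x)\<^sup>2 - h * (u x)\<^sup>2 = 0}"
    then have "(v x)\<^sup>2 = h / g * (u x)\<^sup>2" using gh by (simp add: field_simps)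
    then have "(v x)\<^sup>2 = (k * u x)\<^sup>2" by (simp add: power_mult_distrib k2)
    then have "v x = k * u x \<or> v x = - (k * u x)" by (simp add: power2_eq_iff)
    with x show "x \<in> {x\<in>{c..d}. u x = 0}
     \<union> {x\<in>{c..d}. u x \<noteq> 0 \<and> v x = k * u x} \<union> {x\<in>{c..d}. u x \<noteq> 0 \<and> v x = (- k) * u x}" by auto
  qed
  then show ?thesis using fu fS[of k] fS[of "-k"] finite_subset by blast
qed

text \<open>First-order perturbation along a single trajectory: decreasing the potential against \<open>u\<^sup>2\<close>
  increases the terminal angle, because \<open>u u\<^sub>t' - u' u\<^sub>t = - r r\<^sub>t sin (\<theta>\<^sub>t - \<theta>)\<close> is negative at the end point.\<close>

lemma rot_perturbation:
  assumes q: "pot q" and p: "pot p" and X: "X > 0"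
    and neg: "integral {0..X} (\<lambda>x. \<sigma> * p x * (iv q (sin t) (cos t) x)\<^sup>2) < 0" and \<sigma>: "\<sigma> = 1 \<or> \<sigma> = - 1"
  shows "\<exists>d>0. \<forall>s. 0 < s \<and> s < d \<longrightarrow> \<sigma> * rot X q t < \<sigma> * rot X (\<lambda>x. q x + s * p x) t"
proof -
  obtain Q0 where Q0: "\<And>x. \<bar>q x\<bar> \<le> Q0" using pot_bound[OF q] by blast
  obtain P0 where P0: "\<And>x. \<bar>p x\<bar> \<le> P0" using pot_bound[OF p] by blast
  have P00: "P0 \<ge> 0" using P0[of 0] by linarith
  define Q where "Q = Q0 + P0"
  have Q: "\<bar>q x\<bar> \<le> Q" for x using Q0[of x] P00 by (simp add: Q_def)
  have [measurable]: "q \<in> borel_measurable borel" "p \<in> borel_measurable borel" using q p by (auto simp: pot_def)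
  have Qs: "\<bar>q x + s * p x\<bar> \<le> Q" if "0 < s" "s \<le> 1" for x s
  proof -
    have "\<bar>s * p x\<bar> \<le> 1 * P0" unfolding abs_mult by (rule mult_mono) (use that P0 in auto)
    then show ?thesis using Q0[of x] abs_triangle_ineq[of "q x" "s * p x"] by (simp add: Q_def)
  qed
  have pots: "pot (\<lambda>x. q x + s * p x)" if "0 < s" "s \<le> 1" for s
    unfolding pot_def using Qs[OF that] by auto
  let ?u = "iv q (sin t) (cos t)"
  define K where "K = exp ((1 + Q) * X)"
  define L where "L = 2 * K ^ 3 * X * P0"
  have L0: "L \<ge> 0" using X P00 by (simp add: L_def K_def)
  define I where "I = integral {0..X} (\<lambda>x. \<sigma> * p x * (?u x)\<^sup>2)"
  have I: "I < 0" using neg by (simp add: I_def)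
  define C where "C = P0 * K * L * X"
  have C0: "C \<ge> 0" using P00 L0 X by (simp add: C_def K_def)
  define H where "H = exp (2 * (1 + Q) * X) * (P0 * X)"
  have H0: "H \<ge> 0" using P00 X by (simp add: H_def)
  \<comment> \<open>The bound by \<open>- I / (C + 1)\<close> lets the first-order term
    \<open>s * I\<close> dominate the remainder \<open>s * (s * C)\<close>. The bound by
    \<open>pi / (H + 1)\<close> keeps the change of angle below \<pi>, where the sign of its sine
    decides the direction.\<close>
  define d where "d = min 1 (min (- I / (C + 1)) (pi / (H + 1)))"
  have "- I / (C + 1) > 0" by (rule divide_pos_pos) (use I C0 in auto)
  moreover have "pi / (H + 1) > 0" by (rule divide_pos_pos) (use H0 in auto)
  ultimately have d: "d > 0" unfolding d_def by simp
  show ?thesis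
  proof (intro exI[of _ d] conjI d allI impI)
    fix s assume s: "0 < s \<and> s < d"
    then have s1: "0 < s" "s \<le> 1" by (auto simp: d_def)
    have sI: "s * C < - I"
    proof -
      have "s < - I / (C + 1)" using s by (simp add: d_def)
      then have "s * (C + 1) < - I" using C0 pos_less_divide_eq[of "C + 1" s "- I"] by simp
      then show ?thesis using s1 by (simp add: distrib_left)
    qed
    have sH: "s * H < pi"
    proof -
      have "s < pi / (H + 1)" using s by (simp add: d_def)
      then have "s * (H + 1) < pi" using H0 by (simp add: pos_less_divide_eq)
      then show ?thesis using s1 by (simp add: distrib_left)
    qed
    let ?r = "\<lambda>x. q x + s * p x"
    let ?w = "iv ?r (sin t) (cos t)"
    have w: "pot ?r" by (rule pots[OF s1])
    have e: "\<bar>?r x - q x\<bar> \<le> s * P0" for x using P0[of x] s1 by (simp add: abs_mult mult_left_mono)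
    have close: "\<bar>?w x - ?u x\<bar> \<le> L * s" if "x \<in> {0..X}" for x
      using iv_lipschitz(1)[OF q w Q Qs[OF s1] e, of x X "sin t" "cos t"] that by (simp add: L_def K_def mult_ac)
    have ub: "\<bar>?u x\<bar> \<le> K" if "x \<in> {0..X}" for x
    proof -
      have "exp ((1 + Q) * \<bar>x\<bar>) \<le> K" using that Q[of 0] unfolding K_def by (auto intro!: mult_left_mono)
      then show ?thesis using iv_bound(1)[OF q Q, of "sin t" "cos t" x] by simp
    qed
    have wr: "lprim (\<lambda>x. ?u x * ivd ?r (sin t) (cos t) x - ivd q (sin t) (cos t) x * ?w x) (\<lambda>x. (?r x - q x) *\<^sub>R (?u x * ?w x))"
      by (rule sol_wronskian[OF ivp_sol(1)[OF q] ivp_sol(1)[OF w]])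
    define N where "N = ?u X * ivd ?r (sin t) (cos t) X - ivd q (sin t) (cos t) X * ?w X"
    have N: "((\<lambda>x. s * (p x * (?u x * ?w x))) has_integral N) {0..X}"
      using lprim_integral[OF wr, of 0 X] X ivp_sol(2,3)[OF q] ivp_sol(2,3)[OF w] by (simp add: N_def mult_ac)
    have mu: "?u \<in> borel_measurable borel"
      using ivp_sol(1)[OF q, of "sin t" "cos t"] by (auto simp: sol_def intro: lprim_measurable_prim)
    have "(\<lambda>x. \<sigma> * p x * (?u x)\<^sup>2) integrable_on {0..X}"
    proof (rule borel_bounded_integrable_on(1)[where K="P0 * K\<^sup>2"])
      show "(\<lambda>x. \<sigma> * p x * (?u x)\<^sup>2) \<in> borel_measurable borel" using mu by measurable
      show "norm (\<sigma> * p x * (?u x)\<^sup>2) \<le> P0 * K\<^sup>2" if "x \<in> {0..X}" for x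
      proof -
        have "(?u x)\<^sup>2 \<le> K\<^sup>2" using ub[OF that] by (metis abs_ge_zero power2_abs power_mono)
        then have "\<bar>p x\<bar> * (?u x)\<^sup>2 \<le> P0 * K\<^sup>2" using P0 P00 by (intro mult_mono) auto
        then show ?thesis using \<sigma> by (auto simp: abs_mult)
      qed
    qed
    then have "((\<lambda>x. \<sigma> * p x * (?u x)\<^sup>2) has_integral I) {0..X}" unfolding I_def by (rule integrable_integral)
    \<comment> \<open>Replacing the perturbed solution by the unperturbed one leaves an error with a
      second factor \<open>s\<close>.\<close>
    from has_integral_diff[OF has_integral_mult_right[OF N, of \<sigma>] has_integral_mult_right[OF this, of s]]
    have "((\<lambda>x. s * (\<sigma> * p x * (?u x * (?w x - ?u x)))) has_integral (\<sigma> * N - s * I)) {0..X}"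
      by (simp add: power2_eq_square algebra_simps)
    moreover have "norm (s * (\<sigma> * p x * (?u x * (?w x - ?u x)))) \<le> s * (P0 * (K * (L * s)))" if "x \<in> {0..X}" for x
    proof -
      have "\<bar>\<sigma> * p x\<bar> \<le> P0" using \<sigma> P0[of x] by (auto simp: abs_mult)
      then have "\<bar>\<sigma> * p x\<bar> * (\<bar>?u x\<bar> * \<bar>?w x - ?u x\<bar>) \<le> P0 * (K * (L * s))"
        using close[OF that] ub[OF that] P00 by (intro mult_mono) (auto simp: K_def)
      then have "s * (\<bar>\<sigma> * p x\<bar> * (\<bar>?u x\<bar> * \<bar>?w x - ?u x\<bar>)) \<le> s * (P0 * (K * (L * s)))" using s1 by simp
      then show ?thesis using s1 by (simp add: abs_mult mult.assoc)
    qed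
    ultimately have "norm (\<sigma> * N - s * I) \<le> s * (P0 * (K * (L * s))) * (X - 0)"
      using X s1 P00 L0 by (intro has_integral_interval_bound[of _ "\<sigma> * N - s * I" 0 X "s * (P0 * (K * (L * s)))"]) (auto simp: K_def)
    then have "\<sigma> * N \<le> s * I + s * (s * C)" by (simp add: C_def abs_le_iff mult_ac)
    also have "\<dots> = s * (I + s * C)" by (simp add: distrib_left)
    also have "\<dots> < 0" using sI s1 by (simp add: mult_pos_neg)
    finally have Nneg: "\<sigma> * N < 0" .
    define \<theta> where "\<theta> = prufer q t"
    define \<eta> where "\<eta> = prufer ?r t"
    have th: "pruf q \<theta>" "\<theta> 0 = t" "pruf ?r \<eta>" "\<eta> 0 = t" using prufer_sol[OF q] prufer_sol[OF w] by (auto simp: \<theta>_def \<eta>_def)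
    obtain r1 where r1: "\<forall>x. r1 x > 0" "iv q (sin t) (cos t) = (\<lambda>x. r1 x * sin (\<theta> x))" "ivd q (sin t) (cos t) = (\<lambda>x. r1 x * cos (\<theta> x))"
      using iv_pruf[OF q th(1) Q] unfolding th(2) by blast
    obtain r2 where r2: "\<forall>x. r2 x > 0" "iv ?r (sin t) (cos t) = (\<lambda>x. r2 x * sin (\<eta> x))" "ivd ?r (sin t) (cos t) = (\<lambda>x. r2 x * cos (\<eta> x))"
      using iv_pruf[OF w th(3) Qs[OF s1]] unfolding th(4) by blast
    have "N = - (r1 X * r2 X * sin (\<eta> X - \<theta> X))"
      unfolding N_def r1(2,3) r2(2,3) by (simp add: sin_diff algebra_simps)
    then have "0 < r1 X * r2 X * (\<sigma> * sin (\<eta> X - \<theta> X))" using Nneg by (simp add: mult_ac)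
    moreover have "r1 X * r2 X > 0" using r1 r2 by simp
    ultimately have "0 < \<sigma> * sin (\<eta> X - \<theta> X)" by (rule zero_less_mult_pos)
    then have sp: "0 < sin (\<sigma> * (\<eta> X - \<theta> X))" using \<sigma> by (metis minus_mult_minus mult_1 mult_minus1 sin_minus)
    have "\<bar>\<theta> X - \<eta> X\<bar> \<le> exp (2 * (1 + Q) * X) * (\<bar>\<theta> 0 - \<eta> 0\<bar> + s * P0 * X)"
      by (rule pruf_lipschitz[OF q w th(1,3) Q e]) (use X in simp)
    also have "\<dots> = s * H" by (simp add: th H_def)
    finally have "\<bar>\<sigma> * (\<eta> X - \<theta> X)\<bar> < pi" using sH \<sigma> by (auto simp: abs_mult abs_minus_commute)
    moreover have "\<sigma> * (\<eta> X - \<theta> X) > 0"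
    proof (rule ccontr)
      assume n: "\<not> ?thesis"
      have "sin (- (\<sigma> * (\<eta> X - \<theta> X))) \<ge> 0"
        by (rule sin_ge_zero) (use n calculation in auto)
      then show False using sp by simp
    qed
    ultimately show "\<sigma> * rot X q t < \<sigma> * rot X ?r t" unfolding rot_def \<theta>_def \<eta>_def by (simp add: algebra_simps)
  qed
qed

section \<open>Periodic representatives and step functions\<close>

definition cell :: "real \<Rightarrow> real \<Rightarrow> real" where
  "cell X x = x - of_int \<lfloor>x / X\<rfloor> * X"

lemma cell_bounds: "X > 0 \<Longrightarrow> 0 \<le> cell X x" "X > 0 \<Longrightarrow> cell X x < X"
proof -
  assume X: "X > 0"
  have "of_int \<lfloor>x / X\<rfloor> \<le> x / X" "x / X < of_int \<lfloor>x / X\<rfloor> + 1" by linarith+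
  then show "0 \<le> cell X x" "cell X x < X" 
    using X pos_le_divide_eq[of X "of_int \<lfloor>x / X\<rfloor>" x] pos_divide_less_eq[of X x "of_int \<lfloor>x / X\<rfloor> + 1"]
    by (simp_all add: cell_def algebra_simps)
qed

lemma cell_periodic: "X > 0 \<Longrightarrow> cell X (x + X) = cell X x"
  by (simp add: cell_def add_divide_distrib algebra_simps)

lemma cell_id: "0 \<le> x \<Longrightarrow> x < X \<Longrightarrow> cell X x = x"
proof -
  assume x: "0 \<le> x" "x < X"
  then have "\<lfloor>x / X\<rfloor> = 0" by (simp add: floor_eq_iff)
  then show ?thesis by (simp add: cell_def)
qed

lemma cell_measurable [measurable]: "cell X \<in> borel_measurable borel"
  unfolding cell_def[abs_def] by measurable

lemma AE_lborel_shift: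
  fixes P :: "real \<Rightarrow> bool"
  assumes "AE x in lborel. P x" shows "AE x in lborel. P (x + c)"
proof -
  obtain N where N: "N \<in> null_sets lborel" "{x. \<not> P x} \<subseteq> N" using assms unfolding eventually_ae_filter by auto
  have "{x. x - (- c) \<in> N} \<in> null_sets lborel" by (rule null_sets_translation[OF N(1)])
  then show ?thesis by (rule AE_I') (use N(2) in auto)
qed

text \<open>A countable union of translated null sets is null; this upgrades a condition on one
  shift to all integer multiples of the period.\<close>

lemma AE_lborel_all_shifts:
  fixes P :: "real \<Rightarrow> bool"
  assumes "AE x in lborel. P x" shows "AE x in lborel. \<forall>n::int. P (x + of_int n * c)"
  unfolding AE_all_countable using AE_lborel_shift[OF assms] by blast

lemma AE_periodic_extension:
  assumes "AE x in lborel. x \<in> {0..<X} \<longrightarrow> P x" "X > 0"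
  shows "AE x in lborel. P (cell X x)"
proof -
  from AE_lborel_all_shifts[OF assms(1), of X] show ?thesis
  proof eventually_elim
    case (elim x)
    have "cell X x = x + of_int (- \<lfloor>x / X\<rfloor>) * X" by (simp add: cell_def)
    then show ?case using elim[rule_format, of "- \<lfloor>x / X\<rfloor>"] cell_bounds[OF assms(2), of x] by auto
  qed
qed

text \<open>A Borel version of \<open>V\<close> is restricted to one period, extended periodically
  and clamped to \<open>{0..Vp}\<close>. Almost every point obeys all integer shifts simultaneously,
  so only a null set is altered.\<close>

lemma periodic_representative:
  assumes V: "V \<in> admissible X Vp" and X: "X > 0" and Vp: "Vp > 0"
  shows "\<exists>U. U \<in> borel_measurable borel \<and> (\<forall>x. U (x + X) = U x) \<and> (\<forall>x. 0 \<le> U x \<and> U x \<le> Vp)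
    \<and> (AE x in lborel. V x = U x)"
proof -
  have Vm: "V \<in> borel_measurable lebesgue" and per: "AE x in lborel. V (x + X) = V x" and rng: "AE x in lborel. V x \<in> {0..Vp}"
    using V by (simp_all add: admissible_def AE_completion_iff)
  obtain W where W: "W \<in> borel_measurable borel" "AE x in lborel. V x = W x"
    using completion_ex_borel_measurable_real[OF Vm] by auto
  define U where "U = (\<lambda>x. max 0 (min Vp (W (cell X x))))"
  have "AE x in lborel. W (x + X) = W x"
    using AE_lborel_shift[OF W(2), of X] W(2) per by eventually_elim simp
  then have all: "AE x in lborel. \<forall>n::int. W (x + of_int n * X + X) = W (x + of_int n * X)" by (rule AE_lborel_all_shifts)
  have "AE x in lborel. V x = U x"
    using all W(2) rng
  proof eventually_elim
    case (elim x)
    have "W (x + of_int n * X) = W x" for n :: int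
    proof (induction n rule: int_induct[of _ 0])
      case (step1 i)
      then show ?case using elim(1)[rule_format, of i] by (simp add: algebra_simps)
    next
      case (step2 i)
      then show ?case using elim(1)[rule_format, of "i - 1"] by (simp add: algebra_simps)
    qed simp
    from this[of "- \<lfloor>x / X\<rfloor>"] have "W (cell X x) = W x" by (simp add: cell_def)
    then show ?case using elim by (simp add: U_def)
  qed
  moreover have "U \<in> borel_measurable borel" unfolding U_def using W(1) by measurable
  ultimately show ?thesis using Vp by (intro exI[of _ U]) (auto simp: U_def cell_periodic[OF X])
qed

lemma hill_periodicI:
  assumes "U \<in> borel_measurable borel" "\<And>x. U (x + X) = U x" "\<And>x. 0 \<le> U x" "\<And>x. U x \<le> M" "X > 0"
  shows "hill_periodic X U"
proof unfold_locales
  have "\<bar>U x\<bar> \<le> M" for x using assms(3,4)[of x] by simp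
  then show "pot U" using assms(1) unfolding pot_def by blast
qed (use assms in auto)

lemma gap_ratio_eq:
  assumes "hill_periodic X U" "AE x in lborel. W x = U x" "m \<ge> 1"
  shows "gap_ratio X m W = (beta X U m - alpha X U m) / ((alpha X U m + beta X U m) / 2)"
  unfolding gap_ratio_def hill_periodic.gap_bottom_eq[OF assms] hill_periodic.gap_top_eq[OF assms(1,2)] ..

section \<open>Step functions given by the sign of a continuous function\<close>

lemma nonzero_const_sign:
  fixes f :: "real \<Rightarrow> real"
  assumes "continuous_on UNIV f" "\<And>z. a < z \<Longrightarrow> z < b \<Longrightarrow> f z \<noteq> 0" "a < x" "x < b" "a < y" "y < b"
  shows "f x > 0 \<longleftrightarrow> f y > 0"
proof -
  have *: False if "a < x" "x < b" "a < y" "y < b" "f x > 0" "f y \<le> 0" for x y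
  proof (cases "x \<le> y")
    case True
    then have "\<exists>z\<ge>x. z \<le> y \<and> f z = 0"
      by (intro IVT2') (use that continuous_on_subset[OF assms(1)] in auto)
    then obtain z where "z \<ge> x" "z \<le> y" "f z = 0" by blast
    then show False using assms(2)[of z] that by auto
  next
    case False
    then have "\<exists>z\<ge>y. z \<le> x \<and> f z = 0"
      by (intro IVT') (use that continuous_on_subset[OF assms(1)] in auto)
    then obtain z where "z \<ge> y" "z \<le> x" "f z = 0" by blast
    then show False using assms(2)[of z] that by auto
  qed
  show ?thesis using *[of x y] *[of y x] assms(3-6) by force
qed

lemma step_function_of_sign:
  fixes f :: "real \<Rightarrow> real"
  assumes X: "X > 0" and c: "continuous_on UNIV f" and fin: "finite {x\<in>{0..X}. f x = 0}"
  shows "periodic_step_function X (\<lambda>x. if f (cell X x) > 0 then a else b)"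
proof -
  \<comment> \<open>The end points join the zeros of \<open>f\<close> so that the sorted list
    partitions the whole period.\<close>
  define P where "P = insert 0 (insert X {x\<in>{0..X}. f x = 0})"
  have P: "finite P" "P \<subseteq> {0..X}" "0 \<in> P" "X \<in> P" using fin X by (auto simp: P_def)
  define xs where "xs = sorted_list_of_set P"
  have xs: "sorted_wrt (<) xs" "set xs = P" using P(1) by (simp_all add: xs_def)
  have len: "length xs \<ge> 2"
  proof -
    have "card {0, X} \<le> card P" using P by (intro card_mono) auto
    then show ?thesis using X P(1) by (simp add: xs_def)
  qed
  define n where "n = length xs - 1"
  define p where "p = (\<lambda>i. xs ! i)"
  have mono: "p i < p j" if "i < j" "j \<le> n" for i j
    using sorted_wrt_nth_less[OF xs(1), of i j] that len by (simp add: p_def n_def)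
  have mem: "\<exists>i\<le>n. p i = x" if "x \<in> P" for x
  proof -
    obtain i where "i < length xs" "xs ! i = x" using \<open>x \<in> P\<close> unfolding xs(2)[symmetric] in_set_conv_nth by blast
    then show ?thesis unfolding p_def n_def by (intro exI[of _ i]) auto
  qed
  have pin: "p i \<in> P" if "i \<le> n" for i
    using that len nth_mem[of i xs] unfolding xs(2)[symmetric] p_def n_def by simp
  have p0: "p 0 = 0"
  proof -
    obtain i where i: "i \<le> n" "p i = 0" using mem P(3) by blast
    have "p 0 \<ge> 0" using pin[of 0] P(2) by auto
    then show ?thesis using mono[of 0 i] i by (cases "i = 0") auto
  qed
  have pn: "p n = X"
  proof -
    obtain i where i: "i \<le> n" "p i = X" using mem P(4) by blast
    have "p n \<le> X" using pin[of n] P(2) by auto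
    then show ?thesis using mono[of i n] i by (cases "i = n") auto
  qed
  define c where "c = (\<lambda>i. if f ((p i + p (Suc i)) / 2) > 0 then a else b)"
  have const: "(if f (cell X x) > 0 then a else b) = c i" if i: "i < n" and x: "x \<in> {p i<..<p (Suc i)}" for i x
  proof -
    have lt: "p i < p (Suc i)" using mono i by simp
    have bds: "0 \<le> p i" "p (Suc i) \<le> X" using pin[of i] pin[of "Suc i"] P(2) i by auto
    have nz: "f z \<noteq> 0" if z: "p i < z" "z < p (Suc i)" for z
    proof
      assume "f z = 0"
      then have "z \<in> P" using z bds by (auto simp: P_def)
      then obtain j where j: "j \<le> n" "p j = z" using mem by blast
      have "\<not> j \<le> i" using mono[of j i] j z i by (cases "j = i") auto
      moreover have "\<not> Suc i \<le> j" using mono[of "Suc i" j] j z by (cases "j = Suc i") auto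
      ultimately show False by simp
    qed
    have "cell X x = x" using x bds by (intro cell_id) auto
    moreover have "f x > 0 \<longleftrightarrow> f ((p i + p (Suc i)) / 2) > 0"
      by (rule nonzero_const_sign[OF \<open>continuous_on UNIV f\<close> nz]) (use x lt in auto)
    ultimately show ?thesis by (simp add: c_def)
  qed
  have "strict_mono_on {..n} p" using mono by (auto simp: strict_mono_on_def)
  then have "\<exists>(n::nat) p c. p 0 = 0 \<and> p n = X \<and> strict_mono_on {..n} p
      \<and> (\<forall>i<n. \<forall>x\<in>{p i<..<p (Suc i)}. (if f (cell X x) > 0 then a else b) = c i)"
    using p0 pn const by blast
  then show ?thesis unfolding periodic_step_function_def cell_periodic[OF X] by simp
qed

text \<open>Near an interior point where \<open>f\<close> is nonzero the potential is almost
  everywhere constant. The point 0 is kept separately: the periodic continuation may jump there even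
  if \<open>f 0\<close> is nonzero.\<close>

lemma transitions_of_sign:
  fixes f :: "real \<Rightarrow> real"
  assumes X: "X > 0" and c: "continuous_on UNIV f" and ab: "a \<noteq> b"
    and ae: "AE x in lebesgue. V x = (if f (cell X x) > 0 then a else b)"
  shows "transitions V b a \<inter> {0..<X} \<subseteq> insert 0 {x\<in>{0..X}. f x = 0}"
proof
  fix x assume x: "x \<in> transitions V b a \<inter> {0..<X}"
  show "x \<in> insert 0 {x\<in>{0..X}. f x = 0}"
  proof (rule ccontr)
    assume "x \<notin> insert 0 {x\<in>{0..X}. f x = 0}"
    then have nz: "0 < x" "x < X" "f x \<noteq> 0" using x by auto
    have "isCont f x" using c by (simp add: continuous_on_eq_continuous_at)
    then obtain d where d: "d > 0" "\<And>z. \<bar>z - x\<bar> < d \<Longrightarrow> \<bar>f z - f x\<bar> < \<bar>f x\<bar>"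
      using nz(3) unfolding continuous_at_eps_delta dist_real_def by (meson zero_less_abs_iff)
    \<comment> \<open>The neighbourhood stays inside the open period, where \<open>cell\<close> is
      the identity.\<close>
    define e where "e = min d (min x (X - x))"
    have e: "e > 0" using d nz by (simp add: e_def)
    define w where "w = (if f x > 0 then a else b)"
    have const: "(if f (cell X y) > 0 then a else b) = w" if "y \<in> {x - e<..<x + e}" for y
    proof -
      have "\<bar>y - x\<bar> < d" "0 < y" "y < X" using that by (auto simp: e_def abs_less_iff)
      then have "\<bar>f y - f x\<bar> < \<bar>f x\<bar>" "cell X y = y" using d(2) by (auto intro: cell_id)
      then show ?thesis by (auto simp: w_def)
    qed
    obtain N where N: "N \<in> null_sets lebesgue" "{x. V x \<noteq> (if f (cell X x) > 0 then a else b)} \<subseteq> N"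
      using ae unfolding eventually_ae_filter by auto
    have zero: "emeasure lebesgue {y\<in>{x - e<..<x + e}. V y = v} = 0" if "v \<noteq> w" for v
    proof -
      have "{y\<in>{x - e<..<x + e}. V y = v} \<subseteq> N" using N(2) const that by auto
      then have "emeasure lebesgue {y\<in>{x - e<..<x + e}. V y = v} \<le> emeasure lebesgue N"
        using N(1) by (intro emeasure_mono) auto
      then show ?thesis using N(1) by (simp add: null_sets_def)
    qed
    have pos: "0 < emeasure lebesgue {y\<in>{x - e<..<x + e}. V y = a}" "0 < emeasure lebesgue {y\<in>{x - e<..<x + e}. V y = b}"
      using IntD1[OF x] e unfolding transitions_def mem_Collect_eq by blast+
    consider "a \<noteq> w" | "b \<noteq> w" using ab by blast
    then show False
    proof cases
      case 1
      have "(0::ennreal) < 0" using pos(1) unfolding zero[OF 1] .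
      then show False by simp
    next
      case 2
      have "(0::ennreal) < 0" using pos(2) unfolding zero[OF 2] .
      then show False by simp
    qed
  qed
qed

section \<open>Optimality\<close>

text \<open>The radius is positive, so a zero of the solution is a zero of the sine of its angle,
  where the cosine is nonzero.\<close>

lemma trajectory_simple_zeros:
  assumes "pot q" "iv q (sin t) (cos t) x = 0" shows "ivd q (sin t) (cos t) x \<noteq> 0"
proof -
  have th: "prufer q t 0 = t" "pruf q (prufer q t)" by (rule prufer_sol[OF assms(1)])+
  obtain Q where Q: "\<And>x. \<bar>q x\<bar> \<le> Q" using pot_bound[OF assms(1)] by blast
  obtain r where r: "\<forall>x. r x > 0" "iv q (sin t) (cos t) = (\<lambda>x. r x * sin (prufer q t x))"
      "ivd q (sin t) (cos t) = (\<lambda>x. r x * cos (prufer q t x))"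
    using iv_pruf[OF assms(1) th(2) Q] unfolding th(1) by blast
  have "r x \<noteq> 0" using r(1) by (metis less_irrefl)
  then have "sin (prufer q t x) = 0" using assms(2) r(2) by simp
  then have "cos (prufer q t x) \<noteq> 0" using sin_zero_norm_cos_one[of "prufer q t x"] by auto
  then show ?thesis using \<open>r x \<noteq> 0\<close> r(3) by simp
qed

lemma iv_measurable: "pot q \<Longrightarrow> iv q a b \<in> borel_measurable borel"
  using ivp_sol(1)[of q a b] by (auto simp: sol_def intro: lprim_measurable_prim)

lemma trajectory_norm_pos:
  assumes "pot q" "X > 0" shows "integral {0..X} (\<lambda>x. (iv q (sin t) (cos t) x)\<^sup>2) > 0"
proof -
  let ?y = "iv q (sin t) (cos t)"
  have s: "sol q ?y (ivd q (sin t) (cos t))" by (rule ivp_sol(1)[OF assms(1)])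
  then have "continuous_on UNIV ?y" by (auto simp: sol_def intro: lprim_continuous_on)
  then have "continuous_on {0..X} ?y" by (rule continuous_on_subset) simp
  then have c: "continuous_on {0..X} (\<lambda>x. (?y x)\<^sup>2)" by (intro continuous_intros)
  have "finite {x\<in>{0..X}. ?y x = 0}"
    by (rule finite_simple_zeros[OF sol_has_real_derivative[OF s] trajectory_simple_zeros[OF assms(1)]])
  moreover have "infinite {0..X}" using assms(2) by (simp add: infinite_Icc)
  ultimately have "{x\<in>{0..X}. ?y x = 0} \<noteq> {0..X}" by metis
  then have "integral {0..X} (\<lambda>x. (?y x)\<^sup>2) \<noteq> 0" using integral_eq_0_iff[OF c assms(2)] by auto
  moreover have "integral {0..X} (\<lambda>x. (?y x)\<^sup>2) \<ge> 0"
    by (rule integral_nonneg[OF integrable_continuous_real[OF c]]) auto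
  ultimately show ?thesis by simp
qed

lemma pot_times_square_integrable:
  assumes "pot p" "pot q"
  shows "(\<lambda>x. p x * (iv q a b x)\<^sup>2) integrable_on {0..X}"
    "set_integrable lborel {0..X} (\<lambda>x. p x * (iv q a b x)\<^sup>2)"
proof -
  obtain P where P: "\<And>x. \<bar>p x\<bar> \<le> P" using pot_bound[OF assms(1)] by blast
  have P0: "P \<ge> 0" using P[of 0] by linarith
  have cy: "continuous_on UNIV (iv q a b)" using ivp_sol(1)[OF assms(2), of a b] by (auto simp: sol_def intro: lprim_continuous_on)
  obtain K where K: "K \<ge> 0" "\<And>x. x \<in> {0..X} \<Longrightarrow> norm (iv q a b x) \<le> K"
    using locally_bounded_nonneg[OF bounded_on_continuous[OF cy], of 0 X] by blast
  have [measurable]: "iv q a b \<in> borel_measurable borel" "p \<in> borel_measurable borel"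
    using iv_measurable[OF assms(2)] assms(1) by (simp_all add: pot_def)
  have m: "(\<lambda>x. p x * (iv q a b x)\<^sup>2) \<in> borel_measurable borel" by measurable
  have b: "norm (p x * (iv q a b x)\<^sup>2) \<le> P * K\<^sup>2" if "x \<in> {0..X}" for x
  proof -
    have "\<bar>iv q a b x\<bar>\<^sup>2 \<le> K\<^sup>2" using K(2)[OF that] by (intro power_mono) auto
    then have "\<bar>p x\<bar> * \<bar>iv q a b x\<bar>\<^sup>2 \<le> P * K\<^sup>2" using P P0 by (intro mult_mono) auto
    then show ?thesis by (simp add: abs_mult)
  qed
  show "(\<lambda>x. p x * (iv q a b x)\<^sup>2) integrable_on {0..X}" "set_integrable lborel {0..X} (\<lambda>x. p x * (iv q a b x)\<^sup>2)"
    by (rule borel_bounded_integrable_on[OF m b], assumption)+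
qed

text \<open>A one-sided substitute for differentiating the edges. The test energies \<open>a\<close>
  and \<open>b\<close> move at the Hellmann-Feynman rates \<open>N / A\<close> and
  \<open>P / B\<close>, displaced by \<epsilon> to the safe side. Relative to this motion the
  perturbation has a strictly signed integral against the squared trajectory, so
  \<open>rot_perturbation\<close> applies, with sign 1 at the lower edge and -1 at the upper
  one.\<close>

lemma gap_edge_perturbation:
  fixes m :: nat
  assumes U: "hill_periodic X U" and \<eta>: "pot \<eta>" and W: "\<And>s. 0 < s \<Longrightarrow> s \<le> 1 \<Longrightarrow> hill_periodic X (\<lambda>x. U x + s * \<eta> x)"
    and m: "m \<ge> 1"
    and t1: "rot X (\<lambda>x. U x - \<alpha>) t1 = m * pi" and t2: "rot X (\<lambda>x. U x - \<beta>) t2 = m * pi"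
    and ab: "\<alpha> > 0" "\<beta> > 0"
    and A: "A = integral {0..X} (\<lambda>x. (iv (\<lambda>x. U x - \<alpha>) (sin t1) (cos t1) x)\<^sup>2)"
    and B: "B = integral {0..X} (\<lambda>x. (iv (\<lambda>x. U x - \<beta>) (sin t2) (cos t2) x)\<^sup>2)"
    and N: "N = integral {0..X} (\<lambda>x. \<eta> x * (iv (\<lambda>x. U x - \<alpha>) (sin t1) (cos t1) x)\<^sup>2)"
    and P: "P = integral {0..X} (\<lambda>x. \<eta> x * (iv (\<lambda>x. U x - \<beta>) (sin t2) (cos t2) x)\<^sup>2)"
    and pos: "\<beta> * (N / A) < \<alpha> * (P / B)"
  shows "\<exists>d>0. \<forall>s. 0 < s \<and> s < d \<longrightarrow> alpha X (\<lambda>x. U x + s * \<eta> x) m * \<beta> < beta X (\<lambda>x. U x + s * \<eta> x) m * \<alpha>"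
proof -
  interpret U: hill_periodic X U by (rule U)
  let ?u = "iv (\<lambda>x. U x - \<alpha>) (sin t1) (cos t1)" and ?v = "iv (\<lambda>x. U x - \<beta>) (sin t2) (cos t2)"
  have A0: "A > 0" unfolding A by (rule trajectory_norm_pos[OF U.potV U.X])
  have B0: "B > 0" unfolding B by (rule trajectory_norm_pos[OF U.potV U.X])
  \<comment> \<open>Spends half the margin: displacing both rates by \<epsilon> costs
    \<open>(\<alpha> + \<beta>) * \<epsilon>\<close> in the comparison.\<close>
  define \<epsilon> where "\<epsilon> = (\<alpha> * (P / B) - \<beta> * (N / A)) / (2 * (\<alpha> + \<beta>))"
  have e: "\<epsilon> > 0" using pos ab by (simp add: \<epsilon>_def)
  have "(2 * (\<alpha> + \<beta>)) * \<epsilon> = \<alpha> * (P / B) - \<beta> * (N / A)" using ab by (simp add: \<epsilon>_def)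
  then have ie: "\<beta> * (N / A + \<epsilon>) < \<alpha> * (P / B - \<epsilon>)"
    using mult_pos_pos[OF e ab(1)] mult_pos_pos[OF e ab(2)] by (simp add: algebra_simps)
  have shifted: "integral {0..X} (\<lambda>x. \<sigma> * (\<eta> x - c) * (iv q a b x)\<^sup>2)
     = \<sigma> * (integral {0..X} (\<lambda>x. \<eta> x * (iv q a b x)\<^sup>2) - c * integral {0..X} (\<lambda>x. (iv q a b x)\<^sup>2))"
    if q: "pot q" for q a b c \<sigma>
  proof -
    have i1: "(\<lambda>x. \<eta> x * (iv q a b x)\<^sup>2) integrable_on {0..X}" by (rule pot_times_square_integrable(1)[OF \<eta> q])
    have i2: "(\<lambda>x. c * (iv q a b x)\<^sup>2) integrable_on {0..X}" by (rule pot_times_square_integrable(1)[OF pot_const q])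
    have "integral {0..X} (\<lambda>x. \<sigma> * (\<eta> x - c) * (iv q a b x)\<^sup>2) = integral {0..X} (\<lambda>x. \<sigma> * (\<eta> x * (iv q a b x)\<^sup>2 - c * (iv q a b x)\<^sup>2))"
      by (simp add: algebra_simps)
    also have "\<dots> = \<sigma> * (integral {0..X} (\<lambda>x. \<eta> x * (iv q a b x)\<^sup>2) - integral {0..X} (\<lambda>x. c * (iv q a b x)\<^sup>2))"
      by (simp add: Henstock_Kurzweil_Integration.integral_diff[OF i1 i2])
    finally show ?thesis by simp
  qed
  have n1: "integral {0..X} (\<lambda>x. 1 * (\<eta> x - (N / A + \<epsilon>)) * (?u x)\<^sup>2) < 0"
    unfolding shifted[OF U.potV] A[symmetric] N[symmetric] using A0 e by (simp add: distrib_right)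
  have n2: "integral {0..X} (\<lambda>x. - 1 * (\<eta> x - (P / B - \<epsilon>)) * (?v x)\<^sup>2) < 0"
    unfolding shifted[OF U.potV] B[symmetric] P[symmetric] using B0 e by (simp add: left_diff_distrib)
  obtain d1 where d1: "d1 > 0" "\<And>s. 0 < s \<Longrightarrow> s < d1 \<Longrightarrow>
      1 * rot X (\<lambda>x. U x - \<alpha>) t1 < 1 * rot X (\<lambda>x. U x - \<alpha> + s * (\<eta> x - (N / A + \<epsilon>))) t1"
    using rot_perturbation[OF U.potV pot_shift[OF \<eta>] U.X n1] by blast
  obtain d2 where d2: "d2 > 0" "\<And>s. 0 < s \<Longrightarrow> s < d2 \<Longrightarrow>
      - 1 * rot X (\<lambda>x. U x - \<beta>) t2 < - 1 * rot X (\<lambda>x. U x - \<beta> + s * (\<eta> x - (P / B - \<epsilon>))) t2"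
    using rot_perturbation[OF U.potV pot_shift[OF \<eta>] U.X n2] by blast
  show ?thesis
  proof (intro exI[of _ "min 1 (min d1 d2)"] conjI allI impI)
    fix s assume s: "0 < s \<and> s < min 1 (min d1 d2)"
    let ?W = "\<lambda>x. U x + s * \<eta> x"
    interpret W: hill_periodic X ?W by (rule W) (use s in auto)
    define a where "a = \<alpha> + s * (N / A + \<epsilon>)"
    define b where "b = \<beta> + s * (P / B - \<epsilon>)"
    have ra: "(\<lambda>x. U x - \<alpha> + s * (\<eta> x - (N / A + \<epsilon>))) = (\<lambda>x. ?W x - a)" by (simp add: a_def fun_eq_iff algebra_simps)
    have rb: "(\<lambda>x. U x - \<beta> + s * (\<eta> x - (P / B - \<epsilon>))) = (\<lambda>x. ?W x - b)" by (simp add: b_def fun_eq_iff algebra_simps)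
    \<comment> \<open>The trajectory started at \<open>t1\<close> now turns by more than
      \<open>m * pi\<close>, so the lower edge lies at or below \<open>a\<close>; the trajectory
      from \<open>t2\<close> bounds the upper edge dually.\<close>
    have "m * pi < rot X (\<lambda>x. ?W x - a) t1" using d1(2)[of s] s unfolding ra t1 by simp
    then have "m * pi \<le> W.Rmax a" using rmax_attained(2)[OF W.potV W.X0, of a t1] by linarith
    then have ale: "alpha X ?W m \<le> a" using W.alpha_le_iff[OF m] by simp
    have "rot X (\<lambda>x. ?W x - b) t2 < m * pi" using d2(2)[of s] s unfolding rb t2 by simp
    then have "W.Rmin b \<le> m * pi" using rmax_attained(4)[OF W.potV W.X0, of b t2] by linarith
    then have ble: "b \<le> beta X ?W m" using W.le_beta_iff by simp
    have "alpha X ?W m * \<beta> \<le> a * \<beta>" using ale ab by (simp add: mult_right_mono)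
    also have "\<dots> = \<alpha> * \<beta> + s * (\<beta> * (N / A + \<epsilon>))" unfolding a_def by (simp only: distrib_left distrib_right mult_ac)
    also have "\<dots> < \<alpha> * \<beta> + s * (\<alpha> * (P / B - \<epsilon>))" using ie s by (intro add_strict_left_mono mult_strict_left_mono) auto
    also have "\<dots> = b * \<alpha>" unfolding b_def by (simp only: distrib_left distrib_right mult_ac)
    also have "\<dots> \<le> beta X ?W m * \<alpha>" using ble ab by (simp add: mult_right_mono)
    finally show "alpha X ?W m * \<beta> < beta X ?W m * \<alpha>" .
  qed (use d1 d2 in auto)
qed

text \<open>For positive edges the gap ratio is an increasing function of \<open>b / a\<close>,
  which is compared here by cross multiplication.\<close>

lemma gap_ratio_less:
  fixes a b a' b' :: real
  assumes "0 < a" "0 < a'" "a \<le> b" "a' \<le> b'" "a' * b < b' * a"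
  shows "(b - a) / ((a + b) / 2) < (b' - a') / ((a' + b') / 2)"
proof -
  have "(b - a) * ((a' + b') / 2) < (b' - a') * ((a + b) / 2)" using assms(5) by (simp add: field_simps)
  moreover have "0 < (a + b) / 2" "0 < (a' + b') / 2" using assms by auto
  ultimately show ?thesis by (simp only: frac_less_eq[symmetric] pos_divide_less_eq pos_less_divide_eq times_divide_eq_left)
qed

text \<open>The switching function \<open>g v\<^sup>2 - h u\<^sup>2\<close> is built from the gap-edge trajectories \<open>u\<close>, \<open>v\<close>. Moving
  \<open>U\<close> linearly towards the bang-bang potential \<open>S\<close> it prescribes changes \<open>\<beta> / \<alpha>\<close> at a rate
  proportional to the integral of \<open>(S - U) (g v\<^sup>2 - h u\<^sup>2) \<ge> 0\<close>, which therefore has to vanish.\<close>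

lemma maximizer_bang_bang:
  fixes m :: nat
  assumes m: "m \<ge> 1" and X: "X > 0" and Vp: "Vp > 0"
    and max: "linf_local_maximizer (admissible X Vp) (gap_ratio X m) V"
    and gap: "gap_ratio X m V > 0"
  shows "\<exists>f::real \<Rightarrow> real. continuous_on UNIV f \<and> finite {x\<in>{0..X}. f x = 0}
    \<and> (AE x in lborel. V x = (if f (cell X x) > 0 then Vp else 0))"
proof -
  obtain \<delta> where V: "V \<in> admissible X Vp" and \<delta>: "\<delta> > 0"
    "\<And>W. W \<in> admissible X Vp \<Longrightarrow> linf_norm (\<lambda>x. W x - V x) < ereal \<delta> \<Longrightarrow> gap_ratio X m W \<le> gap_ratio X m V"
    using max unfolding linf_local_maximizer_def by blast
  obtain U where Um [measurable]: "U \<in> borel_measurable borel" and Uper: "\<And>x. U (x + X) = U x"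
    and Ub: "\<And>x. 0 \<le> U x" "\<And>x. U x \<le> Vp" and VU: "AE x in lborel. V x = U x"
    using periodic_representative[OF V X Vp] by auto
  have HU: "hill_periodic X U" by (rule hill_periodicI[OF Um Uper Ub X])
  interpret U: hill_periodic X U by (rule HU)
  define \<alpha> where "\<alpha> = alpha X U m"
  define \<beta> where "\<beta> = beta X U m"
  have a0: "\<alpha> > 0" unfolding \<alpha>_def by (rule U.alpha_pos[OF m])
  have le: "\<alpha> \<le> \<beta>" unfolding \<alpha>_def \<beta>_def by (rule U.alpha_le_beta[OF m])
  have G: "gap_ratio X m V = (\<beta> - \<alpha>) / ((\<alpha> + \<beta>) / 2)"
    using gap_ratio_eq[OF HU VU m] by (simp add: \<alpha>_def \<beta>_def)
  have lt: "\<alpha> < \<beta>" using gap le a0 unfolding G by (cases "\<alpha> = \<beta>") auto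
  obtain t1 where t1: "rot X (\<lambda>x. U x - \<alpha>) t1 = m * pi"
    using rmax_attained(1)[OF U.potV[of \<alpha>] U.X0] U.rmax_alpha[OF m] by (auto simp: \<alpha>_def)
  obtain t2 where t2: "rot X (\<lambda>x. U x - \<beta>) t2 = m * pi"
    using rmax_attained(3)[OF U.potV[of \<beta>] U.X0] U.rmin_beta[of m] by (auto simp: \<beta>_def)
  define u where "u = iv (\<lambda>x. U x - \<alpha>) (sin t1) (cos t1)"
  define v where "v = iv (\<lambda>x. U x - \<beta>) (sin t2) (cos t2)"
  define A where "A = integral {0..X} (\<lambda>x. (u x)\<^sup>2)"
  define B where "B = integral {0..X} (\<lambda>x. (v x)\<^sup>2)"
  have A0: "A > 0" unfolding A_def u_def by (rule trajectory_norm_pos[OF U.potV X])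
  have B0: "B > 0" unfolding B_def v_def by (rule trajectory_norm_pos[OF U.potV X])
  \<comment> \<open>With these weights the integral of \<open>\<eta> * f\<close> over a period
    equals \<open>\<alpha> * (P / B) - \<beta> * (N / A)\<close>, the quantity whose sign controls
    \<beta> / \<alpha> to first order.\<close>
  define f where "f = (\<lambda>x. \<alpha> / B * (v x)\<^sup>2 - \<beta> / A * (u x)\<^sup>2)"
  have su: "sol (\<lambda>x. U x - \<alpha>) u (ivd (\<lambda>x. U x - \<alpha>) (sin t1) (cos t1))"
    unfolding u_def by (rule ivp_sol(1)[OF U.potV])
  have sv: "sol (\<lambda>x. U x - \<beta>) v (ivd (\<lambda>x. U x - \<beta>) (sin t2) (cos t2))"
    unfolding v_def by (rule ivp_sol(1)[OF U.potV])
  have cf: "continuous_on UNIV f" unfolding f_def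
    by (intro continuous_intros lprim_continuous_on[OF conjunct1[OF su[unfolded sol_def]]]
        lprim_continuous_on[OF conjunct1[OF sv[unfolded sol_def]]])
  have fin: "finite {x\<in>{0..X}. f x = 0}" unfolding f_def
    by (rule finite_zeros_quadratic[OF su sv])
       (use lt a0 A0 B0 trajectory_simple_zeros[OF U.potV] in \<open>auto simp: u_def v_def\<close>)
  have fm [measurable]: "f \<in> borel_measurable borel" by (rule borel_measurable_continuous_onI[OF cf])
  define S where "S = (\<lambda>x. if f (cell X x) > 0 then Vp else 0)"
  have Sm [measurable]: "S \<in> borel_measurable borel" unfolding S_def by measurable
  have Sb: "0 \<le> S x" "S x \<le> Vp" and Sper: "S (x + X) = S x" for x
    using Vp by (auto simp: S_def cell_periodic[OF X])
  define \<eta> where "\<eta> = (\<lambda>x. S x - U x)"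
  have \<eta>m [measurable]: "\<eta> \<in> borel_measurable borel" unfolding \<eta>_def by measurable
  have \<eta>b: "\<bar>\<eta> x\<bar> \<le> Vp" for x using Sb[of x] Ub[of x] by (auto simp: \<eta>_def)
  have \<eta>: "pot \<eta>" using \<eta>m \<eta>b unfolding pot_def by blast
  have Wb: "0 \<le> U x + s * \<eta> x" "U x + s * \<eta> x \<le> Vp" if s: "0 < s" "s \<le> 1" for s x
  proof -
    have eq: "U x + s * \<eta> x = (1 - s) * U x + s * S x" by (simp add: \<eta>_def algebra_simps)
    show "0 \<le> U x + s * \<eta> x" unfolding eq using s Ub[of x] Sb[of x] by simp
    have "(1 - s) * U x + s * S x \<le> (1 - s) * Vp + s * Vp"
      using s Ub[of x] Sb[of x] by (intro add_mono mult_left_mono) auto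
    then show "U x + s * \<eta> x \<le> Vp" unfolding eq by (simp add: algebra_simps)
  qed
  have Wper: "U (x + X) + s * \<eta> (x + X) = U x + s * \<eta> x" for s x by (simp add: \<eta>_def Uper Sper)
  have HW: "hill_periodic X (\<lambda>x. U x + s * \<eta> x)" if s: "0 < s" "s \<le> 1" for s
    by (rule hill_periodicI[where U="\<lambda>x. U x + s * \<eta> x", OF _ Wper Wb[OF s] X]) measurable
  have Wadm: "(\<lambda>x. U x + s * \<eta> x) \<in> admissible X Vp" if s: "0 < s" "s \<le> 1" for s
  proof -
    have "(\<lambda>x. U x + s * \<eta> x) \<in> borel_measurable borel" by measurable
    then show ?thesis using Wb[OF s] Wper by (simp add: admissible_def measurable_completion)
  qed
  define N where "N = integral {0..X} (\<lambda>x. \<eta> x * (u x)\<^sup>2)"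
  define P where "P = integral {0..X} (\<lambda>x. \<eta> x * (v x)\<^sup>2)"
  have opt: "\<alpha> * (P / B) \<le> \<beta> * (N / A)"
  proof (rule ccontr)
    assume "\<not> ?thesis"
    then have pos: "\<beta> * (N / A) < \<alpha> * (P / B)" by simp
    obtain d where d: "d > 0" "\<And>s. 0 < s \<Longrightarrow> s < d \<Longrightarrow> alpha X (\<lambda>x. U x + s * \<eta> x) m * \<beta> < beta X (\<lambda>x. U x + s * \<eta> x) m * \<alpha>"
      using gap_edge_perturbation[OF HU \<eta> HW m t1 t2 a0 _ A_def[unfolded u_def] B_def[unfolded v_def]
          N_def[unfolded u_def] P_def[unfolded v_def] pos] a0 lt by auto
    \<comment> \<open>Since \<eta> is bounded by \<open>Vp\<close>, the third bound makes the
      distance to \<open>V\<close> at most half of \<delta>.\<close>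
    define s where "s = min (d / 2) (min (1 / 2) (\<delta> / (2 * Vp)))"
    have "\<delta> / (2 * Vp) > 0" using \<delta>(1) Vp by simp
    then have s: "0 < s" "s < d" "s \<le> 1" "s \<le> \<delta> / (2 * Vp)" using d(1) by (auto simp: s_def)
    have "s * Vp \<le> \<delta> / (2 * Vp) * Vp" using s(4) Vp by (intro mult_right_mono) auto
    then have sV: "s * Vp < \<delta>" using Vp \<delta>(1) by simp
    let ?W = "\<lambda>x. U x + s * \<eta> x"
    interpret W: hill_periodic X ?W by (rule HW[OF s(1,3)])
    have "linf_norm (\<lambda>x. ?W x - V x) \<le> ereal (s * Vp)"
      unfolding linf_norm_def
    proof (rule esssup_I)
      have "V \<in> borel_measurable lebesgue" using V by (simp add: admissible_def)
      moreover have "?W \<in> borel_measurable lebesgue" using Wadm[OF s(1,3)] by (simp add: admissible_def)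
      ultimately show "(\<lambda>x. ereal \<bar>?W x - V x\<bar>) \<in> borel_measurable lebesgue" by measurable
      have "AE x in lborel. ereal \<bar>?W x - V x\<bar> \<le> ereal (s * Vp)"
        using VU by eventually_elim (use s(1) \<eta>b in \<open>simp add: abs_mult\<close>)
      then show "AE x in lebesgue. ereal \<bar>?W x - V x\<bar> \<le> ereal (s * Vp)" by (simp add: AE_completion_iff)
    qed
    also have "\<dots> < ereal \<delta>" using sV by simp
    finally have "gap_ratio X m ?W \<le> gap_ratio X m V" by (rule \<delta>(2)[OF Wadm[OF s(1,3)]])
    moreover have "gap_ratio X m ?W = (beta X ?W m - alpha X ?W m) / ((alpha X ?W m + beta X ?W m) / 2)"
      by (rule gap_ratio_eq[OF HW[OF s(1,3)] _ m]) simp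
    moreover have "(\<beta> - \<alpha>) / ((\<alpha> + \<beta>) / 2) < (beta X ?W m - alpha X ?W m) / ((alpha X ?W m + beta X ?W m) / 2)"
      by (rule gap_ratio_less[OF a0 W.alpha_pos[OF m] le W.alpha_le_beta[OF m] d(2)[OF s(1,2)]])
    ultimately show False unfolding G by simp
  qed
  have iu: "(\<lambda>x. \<eta> x * (u x)\<^sup>2) integrable_on {0..X}" "set_integrable lborel {0..X} (\<lambda>x. \<eta> x * (u x)\<^sup>2)"
    unfolding u_def by (rule pot_times_square_integrable[OF \<eta> U.potV])+
  have iv: "(\<lambda>x. \<eta> x * (v x)\<^sup>2) integrable_on {0..X}" "set_integrable lborel {0..X} (\<lambda>x. \<eta> x * (v x)\<^sup>2)"
    unfolding v_def by (rule pot_times_square_integrable[OF \<eta> U.potV])+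
  have fe: "(\<lambda>x. \<eta> x * f x) = (\<lambda>x. \<alpha> / B * (\<eta> x * (v x)\<^sup>2) - \<beta> / A * (\<eta> x * (u x)\<^sup>2))"
    by (simp add: f_def fun_eq_iff algebra_simps)
  have "integral {0..X} (\<lambda>x. \<eta> x * f x) = \<alpha> / B * P - \<beta> / A * N"
    unfolding fe P_def N_def
    by (rule integral_unique[OF has_integral_diff[OF has_integral_mult_right has_integral_mult_right]])
       (intro integrable_integral iu iv)+
  then have int_le: "integral {0..X} (\<lambda>x. \<eta> x * f x) \<le> 0" using opt by simp
  \<comment> \<open>Half-open, because \<open>cell X X\<close> is 0 and at \<open>X\<close> itself
    the sign of \<eta> is not tied to that of \<open>f\<close>.\<close>
  have sint: "set_integrable lborel {0..<X} (\<lambda>x. \<eta> x * f x)"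
  proof (rule set_integrable_subset)
    show "set_integrable lborel {0..X} (\<lambda>x. \<eta> x * f x)"
      unfolding fe by (intro set_integral_diff set_integrable_mult_right iu iv)
  qed auto
  have nonneg: "0 \<le> \<eta> x * f x" if "x \<in> {0..<X}" for x
  proof -
    have "cell X x = x" using that by (intro cell_id) auto
    then have "\<eta> x = (if f x > 0 then Vp - U x else - U x)" by (simp add: \<eta>_def S_def)
    then show ?thesis using Ub[of x] by (auto simp: mult_nonneg_nonpos)
  qed
  have "(LINT x : {0..<X} | lborel. \<eta> x * f x) = integral {0..<X} (\<lambda>x. \<eta> x * f x)"
    by (rule set_borel_integral_eq_integral(2)[OF sint])
  also have "\<dots> = integral {0..X} (\<lambda>x. \<eta> x * f x)"
    by (rule integral_spike_set) (rule negligible_subset[of "{X}"]; auto)+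
  finally have "(LINT x : {0..<X} | lborel. \<eta> x * f x) \<le> 0" using int_le by simp
  moreover have "(LINT x : {0..<X} | lborel. \<eta> x * f x) \<ge> 0"
    unfolding set_lebesgue_integral_def by (rule integral_nonneg_AE) (use nonneg in \<open>auto simp: indicator_def\<close>)
  ultimately have "(LINT x : {0..<X} | lborel. \<eta> x * f x) = 0" by simp
  then have "AE x in lborel. indicator {0..<X} x *\<^sub>R (\<eta> x * f x) = 0"
    unfolding set_lebesgue_integral_def
    by (subst (asm) integral_nonneg_eq_0_iff_AE)
       (use sint nonneg in \<open>auto simp: set_integrable_def indicator_def\<close>)
  \<comment> \<open>Off this finite, hence null, set the vanishing product leaves \<eta> equal to
    0.\<close>
  moreover have "AE x in lborel. x \<notin> {x\<in>{0..X}. f x = 0}"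
    by (rule AE_not_in[OF finite_imp_null_set_lborel[OF fin]])
  ultimately have "AE x in lborel. x \<in> {0..<X} \<longrightarrow> U x = S x"
    by eventually_elim (auto simp: \<eta>_def)
  then have "AE x in lborel. U (cell X x) = S (cell X x)" by (rule AE_periodic_extension[OF _ X])
  with VU have "AE x in lborel. V x = (if f (cell X x) > 0 then Vp else 0)"
  proof eventually_elim
    case (elim x)
    have "U (x + of_int n * X) = U x" for n :: int
    proof (induction n rule: int_induct[of _ 0])
      case (step1 i)
      then show ?case using Uper[of "x + of_int i * X"] by (simp add: algebra_simps)
    next
      case (step2 i)
      then show ?case using Uper[of "x + of_int (i - 1) * X"] by (simp add: algebra_simps)
    qed simp
    from this[of "- \<lfloor>x / X\<rfloor>"] have "U (cell X x) = U x" by (simp add: cell_def)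
    moreover have "cell X (cell X x) = cell X x" by (rule cell_id) (use cell_bounds[OF X] in auto)
    ultimately show ?case using elim by (simp add: S_def)
  qed
  with cf fin show ?thesis by blast
qed

theorem theorem2p4:
  fixes m :: nat and X Vp :: real and V :: "real \<Rightarrow> real"
  assumes "m \<ge> 1" and "X > 0" and "Vp > 0"
    and "linf_local_maximizer (admissible X Vp) (gap_ratio X m) V"
    and "gap_ratio X m V > 0"
  shows "finite (transitions V 0 Vp \<inter> {0..<X})
    \<and> (\<exists>W. periodic_step_function X W \<and> range W \<subseteq> {0, Vp} \<and> (AE x in lebesgue. V x = W x))"
proof -
  obtain f :: "real \<Rightarrow> real" where f: "continuous_on UNIV f" "finite {x\<in>{0..X}. f x = 0}"
      "AE x in lborel. V x = (if f (cell X x) > 0 then Vp else 0)"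
    using maximizer_bang_bang[OF assms] by blast
  have ae: "AE x in lebesgue. V x = (if f (cell X x) > 0 then Vp else 0)" using f(3) by (simp add: AE_completion_iff)
  have "transitions V 0 Vp \<inter> {0..<X} \<subseteq> insert 0 {x\<in>{0..X}. f x = 0}"
    by (rule transitions_of_sign[where f=f, OF assms(2) f(1) _ ae]) (use assms(3) in auto)
  then have "finite (transitions V 0 Vp \<inter> {0..<X})" using f(2) finite_subset by blast
  moreover have "periodic_step_function X (\<lambda>x. if f (cell X x) > 0 then Vp else 0)"
    by (rule step_function_of_sign[OF assms(2) f(1,2)])
  ultimately show ?thesis using ae by (intro conjI exI[of _ "\<lambda>x. if f (cell X x) > 0 then Vp else 0"]) auto
qed

end
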